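(* Let $n\in \mathbb{Z}_{\ge 1}$. Let $H$ be a compact metrizable space and let $v_1,\dots,v_{n+1}$ be $n+1$ pairwise distinct points of $H$. Let $\mathscr{S}$ be any one of $\mathscr{C}$, $\mathscr{P}$, $\mathscr{G}$, $\mathscr{Z}$. Let $(X_1,d_1),\dots,(X_{n+1},d_{n+1})$ be elements of $\mathscr{S}$ such that $d_{GH}((X_i,d_i),(X_j,d_j))>0$ for all distinct $i,j$. Then there exists a topological embedding $\Phi: H\to \mathscr{S}$ (with $\mathscr{S}$ carrying the topology of the Gromov--Hausdorff distance) such that $\Phi(v_i)=(X_i,d_i)$ for all $i\in\{1,\dots,n+1\}$.
   Context: For metric spaces $(X,d),(Y,e)$, the Gromov--Hausdorff distance $d_{GH}((X,d),(Y,e))$ is the infimum of the Hausdorff distances $d_H(i(X),j(Y))$ over all metric spaces $(Z,h)$ and isometric embeddings $i:X\to Z$, $j:Y\to Z$. $\mathscr{M}$ denotes the set of isometry classes of non-empty compact metric spaces, equipped with the metric $d_{GH}$ (the Gromov--Hausdorff space). A geodesic from $x$ to $y$ in $(X,d)$ is a map $\gamma:[0,1]\to X$ with $\gamma(0)=x$, $\gamma(1)=y$ and $d(\gamma(s),\gamma(t))=|s-t|\,d(x,y)$ for all $s,t$; a geodesic space is one in which any two points are joined by a geodesic. A CAT(0) space is a geodesic space in which, for every geodesic triangle $\triangle$ and all $x,y\in\triangle$, $d(x,y)\le |\bar x-\bar y|$ where $\bar x,\bar y$ are the comparison points in a Euclidean comparison triangle in $\mathbb{R}^2$. $\mathscr{C}$,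 $\mathscr{P}$, $\mathscr{G}$, $\mathscr{Z}$ denote the subsets of $\mathscr{M}$ consisting of all compact metric spaces that are, respectively, connected, path-connected, geodesic, and CAT(0). *)

theory Defs
  imports "HOL-Analysis.Analysis"
begin

text \<open>A (non-empty compact) metric space is represented by a carrier set X and a distance d
  with Metric_space X d (library locale).  Isometry classes are handled via representatives.\<close>

definition isometric :: "'a set \<Rightarrow> ('a \<Rightarrow> 'a \<Rightarrow> real) \<Rightarrow> 'b set \<Rightarrow> ('b \<Rightarrow> 'b \<Rightarrow> real) \<Rightarrow> bool" where
  "isometric X d Y e \<longleftrightarrow> (\<exists>f. bij_betw f X Y \<and> (\<forall>x\<in>X. \<forall>y\<in>X. e (f x) (f y) = d x y))"

definition isometric_embedding :: "'a set \<Rightarrow> ('a \<Rightarrow> 'a \<Rightarrow> real) \<Rightarrow> 'c set \<Rightarrow> ('c \<Rightarrow> 'c \<Rightarrow> real) \<Rightarrow> ('a \<Rightarrow> 'c) \<Rightarrow> bool" where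
  "isometric_embedding X d Z h i \<longleftrightarrow> i ` X \<subseteq> Z \<and> (\<forall>x\<in>X. \<forall>y\<in>X. h (i x) (i y) = d x y)"

definition hausdorff_distance :: "('c \<Rightarrow> 'c \<Rightarrow> real) \<Rightarrow> 'c set \<Rightarrow> 'c set \<Rightarrow> real" where
  "hausdorff_distance h A B = Inf {r. r > 0 \<and> (\<forall>a\<in>A. \<exists>b\<in>B. h a b < r) \<and> (\<forall>b\<in>B. \<exists>a\<in>A. h a b < r)}"

text \<open>Gromov--Hausdorff distance.  The ambient space Z ranges over all metric spaces whose
  points lie in the type 'a + 'b; this loses no generality, since one may always replace Z by
  i(X) \<union> j(Y), which injects into 'a + 'b.\<close>
definition GH_dist :: "'a set \<Rightarrow> ('a \<Rightarrow> 'a \<Rightarrow> real) \<Rightarrow> 'b set \<Rightarrow> ('b \<Rightarrow> 'b \<Rightarrow> real) \<Rightarrow> real" where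
  "GH_dist X d Y e = Inf {hausdorff_distance h (i ` X) (j ` Y) | (Z :: ('a + 'b) set) h i j.
      Metric_space Z h \<and> isometric_embedding X d Z h i \<and> isometric_embedding Y e Z h j}"

definition in_GH_space :: "'a set \<Rightarrow> ('a \<Rightarrow> 'a \<Rightarrow> real) \<Rightarrow> bool" where
  "in_GH_space X d \<longleftrightarrow> X \<noteq> {} \<and> Metric_space X d \<and> compact_space (Metric_space.mtopology X d)"

definition is_geodesic :: "'a set \<Rightarrow> ('a \<Rightarrow> 'a \<Rightarrow> real) \<Rightarrow> (real \<Rightarrow> 'a) \<Rightarrow> 'a \<Rightarrow> 'a \<Rightarrow> bool" where
  "is_geodesic X d \<gamma> x y \<longleftrightarrow> \<gamma> ` {0..1} \<subseteq> X \<and> \<gamma> 0 = x \<and> \<gamma> 1 = y \<and>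
     (\<forall>s\<in>{0..1}. \<forall>t\<in>{0..1}. d (\<gamma> s) (\<gamma> t) = \<bar>s - t\<bar> * d x y)"

definition geodesic_space :: "'a set \<Rightarrow> ('a \<Rightarrow> 'a \<Rightarrow> real) \<Rightarrow> bool" where
  "geodesic_space X d \<longleftrightarrow> (\<forall>x\<in>X. \<forall>y\<in>X. \<exists>\<gamma>. is_geodesic X d \<gamma> x y)"

text \<open>CAT(0): for every geodesic triangle with sides g1 (p to q), g2 (q to r), g3 (r to p)
  and every Euclidean comparison triangle P Q R in the plane, the distance between any two
  points of the triangle is at most the distance of their comparison points (the point g(s)
  on a side from A to B has comparison point A + s(B - A)).\<close>
definition CAT0 :: "'a set \<Rightarrow> ('a \<Rightarrow> 'a \<Rightarrow> real) \<Rightarrow> bool" where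
  "CAT0 X d \<longleftrightarrow> geodesic_space X d \<and>
    (\<forall>p q r g1 g2 g3 (P::real^2) Q R.
       p \<in> X \<and> q \<in> X \<and> r \<in> X \<and>
       is_geodesic X d g1 p q \<and> is_geodesic X d g2 q r \<and> is_geodesic X d g3 r p \<and>
       dist P Q = d p q \<and> dist Q R = d q r \<and> dist R P = d r p \<longrightarrow>
       (\<forall>(g, A, B) \<in> {(g1, P, Q), (g2, Q, R), (g3, R, P)}.
        \<forall>(g', A', B') \<in> {(g1, P, Q), (g2, Q, R), (g3, R, P)}.
        \<forall>s\<in>{0..1}. \<forall>t\<in>{0..1}.
          d (g s) (g' t) \<le> dist (A + s *\<^sub>R (B - A)) (A' + t *\<^sub>R (B' - A'))))"

definition GH_connected :: "'a set \<Rightarrow> ('a \<Rightarrow> 'a \<Rightarrow> real) \<Rightarrow> bool" where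
  "GH_connected X d \<longleftrightarrow> in_GH_space X d \<and> connected_space (Metric_space.mtopology X d)"

definition GH_path_connected :: "'a set \<Rightarrow> ('a \<Rightarrow> 'a \<Rightarrow> real) \<Rightarrow> bool" where
  "GH_path_connected X d \<longleftrightarrow> in_GH_space X d \<and> path_connected_space (Metric_space.mtopology X d)"

definition GH_geodesic :: "'a set \<Rightarrow> ('a \<Rightarrow> 'a \<Rightarrow> real) \<Rightarrow> bool" where
  "GH_geodesic X d \<longleftrightarrow> in_GH_space X d \<and> geodesic_space X d"

definition GH_CAT0 :: "'a set \<Rightarrow> ('a \<Rightarrow> 'a \<Rightarrow> real) \<Rightarrow> bool" where
  "GH_CAT0 X d \<longleftrightarrow> in_GH_space X d \<and> CAT0 X d"

text \<open>Topological embedding of the topological space H into the subspace S of the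
  Gromov--Hausdorff space (isometry classes, metric GH_dist), given by representatives Phi h.\<close>
definition GH_topological_embedding ::
  "'h topology \<Rightarrow> ('a set \<Rightarrow> ('a \<Rightarrow> 'a \<Rightarrow> real) \<Rightarrow> bool) \<Rightarrow> ('h \<Rightarrow> 'a set \<times> ('a \<Rightarrow> 'a \<Rightarrow> real)) \<Rightarrow> bool" where
  "GH_topological_embedding H S \<Phi> \<longleftrightarrow>
     (\<forall>x\<in>topspace H. S (fst (\<Phi> x)) (snd (\<Phi> x))) \<and>
     (\<forall>x\<in>topspace H. \<forall>y\<in>topspace H. x \<noteq> y \<longrightarrow>
        \<not> isometric (fst (\<Phi> x)) (snd (\<Phi> x)) (fst (\<Phi> y)) (snd (\<Phi> y))) \<and>
     (\<forall>x\<in>topspace H. \<forall>\<epsilon>>0. \<exists>U. openin H U \<and> x \<in> U \<and>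
        (\<forall>y\<in>U. GH_dist (fst (\<Phi> x)) (snd (\<Phi> x)) (fst (\<Phi> y)) (snd (\<Phi> y)) < \<epsilon>)) \<and>
     (\<forall>x\<in>topspace H. \<forall>U. openin H U \<and> x \<in> U \<longrightarrow> (\<exists>\<epsilon>>0. \<forall>y\<in>topspace H.
        GH_dist (fst (\<Phi> x)) (snd (\<Phi> x)) (fst (\<Phi> y)) (snd (\<Phi> y)) < \<epsilon> \<longrightarrow> y \<in> U))"

end

theory Submission
  imports Defs
begin

text \<open>
  Let $\Phi(h)$ be the wedge at one common base point of the rescaled spaces
  $\lambda_i(h) X_i$, where $\lambda_i(v_j) = \delta_{ij}$, and of countably many segments
  (arms): $M_t$ arms of length $\rho(h) 4^{-t} (1 + u_{\pi(t)}(h)) / 2$ for each level $t$. Here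
  $\rho$ vanishes exactly at the $v_i$, the functions $u_j$ separate the points of $H$, and $\pi$
  takes every value infinitely often. All four classes are closed under rescaling and under such
  wedges, and $\Phi$ is continuous because the scales are. For injectivity choose $M_t$ larger
  than the number of $2 \cdot 16^{-t}$-separated points that fit into the $X_i$ together.
  Counting $2 \epsilon$-separated points in a closed ball of radius $\epsilon$ then recognises
  the base point and, for all large $t$, the arm length of level $t$; these determine $\rho(h)$
  and all $u_j(h)$. Since $H$ is compact, the continuous injection is an embedding.
\<close>

subsection \<open>Gromov--Hausdorff distance and correspondences\<close>

text \<open>One obstacle is that an isometry between two wedges need not respect the pieces: the
  \<open>X i\<close> are arbitrary, may contain arms themselves, and the base point may be moved. So
  arms are detected by their number alone. Rescaling by a factor at most 1 does not create separated
  points, hence one bound \<open>N t\<close> on the \<open>2 * (1/16) ^ t\<close>-packing numbers of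
  the unscaled pieces serves every \<open>h\<close>. Arms of level \<open>t\<close> are at least
  \<open>\<rho> / 2\<close> times \<open>(1/4) ^ t\<close> long, and \<open>(1/16) ^ t\<close>, the
  square of \<open>(1/4) ^ t\<close>, lies below that for all large \<open>t\<close>, whatever the
  positive value of \<open>\<rho>\<close>. Hence the two rates 1/4 and 1/16, and hence only the tail
  of the sequence of lengths is recovered.

  Another obstacle is that all values of \<open>\<Phi>\<close> must live in the given type
  \<open>'a\<close>. Two nonisometric nonempty spaces cannot both consist of one point, and a
  connected metric space with two points has at least as many points as there are reals. So
  \<open>'a\<close> is infinite, has as many elements as its square, and offers room for countably
  many disjoint copies of itself.\<close>

lemma (in Metric_space) continuous_map_dist:
  assumes "continuous_map T mtopology f" "continuous_map T mtopology g"
  shows "continuous_map T euclideanreal (\<lambda>x. d (f x) (g x))"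
  using continuous_map_mdist[of T "metric (M, d)" f g] assms
  by (simp add: mtopology_of mdist_metric)

text \<open>A correspondence of distortion at most \<open>\<epsilon>\<close>. It mentions no ambient
  space, so it is easy to exhibit and to compose. Up to a factor 2 it is equivalent to a bound on
  \<open>GH_dist\<close>, which is all that a topological statement requires.\<close>

definition GH_close ::
  "real \<Rightarrow> 'a set \<Rightarrow> ('a \<Rightarrow> 'a \<Rightarrow> real) \<Rightarrow> 'b set \<Rightarrow> ('b \<Rightarrow> 'b \<Rightarrow> real) \<Rightarrow> bool" where
  "GH_close \<epsilon> X d Y e \<longleftrightarrow> (\<exists>R. (\<forall>x\<in>X. \<exists>y\<in>Y. R x y) \<and> (\<forall>y\<in>Y. \<exists>x\<in>X. R x y) \<and>
     (\<forall>x\<in>X. \<forall>x'\<in>X. \<forall>y\<in>Y. \<forall>y'\<in>Y. R x y \<and> R x' y' \<longrightarrow> \<bar>d x x' - e y y'\<bar> \<le> \<epsilon>))"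

lemma GH_close_sym: "GH_close \<epsilon> X d Y e \<Longrightarrow> GH_close \<epsilon> Y e X d"
  unfolding GH_close_def
  by (elim exE conjE, rule_tac x="\<lambda>y x. R x y" in exI) (auto simp: abs_minus_commute)

lemma GH_close_mono:
  assumes "GH_close \<epsilon> X d Y e" "\<epsilon> \<le> \<delta>" shows "GH_close \<delta> X d Y e"
proof -
  obtain R where R: "\<forall>x\<in>X. \<exists>y\<in>Y. R x y" "\<forall>y\<in>Y. \<exists>x\<in>X. R x y"
    and dis: "\<And>x x' y y'. \<lbrakk>x\<in>X; x'\<in>X; y\<in>Y; y'\<in>Y; R x y; R x' y'\<rbrakk> \<Longrightarrow> \<bar>d x x' - e y y'\<bar> \<le> \<epsilon>"
    using assms(1) unfolding GH_close_def by metis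
  show ?thesis
    unfolding GH_close_def
    by (rule exI[of _ R], intro conjI R ballI impI order_trans[OF dis assms(2)]) auto
qed

lemma GH_close_trans:
  assumes "GH_close \<epsilon> X d Y e" "GH_close \<delta> Y e Z h"
  shows "GH_close (\<epsilon> + \<delta>) X d Z h"
proof -
  obtain R where R: "\<forall>x\<in>X. \<exists>y\<in>Y. R x y" "\<forall>y\<in>Y. \<exists>x\<in>X. R x y"
    "\<And>x x' y y'. \<lbrakk>x\<in>X; x'\<in>X; y\<in>Y; y'\<in>Y; R x y; R x' y'\<rbrakk> \<Longrightarrow> \<bar>d x x' - e y y'\<bar> \<le> \<epsilon>"
    using assms(1) unfolding GH_close_def by metis
  obtain S where S: "\<forall>x\<in>Y. \<exists>y\<in>Z. S x y" "\<forall>y\<in>Z. \<exists>x\<in>Y. S x y"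
    "\<And>x x' y y'. \<lbrakk>x\<in>Y; x'\<in>Y; y\<in>Z; y'\<in>Z; S x y; S x' y'\<rbrakk> \<Longrightarrow> \<bar>e x x' - h y y'\<bar> \<le> \<delta>"
    using assms(2) unfolding GH_close_def by metis
  have "\<bar>d x x' - h z z'\<bar> \<le> \<epsilon> + \<delta>"
    if "x\<in>X" "x'\<in>X" "z\<in>Z" "z'\<in>Z" "y\<in>Y" "y'\<in>Y" "R x y" "S y z" "R x' y'" "S y' z'"
    for x x' y y' z z'
    using R(3)[of x x' y y'] S(3)[of y y' z z'] that by linarith
  then show ?thesis
    unfolding GH_close_def
    by (intro exI[of _ "\<lambda>x z. \<exists>y\<in>Y. R x y \<and> S y z"] conjI) (use R(1,2) S(1,2) in \<open>meson+\<close>)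
qed

lemma isometric_imp_GH_close: "isometric X d Y e \<Longrightarrow> GH_close 0 X d Y e"
  unfolding isometric_def GH_close_def bij_betw_def
  by (elim exE conjE, rule_tac x="\<lambda>x y. y = f x" in exI) auto

lemma isometric_sym:
  assumes "isometric X d Y e" shows "isometric Y e X d"
proof -
  obtain f where f: "bij_betw f X Y" "\<forall>x\<in>X. \<forall>y\<in>X. e (f x) (f y) = d x y"
    using assms unfolding isometric_def by blast
  have "d (inv_into X f x) (inv_into X f y) = e x y" if "x \<in> Y" "y \<in> Y" for x y
  proof -
    have "inv_into X f x \<in> X" "inv_into X f y \<in> X"
      using bij_betw_apply[OF bij_betw_inv_into[OF f(1)]] that by auto
    then have "e (f (inv_into X f x)) (f (inv_into X f y)) = d (inv_into X f x) (inv_into X f y)"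
      using f(2) by blast
    then show ?thesis using that by (simp add: bij_betw_inv_into_right[OF f(1)])
  qed
  then show ?thesis
    unfolding isometric_def using bij_betw_inv_into[OF f(1)] by blast
qed

lemma isometric_trans:
  assumes "isometric X d Y e" "isometric Y e Z h" shows "isometric X d Z h"
proof -
  obtain f g where f: "bij_betw f X Y" "\<forall>x\<in>X. \<forall>y\<in>X. e (f x) (f y) = d x y"
    and g: "bij_betw g Y Z" "\<forall>x\<in>Y. \<forall>y\<in>Y. h (g x) (g y) = e x y"
    using assms unfolding isometric_def by blast
  then have "bij_betw (g \<circ> f) X Z \<and> (\<forall>x\<in>X. \<forall>y\<in>X. h ((g \<circ> f) x) ((g \<circ> f) y) = d x y)"
    using bij_betw_trans[OF f(1) g(1)] bij_betw_apply[OF f(1)] by simp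
  then show ?thesis unfolding isometric_def by blast
qed

text \<open>The four hypotheses are the mixed triangle inequalities, two with the odd point at an
  end and two with it in the middle. Strict positivity of \<open>c\<close> keeps points of the two
  halves apart, so that a metric results and not just a pseudometric.\<close>

lemma Metric_space_coupling:
  fixes X :: "'a set" and Y :: "'b set"
  assumes "Metric_space X d" "Metric_space Y e"
    and pos: "\<And>x y. x \<in> X \<Longrightarrow> y \<in> Y \<Longrightarrow> c x y > 0"
    and t1: "\<And>x x' y. \<lbrakk>x \<in> X; x' \<in> X; y \<in> Y\<rbrakk> \<Longrightarrow> c x y \<le> d x x' + c x' y"
    and t2: "\<And>x y y'. \<lbrakk>x \<in> X; y \<in> Y; y' \<in> Y\<rbrakk> \<Longrightarrow> c x y \<le> c x y' + e y' y"
    and t3: "\<And>x x' y. \<lbrakk>x \<in> X; x' \<in> X; y \<in> Y\<rbrakk> \<Longrightarrow> d x x' \<le> c x y + c x' y"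
    and t4: "\<And>x y y'. \<lbrakk>x \<in> X; y \<in> Y; y' \<in> Y\<rbrakk> \<Longrightarrow> e y y' \<le> c x y + c x y'"
  shows "\<exists>h. Metric_space (Inl ` X \<union> Inr ` Y) h \<and>
      (\<forall>x x'. h (Inl x) (Inl x') = d x x') \<and> (\<forall>y y'. h (Inr y) (Inr y') = e y y') \<and>
      (\<forall>x\<in>X. \<forall>y\<in>Y. h (Inl x) (Inr y) = c x y)"
proof -
  interpret X: Metric_space X d by fact
  interpret Y: Metric_space Y e by fact
  \<comment> \<open>The absolute value matters outside the carriers only:
    \<open>Metric_space\<close> demands nonnegativity for all arguments of the type.\<close>
  define h where "h u v = (case u of
      Inl x \<Rightarrow> (case v of Inl x' \<Rightarrow> d x x' | Inr y \<Rightarrow> \<bar>c x y\<bar>)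
    | Inr y \<Rightarrow> (case v of Inl x \<Rightarrow> \<bar>c x y\<bar> | Inr y' \<Rightarrow> e y y'))" for u v
  have h[simp]: "h (Inl x) (Inl x') = d x x'" "h (Inr y) (Inr y') = e y y'"
    "h (Inl x) (Inr y) = \<bar>c x y\<bar>" "h (Inr y) (Inl x) = \<bar>c x y\<bar>" for x x' y y'
    by (auto simp: h_def)
  have "Metric_space (Inl ` X \<union> Inr ` Y) h"
  proof
    show "0 \<le> h u v" for u v by (cases u; cases v) auto
    show "h u v = h v u" for u v
      by (cases u; cases v) (auto simp: X.commute Y.commute)
    show "h u v = 0 \<longleftrightarrow> u = v" if "u \<in> Inl ` X \<union> Inr ` Y" "v \<in> Inl ` X \<union> Inr ` Y" for u v
      using that pos by (auto, force+)
    show "h u w \<le> h u v + h v w"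
      if "u \<in> Inl ` X \<union> Inr ` Y" "v \<in> Inl ` X \<union> Inr ` Y" "w \<in> Inl ` X \<union> Inr ` Y" for u v w
    proof -
      have p: "\<bar>c x y\<bar> = c x y" if "x \<in> X" "y \<in> Y" for x y
        using pos[OF that] by simp
      have t1': "c x y \<le> c x' y + d x' x" if "x \<in> X" "x' \<in> X" "y \<in> Y" for x x' y
        using t1[OF that] X.commute[of x x'] by simp
      have t2': "c x y \<le> e y y' + c x y'" if "x \<in> X" "y \<in> Y" "y' \<in> Y" for x y y'
        using t2[OF that] Y.commute[of y y'] by simp
      show ?thesis
        using that
        by (elim UnE imageE) (simp_all add: p X.triangle Y.triangle t1 t2 t3 t4 t1' t2')
    qed
  qed
  moreover have "\<forall>x\<in>X. \<forall>y\<in>Y. h (Inl x) (Inr y) = c x y"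
    using pos by (simp add: abs_of_pos)
  ultimately show ?thesis
    by (intro exI[of _ h]) simp
qed

text \<open>If no radius is admissible, the infimum is the unspecified real \<open>Inf {}\<close>. A
  lower bound that allows for this holds for all sets, and with it the set of values in
  \<open>GH_dist\<close> is bounded below.\<close>

lemma hausdorff_distance_ge: "min 0 (Inf {}) \<le> hausdorff_distance h A B"
proof -
  define T where "T = {r. r > 0 \<and> (\<forall>a\<in>A. \<exists>b\<in>B. h a b < r) \<and> (\<forall>b\<in>B. \<exists>a\<in>A. h a b < r)}"
  have "0 \<le> Inf T" if "T \<noteq> {}"
    using that by (intro cInf_greatest) (auto simp: T_def)
  then have "min 0 (Inf {}) \<le> Inf T" by (cases "T = {}") auto
  then show ?thesis unfolding hausdorff_distance_def T_def .
qed

text \<open>Related points are joined by bridges of length \<open>\<epsilon> / 2\<close>, and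
  \<open>c x y\<close> is the length of a shortest route over one bridge. A detour to the other
  space and back crosses two bridges and costs \<open>\<epsilon>\<close>, which makes up for the
  distortion, so the given metrics are not shortened. Related points end up closer than
  \<open>\<epsilon>\<close>.\<close>

lemma GH_close_imp_coupling:
  fixes X :: "'a set" and Y :: "'b set"
  assumes mX: "Metric_space X d" and mY: "Metric_space Y e" and "X \<noteq> {}"
    and "GH_close \<epsilon> X d Y e" and "\<epsilon> > 0"
  obtains Z :: "('a + 'b) set" and h i j where "Metric_space Z h" "isometric_embedding X d Z h i"
    "isometric_embedding Y e Z h j" "hausdorff_distance h (i ` X) (j ` Y) \<le> \<epsilon>"
proof -
  interpret X: Metric_space X d by fact
  interpret Y: Metric_space Y e by fact
  obtain R where R: "\<forall>x\<in>X. \<exists>y\<in>Y. R x y" "\<forall>y\<in>Y. \<exists>x\<in>X. R x y"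
    and dis: "\<And>x x' y y'. \<lbrakk>x\<in>X; x'\<in>X; y\<in>Y; y'\<in>Y; R x y; R x' y'\<rbrakk> \<Longrightarrow> \<bar>d x x' - e y y'\<bar> \<le> \<epsilon>"
    using assms(4) unfolding GH_close_def by metis
  define C where "C x y = {d x u + \<epsilon> / 2 + e v y | u v. u \<in> X \<and> v \<in> Y \<and> R u v}" for x y
  define c where "c x y = Inf (C x y)" for x y
  have bdd: "bdd_below (C x y)" for x y
    unfolding C_def by (rule bdd_belowI[of _ 0]) (use \<open>\<epsilon> > 0\<close> in auto)
  have ne: "C x y \<noteq> {}" for x y
    using R(1) \<open>X \<noteq> {}\<close> unfolding C_def by blast
  have upper: "c x y \<le> d x u + \<epsilon> / 2 + e v y" if "u \<in> X" "v \<in> Y" "R u v" for x y u v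
    unfolding c_def by (rule cInf_lower[OF _ bdd]) (use that C_def in blast)
  have lower: "z \<le> c x y"
    if "\<And>u v. u \<in> X \<Longrightarrow> v \<in> Y \<Longrightarrow> R u v \<Longrightarrow> z \<le> d x u + \<epsilon> / 2 + e v y" for z x y
    unfolding c_def by (rule cInf_greatest[OF ne]) (use that C_def in auto)
  have "\<exists>h. Metric_space (Inl ` X \<union> Inr ` Y) h \<and>
      (\<forall>x x'. h (Inl x) (Inl x') = d x x') \<and> (\<forall>y y'. h (Inr y) (Inr y') = e y y') \<and>
      (\<forall>x\<in>X. \<forall>y\<in>Y. h (Inl x) (Inr y) = c x y)"
  proof (rule Metric_space_coupling[OF mX mY])
    show "c x y > 0" if "x \<in> X" "y \<in> Y" for x y
      using lower[of "\<epsilon> / 2" x y] \<open>\<epsilon> > 0\<close> by simp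
    show "c x y \<le> d x x' + c x' y" if "x \<in> X" "x' \<in> X" "y \<in> Y" for x x' y
    proof -
      have "c x y - d x x' \<le> c x' y"
        by (rule lower) (smt (verit) X.triangle upper that)
      then show ?thesis by simp
    qed
    show "c x y \<le> c x y' + e y' y" if "x \<in> X" "y \<in> Y" "y' \<in> Y" for x y y'
    proof -
      have "c x y - e y' y \<le> c x y'"
        by (rule lower) (smt (verit) Y.triangle upper that)
      then show ?thesis by simp
    qed
    show "d x x' \<le> c x y + c x' y" if "x \<in> X" "x' \<in> X" "y \<in> Y" for x x' y
    proof -
      have "d x x' - c x' y \<le> c x y"
      proof (rule lower)
        fix u v assume uv: "u \<in> X" "v \<in> Y" "R u v"
        have "d x x' - (d x u + \<epsilon> / 2 + e v y) \<le> c x' y"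
        proof (rule lower)
          fix u' v' assume uv': "u' \<in> X" "v' \<in> Y" "R u' v'"
          have "d x x' \<le> d x u + d u u' + d x' u'"
            using X.triangle[of x u x'] X.triangle[of u u' x'] X.commute[of u' x'] that uv uv'
            by linarith
          moreover have "d u u' \<le> e v v' + \<epsilon>"
            using dis[of u u' v v'] uv uv' by linarith
          moreover have "e v v' \<le> e v y + e v' y"
            using Y.triangle[of v y v'] Y.commute[of v' y] that uv uv' by linarith
          ultimately show "d x x' - (d x u + \<epsilon> / 2 + e v y) \<le> d x' u' + \<epsilon> / 2 + e v' y"
            by linarith
        qed
        then show "d x x' - c x' y \<le> d x u + \<epsilon> / 2 + e v y" by simp
      qed
      then show ?thesis by simp
    qed
    show "e y y' \<le> c x y + c x y'" if "x \<in> X" "y \<in> Y" "y' \<in> Y" for x y y'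
    proof -
      have "e y y' - c x y' \<le> c x y"
      proof (rule lower)
        fix u v assume uv: "u \<in> X" "v \<in> Y" "R u v"
        have "e y y' - (d x u + \<epsilon> / 2 + e v y) \<le> c x y'"
        proof (rule lower)
          fix u' v' assume uv': "u' \<in> X" "v' \<in> Y" "R u' v'"
          have "e y y' \<le> e v y + e v v' + e v' y'"
            using Y.triangle[of y v y'] Y.triangle[of v v' y'] Y.commute[of v y] that uv uv'
            by linarith
          moreover have "e v v' \<le> d u u' + \<epsilon>"
            using dis[of u u' v v'] uv uv' by linarith
          moreover have "d u u' \<le> d x u + d x u'"
            using X.triangle[of u x u'] X.commute[of u x] that uv uv' by linarith
          ultimately show "e y y' - (d x u + \<epsilon> / 2 + e v y) \<le> d x u' + \<epsilon> / 2 + e v' y'"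
            by linarith
        qed
        then show "e y y' - c x y' \<le> d x u + \<epsilon> / 2 + e v y" by simp
      qed
      then show ?thesis by simp
    qed
  qed
  then obtain h where h: "Metric_space (Inl ` X \<union> Inr ` Y) h"
      "\<forall>x x'. h (Inl x) (Inl x') = d x x'" "\<forall>y y'. h (Inr y) (Inr y') = e y y'"
      "\<forall>x\<in>X. \<forall>y\<in>Y. h (Inl x) (Inr y) = c x y"
    by blast
  have less: "h (Inl x) (Inr y) < \<epsilon>" if "x \<in> X" "y \<in> Y" "R x y" for x y
    using upper[of x y x y] that h(4) \<open>\<epsilon> > 0\<close> by simp
  have "hausdorff_distance h (Inl ` X) (Inr ` Y) \<le> \<epsilon>"
    unfolding hausdorff_distance_def
  proof (rule cInf_lower)
    show "bdd_below {r. r > 0 \<and> (\<forall>a\<in>Inl ` X. \<exists>b\<in>Inr ` Y. h a b < r) \<and>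
        (\<forall>b\<in>Inr ` Y. \<exists>a\<in>Inl ` X. h a b < r)}"
      by (rule bdd_belowI[of _ 0]) auto
    have "\<exists>b\<in>Inr ` Y. h (Inl x) b < \<epsilon>" if "x \<in> X" for x
      using R(1) less that by blast
    moreover have "\<exists>a\<in>Inl ` X. h a (Inr y) < \<epsilon>" if "y \<in> Y" for y
      using R(2) less that by blast
    ultimately show "\<epsilon> \<in> {r. r > 0 \<and> (\<forall>a\<in>Inl ` X. \<exists>b\<in>Inr ` Y. h a b < r) \<and>
        (\<forall>b\<in>Inr ` Y. \<exists>a\<in>Inl ` X. h a b < r)}"
      using \<open>\<epsilon> > 0\<close> by simp
  qed
  then show ?thesis
    using h by (intro that[of "Inl ` X \<union> Inr ` Y" h Inl Inr]) (auto simp: isometric_embedding_def)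
qed

lemma GH_close_imp_GH_dist_le:
  assumes "Metric_space X d" "Metric_space Y e" "X \<noteq> {}" "GH_close \<epsilon> X d Y e" "\<epsilon> > 0"
  shows "GH_dist X d Y e \<le> \<epsilon>"
proof -
  obtain Z :: "('a + 'b) set" and h i j where Z: "Metric_space Z h" "isometric_embedding X d Z h i"
    "isometric_embedding Y e Z h j" "hausdorff_distance h (i ` X) (j ` Y) \<le> \<epsilon>"
    using GH_close_imp_coupling[OF assms] by blast
  have "GH_dist X d Y e \<le> hausdorff_distance h (i ` X) (j ` Y)"
    unfolding GH_dist_def
  proof (rule cInf_lower)
    show "bdd_below {hausdorff_distance h (i ` X) (j ` Y) | (Z :: ('a + 'b) set) h i j.
      Metric_space Z h \<and> isometric_embedding X d Z h i \<and> isometric_embedding Y e Z h j}"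
      by (rule bdd_belowI[of _ "min 0 (Inf {})"]) (use hausdorff_distance_ge in blast)
  qed (use Z in blast)
  then show ?thesis using Z(4) by simp
qed

lemma in_GH_space_bounded:
  assumes "in_GH_space X d"
  obtains B where "\<forall>x\<in>X. \<forall>y\<in>X. d x y \<le> B" "B > 0"
proof -
  interpret Metric_space X d using assms by (simp add: in_GH_space_def)
  have "mbounded X"
    using assms compactin_imp_mbounded[of X] by (simp add: in_GH_space_def compact_space_def)
  then show ?thesis
    using that unfolding mbounded_alt_pos by blast
qed

text \<open>In a common ambient space, relate points closer than \<open>r\<close>; replacing both
  endpoints changes a distance by less than \<open>2 * r\<close>. The rest of the work ensures that
  the two infima range over nonempty sets.\<close>

lemma GH_dist_less_imp_GH_close:
  assumes X: "in_GH_space X d" and Y: "in_GH_space Y e" and lt: "GH_dist X d Y e < \<epsilon>"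
  shows "GH_close (2 * \<epsilon>) X d Y e"
proof -
  let ?T = "{hausdorff_distance h (i ` X) (j ` Y) | (Z :: ('a + 'b) set) h i j.
      Metric_space Z h \<and> isometric_embedding X d Z h i \<and> isometric_embedding Y e Z h j}"
  obtain B where B: "\<forall>x\<in>X. \<forall>y\<in>X. d x y \<le> B" "B > 0" using in_GH_space_bounded[OF X] .
  obtain C where C: "\<forall>x\<in>Y. \<forall>y\<in>Y. e x y \<le> C" "C > 0" using in_GH_space_bounded[OF Y] .
  have mX: "Metric_space X d" "X \<noteq> {}" and mY: "Metric_space Y e" "Y \<noteq> {}"
    using X Y by (auto simp: in_GH_space_def)
  interpret X: Metric_space X d by fact
  interpret Y: Metric_space Y e by fact
  \<comment> \<open>Relating everything to everything has finite distortion because both spaces are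
    bounded. This yields some coupling, so the infimum in \<open>GH_dist\<close> is not the
    unspecified \<open>Inf {}\<close>.\<close>
  have "\<bar>d x x' - e y y'\<bar> \<le> B + C" if "x\<in>X" "x'\<in>X" "y\<in>Y" "y'\<in>Y" for x x' y y'
    using that B C X.nonneg[of x x'] Y.nonneg[of y y'] by (smt (verit))
  then have "GH_close (B + C) X d Y e"
    using mX mY unfolding GH_close_def by (intro exI[of _ "\<lambda>x y. True"]) auto
  then obtain Z0 :: "('a + 'b) set" and h0 i0 j0 where "Metric_space Z0 h0"
    "isometric_embedding X d Z0 h0 i0" "isometric_embedding Y e Z0 h0 j0"
    using GH_close_imp_coupling[OF mX(1) mY(1) mX(2), of "B + C"] B C by (metis add_pos_pos)
  then have "?T \<noteq> {}" by blast
  then obtain Z :: "('a + 'b) set" and h i j where Z: "Metric_space Z h"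
    "isometric_embedding X d Z h i" "isometric_embedding Y e Z h j"
    and hd: "hausdorff_distance h (i ` X) (j ` Y) < \<epsilon>"
    using lt cInf_lessD[of ?T \<epsilon>] unfolding GH_dist_def by blast
  interpret Z: Metric_space Z h by fact
  have iX: "i x \<in> Z" and di: "h (i x) (i x') = d x x'" if "x \<in> X" "x' \<in> X" for x x'
    using Z(2) that by (auto simp: isometric_embedding_def)
  have jY: "j y \<in> Z" and ej: "h (j y) (j y') = e y y'" if "y \<in> Y" "y' \<in> Y" for y y'
    using Z(3) that by (auto simp: isometric_embedding_def)
  let ?H = "{r. r > 0 \<and> (\<forall>a\<in>i ` X. \<exists>b\<in>j ` Y. h a b < r) \<and> (\<forall>b\<in>j ` Y. \<exists>a\<in>i ` X. h a b < r)}"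
  obtain x0 y0 where xy: "x0 \<in> X" "y0 \<in> Y" using mX mY by blast
  \<comment> \<open>Likewise for the Hausdorff distance: a crude admissible radius shows that its
    infimum is genuine.\<close>
  have bound: "h (i x) (j y) < B + h (i x0) (j y0) + C + 1" if "x \<in> X" "y \<in> Y" for x y
  proof -
    have "h (i x) (j y) \<le> d x x0 + h (i x0) (j y0) + e y0 y"
      using Z.triangle[of "i x" "i x0" "j y"] Z.triangle[of "i x0" "j y0" "j y"] that xy
        iX jY di ej by (smt (verit))
    moreover have "d x x0 \<le> B" "e y0 y \<le> C" using B C that xy by auto
    ultimately show ?thesis by linarith
  qed
  have "B + h (i x0) (j y0) + C + 1 \<in> ?H"
    using bound xy B(2) C(2) Z.nonneg[of "i x0" "j y0"]
    by (auto intro!: bexI[of _ x0] bexI[of _ y0] simp del: Z.nonneg)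
  then obtain r where r: "r \<in> ?H" "r < \<epsilon>"
    using hd cInf_lessD[of ?H \<epsilon>] unfolding hausdorff_distance_def by blast
  have "\<bar>d x x' - e y y'\<bar> \<le> 2 * \<epsilon>"
    if "x\<in>X" "x'\<in>X" "y\<in>Y" "y'\<in>Y" "h (i x) (j y) < r" "h (i x') (j y') < r" for x x' y y'
  proof -
    have "d x x' \<le> h (i x) (j y) + e y y' + h (i x') (j y')"
      using Z.triangle[of "i x" "j y" "i x'"] Z.triangle[of "j y" "j y'" "i x'"]
        Z.commute[of "j y'" "i x'"] that iX jY di[of x x'] ej[of y y'] by (smt (verit))
    moreover have "e y y' \<le> h (i x) (j y) + d x x' + h (i x') (j y')"
      using Z.triangle[of "j y" "i x" "j y'"] Z.triangle[of "i x" "i x'" "j y'"]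
        Z.commute[of "j y" "i x"] that iX jY di[of x x'] ej[of y y'] by (smt (verit))
    ultimately show ?thesis using that r by linarith
  qed
  then show ?thesis
    unfolding GH_close_def
    by (intro exI[of _ "\<lambda>x y. h (i x) (j y) < r"]) (use r in auto)
qed

text \<open>A compactness argument in the product of all maps \<open>X\<close> to \<open>Y\<close>
  with all maps \<open>Y\<close> to \<open>X\<close>. The equation
  \<open>e (f x) y = d x (g y)\<close> for all \<open>x\<close>, \<open>y\<close> is an intersection
  of closed conditions, each on two coordinates only, and correspondences of small distortion
  satisfy any finitely many of them. A pair satisfying the equation exactly consists of mutually
  inverse isometries, so surjectivity needs no separate argument.\<close>

lemma GH_close_all_imp_isometric:
  assumes X: "in_GH_space X d" and Y: "in_GH_space Y e"
    and close: "\<And>\<epsilon>. \<epsilon> > 0 \<Longrightarrow> GH_close \<epsilon> X d Y e"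
  shows "isometric X d Y e"
proof -
  interpret X: Metric_space X d using X by (simp add: in_GH_space_def)
  interpret Y: Metric_space Y e using Y by (simp add: in_GH_space_def)
  let ?T = "prod_topology (product_topology (\<lambda>_. Y.mtopology) X) (product_topology (\<lambda>_. X.mtopology) Y)"
  have top: "topspace ?T = (X \<rightarrow>\<^sub>E Y) \<times> (Y \<rightarrow>\<^sub>E X)" by simp
  have comp: "compact_space ?T"
    using X Y by (simp add: in_GH_space_def compact_space_prod_topology compact_space_product_topology)
  define C where "C x y m = {p \<in> topspace ?T. e (fst p x) y - d x (snd p y) \<in> {- inverse (real (Suc m)) .. inverse (real (Suc m))}}"
    for x y m
  let ?F = "{C x y m | x y m. x \<in> X \<and> y \<in> Y}"
  have closed: "closedin ?T (C x y m)" if "x \<in> X" "y \<in> Y" for x y m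
  proof -
    have f: "continuous_map ?T Y.mtopology (\<lambda>p. fst p x)"
      using continuous_map_compose[OF continuous_map_fst continuous_map_product_projection[OF that(1)]]
      by (simp add: o_def)
    have g: "continuous_map ?T X.mtopology (\<lambda>p. snd p y)"
      using continuous_map_compose[OF continuous_map_snd continuous_map_product_projection[OF that(2)]]
      by (simp add: o_def)
    have "continuous_map ?T euclideanreal (\<lambda>p. e (fst p x) y - d x (snd p y))"
      using that f g
      by (intro continuous_map_diff Y.continuous_map_dist X.continuous_map_dist) auto
    from closedin_continuous_map_preimage[OF this, of "{- inverse (real (Suc m)) .. inverse (real (Suc m))}"]
    show ?thesis unfolding C_def by simp
  qed
  have fip: "\<Inter>\<G> \<noteq> {}" if G: "finite \<G>" "\<G> \<subseteq> ?F" for \<G>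
  proof -
    have "\<forall>A\<in>\<G>. \<exists>m x y. x \<in> X \<and> y \<in> Y \<and> A = C x y m" using G by blast
    then obtain m where m: "\<And>A. A \<in> \<G> \<Longrightarrow> \<exists>x y. x \<in> X \<and> y \<in> Y \<and> A = C x y (m A)" by metis
    \<comment> \<open>The sharpest of finitely many tolerances; choice functions along one
      correspondence of distortion \<open>inverse (real (Suc N))\<close> meet all of the conditions
      at once.\<close>
    define N where "N = Max (insert 0 (m ` \<G>))"
    have mN: "m A \<le> N" if "A \<in> \<G>" for A using that G by (simp add: N_def)
    obtain R where R: "\<forall>x\<in>X. \<exists>y\<in>Y. R x y" "\<forall>y\<in>Y. \<exists>x\<in>X. R x y"
      and dis: "\<And>x x' y y'. \<lbrakk>x\<in>X; x'\<in>X; y\<in>Y; y'\<in>Y; R x y; R x' y'\<rbrakk>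
        \<Longrightarrow> \<bar>d x x' - e y y'\<bar> \<le> inverse (real (Suc N))"
      using close[of "inverse (real (Suc N))"] unfolding GH_close_def by (metis inverse_positive_iff_positive of_nat_0_less_iff zero_less_Suc)
    obtain f g where f: "\<And>x. x \<in> X \<Longrightarrow> f x \<in> Y \<and> R x (f x)" and g: "\<And>y. y \<in> Y \<Longrightarrow> g y \<in> X \<and> R (g y) y"
      using R by metis
    have "(restrict f X, restrict g Y) \<in> A" if A: "A \<in> \<G>" for A
    proof -
      obtain x y where xy: "x \<in> X" "y \<in> Y" "A = C x y (m A)" using m A by blast
      have "\<bar>d x (g y) - e (f x) y\<bar> \<le> inverse (real (Suc N))"
        using dis f g xy by blast
      also have "\<dots> \<le> inverse (real (Suc (m A)))"
        using mN[OF A] by (simp add: le_imp_inverse_le)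
      finally have "(restrict f X, restrict g Y) \<in> C x y (m A)"
        using xy f g unfolding C_def top by (auto simp: abs_le_iff)
      then show ?thesis using xy(3) by simp
    qed
    then show ?thesis by blast
  qed
  have "\<Inter>?F \<noteq> {}"
  proof (rule comp[unfolded compact_space_fip, THEN spec, THEN mp], intro conjI allI impI ballI)
    fix A assume "A \<in> ?F" then show "closedin ?T A" using closed by auto
  qed (use fip in auto)
  then obtain p where "p \<in> \<Inter>?F" by (auto simp only: ex_in_conv[symmetric])
  then have p: "p \<in> C x y m" if "x \<in> X" "y \<in> Y" for x y m
    using that by auto
  obtain f g where fg: "p = (f, g)" by force
  obtain x0 y0 where "x0 \<in> X" "y0 \<in> Y" using X Y by (auto simp: in_GH_space_def)
  then have fY: "f x \<in> Y" and gX: "g y \<in> X" if "x \<in> X" "y \<in> Y" for x y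
    using p[OF \<open>x0 \<in> X\<close> \<open>y0 \<in> Y\<close>] that unfolding C_def top fg by auto
  have eq: "e (f x) y = d x (g y)" if "x \<in> X" "y \<in> Y" for x y
  proof -
    have "\<bar>e (f x) y - d x (g y)\<bar> \<le> inverse (real (Suc m))" for m
      using p[OF that, of m] unfolding C_def fg by (auto simp: abs_le_iff)
    then have "\<not> 0 < \<bar>e (f x) y - d x (g y)\<bar>"
      using reals_Archimedean[of "\<bar>e (f x) y - d x (g y)\<bar>"] by (meson not_le)
    then show ?thesis by simp
  qed
  \<comment> \<open>Putting \<open>y = f x\<close> in \<open>eq\<close> gives
    \<open>d x (g (f x)) = e (f x) (f x) = 0\<close>.\<close>
  have gf: "g (f x) = x" if "x \<in> X" for x
    using eq[OF that fY[OF that \<open>y0 \<in> Y\<close>]] fY gX that \<open>y0 \<in> Y\<close> by (metis X.zero Y.zero)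
  have fg': "f (g y) = y" if "y \<in> Y" for y
    using eq[OF gX[OF \<open>x0 \<in> X\<close> that] that] fY gX that \<open>x0 \<in> X\<close> by (metis X.zero Y.zero)
  have "bij_betw f X Y"
    by (rule bij_betw_byWitness[of _ g]) (use gf fg' fY gX \<open>x0 \<in> X\<close> \<open>y0 \<in> Y\<close> in auto)
  moreover have "e (f x) (f x') = d x x'" if "x \<in> X" "x' \<in> X" for x x'
    using eq[of x "f x'"] gf fY that \<open>y0 \<in> Y\<close> by metis
  ultimately show ?thesis unfolding isometric_def by blast
qed

lemma isometric_imp_GH_dist_nonpos:
  assumes "in_GH_space X d" "in_GH_space Y e" "isometric X d Y e"
  shows "GH_dist X d Y e \<le> 0"
proof (rule field_le_epsilon)
  fix \<epsilon> :: real assume "0 < \<epsilon>"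
  then show "GH_dist X d Y e \<le> 0 + \<epsilon>"
    using assms GH_close_mono[OF isometric_imp_GH_close[OF assms(3)], of \<epsilon>]
      GH_close_imp_GH_dist_le[of X d Y e \<epsilon>] by (simp add: in_GH_space_def)
qed

text \<open>The usual argument for a continuous injection from a compact into a Hausdorff space,
  carried out with representatives. Every \<open>y\<close> outside \<open>U\<close> has a
  neighbourhood whose images stay at definite distortion from that of \<open>x\<close>; finitely
  many such neighbourhoods cover the complement of \<open>U\<close>.\<close>

lemma GH_topological_embedding_compact:
  fixes \<Phi> :: "'h \<Rightarrow> 'a set \<times> ('a \<Rightarrow> 'a \<Rightarrow> real)"
  assumes H: "compact_space H"
    and S: "\<And>x. x \<in> topspace H \<Longrightarrow> S (fst (\<Phi> x)) (snd (\<Phi> x))"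
    and GH: "\<And>X d. S X d \<Longrightarrow> in_GH_space X d"
    and inj: "\<And>x y. \<lbrakk>x \<in> topspace H; y \<in> topspace H; x \<noteq> y\<rbrakk> \<Longrightarrow>
      \<not> isometric (fst (\<Phi> x)) (snd (\<Phi> x)) (fst (\<Phi> y)) (snd (\<Phi> y))"
    and cont: "\<And>x \<epsilon>. \<lbrakk>x \<in> topspace H; \<epsilon> > 0\<rbrakk> \<Longrightarrow> \<exists>U. openin H U \<and> x \<in> U \<and>
      (\<forall>y\<in>U. GH_close \<epsilon> (fst (\<Phi> x)) (snd (\<Phi> x)) (fst (\<Phi> y)) (snd (\<Phi> y)))"
  shows "GH_topological_embedding H S \<Phi>"
proof -
  let ?close = "\<lambda>\<epsilon> x y. GH_close \<epsilon> (fst (\<Phi> x)) (snd (\<Phi> x)) (fst (\<Phi> y)) (snd (\<Phi> y))"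
  let ?dist = "\<lambda>x y. GH_dist (fst (\<Phi> x)) (snd (\<Phi> x)) (fst (\<Phi> y)) (snd (\<Phi> y))"
  have GHx: "in_GH_space (fst (\<Phi> x)) (snd (\<Phi> x))" if "x \<in> topspace H" for x
    using GH S that by blast
  then have ms: "Metric_space (fst (\<Phi> x)) (snd (\<Phi> x))" "fst (\<Phi> x) \<noteq> {}" if "x \<in> topspace H" for x
    using that by (auto simp: in_GH_space_def)
  have continuous: "\<exists>U. openin H U \<and> x \<in> U \<and> (\<forall>y\<in>U. ?dist x y < \<epsilon>)"
    if x: "x \<in> topspace H" and "\<epsilon> > 0" for x \<epsilon>
  proof -
    obtain U where U: "openin H U" "x \<in> U" "\<forall>y\<in>U. ?close (\<epsilon> / 2) x y"
      using cont[OF x, of "\<epsilon> / 2"] \<open>\<epsilon> > 0\<close> by auto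
    have "?dist x y < \<epsilon>" if "y \<in> U" for y
    proof -
      have "y \<in> topspace H" using U(1) that openin_subset by blast
      then have "?dist x y \<le> \<epsilon> / 2"
        using U(3) that \<open>\<epsilon> > 0\<close>
        by (intro GH_close_imp_GH_dist_le ms x) auto
      then show ?thesis using \<open>\<epsilon> > 0\<close> by simp
    qed
    then show ?thesis using U by blast
  qed
  have inverse: "\<exists>\<epsilon>>0. \<forall>z\<in>topspace H. ?dist x z < \<epsilon> \<longrightarrow> z \<in> U"
    if U: "openin H U" "x \<in> U" for x U
  proof -
    have x: "x \<in> topspace H" using U openin_subset by blast
    have "\<exists>e V. e > 0 \<and> openin H V \<and> y \<in> V \<and> (\<forall>z\<in>V. \<not> ?close (e / 2) x z)"
      if y: "y \<in> topspace H - U" for y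
    proof -
      have "x \<noteq> y" using U(2) y by blast
      then have "\<not> isometric (fst (\<Phi> x)) (snd (\<Phi> x)) (fst (\<Phi> y)) (snd (\<Phi> y))"
        using inj[OF x, of y] y by blast
      then have "\<not> (\<forall>e>0. ?close e x y)"
        using GH_close_all_imp_isometric[OF GHx[OF x] GHx[of y]] y by blast
      then obtain e where e: "e > 0" "\<not> ?close e x y" by blast
      obtain V where V: "openin H V" "y \<in> V" "\<forall>z\<in>V. ?close (e / 2) y z"
        using cont[of y "e / 2"] y e(1) by auto
      have "\<not> ?close (e / 2) x z" if "z \<in> V" for z
      proof
        assume "?close (e / 2) x z"
        moreover have "?close (e / 2) z y" by (rule GH_close_sym) (use V(3) that in blast)
        ultimately have "?close (e / 2 + e / 2) x y" by (rule GH_close_trans)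
        then show False using e(2) by simp
      qed
      then show ?thesis using e V by blast
    qed
    then obtain e V where eV: "\<And>y. y \<in> topspace H - U \<Longrightarrow>
        e y > 0 \<and> openin H (V y) \<and> y \<in> V y \<and> (\<forall>z\<in>V y. \<not> ?close (e y / 2) x z)"
      by metis
    have "compactin H (topspace H - U)"
      using H U(1) closedin_compact_space[of H "topspace H - U"] by blast
    moreover have "\<forall>A\<in>V ` (topspace H - U). openin H A" "topspace H - U \<subseteq> \<Union>(V ` (topspace H - U))"
      using eV by blast+
    ultimately obtain \<F> where F: "finite \<F>" "\<F> \<subseteq> V ` (topspace H - U)" "topspace H - U \<subseteq> \<Union>\<F>"
      unfolding compactin_def by meson
    then obtain F where F': "finite F" "F \<subseteq> topspace H - U" "\<F> = V ` F"
      using finite_subset_image by meson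
    \<comment> \<open>A quarter, because \<open>GH_dist\<close> below \<open>\<delta>\<close> only
      yields distortion \<open>2 * \<delta>\<close>. The 1 covers the case that \<open>F\<close> is
      empty.\<close>
    define \<epsilon> where "\<epsilon> = Min (insert 1 ((\<lambda>y. e y / 4) ` F))"
    have "\<epsilon> > 0" unfolding \<epsilon>_def using F'(1,2) eV by (subst Min_gr_iff) auto
    moreover have "z \<in> U" if z: "z \<in> topspace H" "?dist x z < \<epsilon>" for z
    proof (rule ccontr)
      assume "z \<notin> U"
      then obtain y where y: "y \<in> F" "z \<in> V y" using z F(3) F'(3) by blast
      have "\<epsilon> \<le> e y / 4" unfolding \<epsilon>_def using F'(1) y by (intro Min_le) auto
      then have "?close (e y / 2) x z"
        using GH_close_mono[OF GH_dist_less_imp_GH_close[OF GHx[OF x] GHx[OF z(1)] z(2)], of "e y / 2"]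
        by simp
      then show False using eV[of y] y F'(2) by blast
    qed
    ultimately show ?thesis by blast
  qed
  show ?thesis
    unfolding GH_topological_embedding_def
    by (intro conjI ballI allI impI S inj continuous inverse) auto
qed

subsection \<open>CAT(0) spaces and the Stewart inequality\<close>

text \<open>
  Stewart's theorem with an inequality sign: for geodesic spaces it is equivalent to CAT(0). It
  mentions four points and no geodesics, which makes it easy to check in a wedge.
\<close>
definition stewart_ineq :: "'a set \<Rightarrow> ('a \<Rightarrow> 'a \<Rightarrow> real) \<Rightarrow> bool" where
  "stewart_ineq X d \<longleftrightarrow> (\<forall>p\<in>X. \<forall>q\<in>X. \<forall>r\<in>X. \<forall>m\<in>X. d q r = d q m + d m r \<longrightarrow>
     d q r * ((d p m)\<^sup>2 + d q m * d m r) \<le> d m r * (d p q)\<^sup>2 + d q m * (d p r)\<^sup>2)"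

section \<open>Elementary properties and concatenation of geodesics\<close>

lemma is_geodesicD:
  assumes "is_geodesic X d g x y"
  shows "\<And>t. t \<in> {0..1} \<Longrightarrow> g t \<in> X" "g 0 = x" "g 1 = y"
    "\<And>s t. s \<in> {0..1} \<Longrightarrow> t \<in> {0..1} \<Longrightarrow> d (g s) (g t) = \<bar>s - t\<bar> * d x y"
    "\<And>t. t \<in> {0..1} \<Longrightarrow> d x (g t) = t * d x y"
    "\<And>t. t \<in> {0..1} \<Longrightarrow> d (g t) y = (1 - t) * d x y"
    "x \<in> X" "y \<in> X"
proof -
  show 1: "\<And>t. t \<in> {0..1} \<Longrightarrow> g t \<in> X" "g 0 = x" "g 1 = y"
    "\<And>s t. s \<in> {0..1} \<Longrightarrow> t \<in> {0..1} \<Longrightarrow> d (g s) (g t) = \<bar>s - t\<bar> * d x y"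
    using assms by (auto simp: is_geodesic_def)
  show "d x (g t) = t * d x y" if "t \<in> {0..1}" for t
    using 1(4)[of 0 t] 1(2) that by simp
  show "d (g t) y = (1 - t) * d x y" if "t \<in> {0..1}" for t
    using 1(4)[of t 1] 1(3) that by (simp add: abs_if)
  show "x \<in> X" "y \<in> X" using 1(1)[of 0] 1(1)[of 1] 1(2,3) by auto
qed

lemma (in Metric_space) is_geodesicI:
  assumes "\<And>t. t \<in> {0..1} \<Longrightarrow> g t \<in> M" "g 0 = x" "g 1 = y"
    and "\<And>s t. 0 \<le> s \<Longrightarrow> s \<le> t \<Longrightarrow> t \<le> 1 \<Longrightarrow> d (g s) (g t) = (t - s) * d x y"
  shows "is_geodesic M d g x y"
proof -
  have "d (g s) (g t) = \<bar>s - t\<bar> * d x y" if "s \<in> {0..1}" "t \<in> {0..1}" for s t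
    using assms(4)[of s t] assms(4)[of t s] commute[of "g s" "g t"] that
    by (cases "s \<le> t") auto
  then show ?thesis using assms by (auto simp: is_geodesic_def)
qed

lemma (in Metric_space) geodesic_concat:
  assumes g1: "is_geodesic M d g1 x m" and g2: "is_geodesic M d g2 m y"
    and sum: "d x y = d x m + d m y"
  obtains g t0 where "is_geodesic M d g x y" "t0 \<in> {0..1}" "g t0 = m"
proof -
  have M: "x \<in> M" "m \<in> M" "y \<in> M" using is_geodesicD[OF g1] is_geodesicD[OF g2] by auto
  show ?thesis
  proof (cases "d x y = 0")
    case True
    then have "d x m = 0" "d m y = 0" using sum nonneg[of x m] nonneg[of m y] by linarith+
    then have "x = m" "m = y" using M by auto
    then have "is_geodesic M d (\<lambda>_. m) x y" using M by (auto simp: is_geodesic_def)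
    then show ?thesis by (rule that[of _ 0]) auto
  next
    case False
    define L where "L = d x y"
    define t0 where "t0 = d x m / L"
    have L: "L > 0" using False nonneg[of x y] unfolding L_def by linarith
    have xm: "d x m = t0 * L" using L by (simp add: t0_def)
    have my: "d m y = (1 - t0) * L" using sum xm by (simp add: L_def[symmetric] algebra_simps)
    have t0: "0 \<le> t0" "t0 \<le> 1"
      using xm my L nonneg[of x m] nonneg[of m y]
      by (auto simp: zero_le_mult_iff)
    \<comment> \<open>Constant speed forces the switch at \<open>t0 = d x m / L\<close>. If
      \<open>t0 = 0\<close> the first branch is used for \<open>t = 0\<close> only, where
      \<open>t / t0\<close> is 0; if \<open>t0 = 1\<close> the second branch never occurs on the
      unit interval.\<close>
    define g where "g t = (if t \<le> t0 then g1 (t / t0) else g2 ((t - t0) / (1 - t0)))" for t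
    have r1: "t / t0 \<in> {0..1}" if "0 \<le> t" "t \<le> t0" for t
      using that t0 by (auto simp: divide_le_eq)
    have r2: "(t - t0) / (1 - t0) \<in> {0..1}" if "t0 < t" "t \<le> 1" for t
      using that t0 by (auto simp: divide_le_eq)
    have gM: "g t \<in> M" if "t \<in> {0..1}" for t
      using that r1[of t] r2[of t] is_geodesicD(1)[OF g1] is_geodesicD(1)[OF g2] by (auto simp: g_def)
    have g0: "g 0 = x" using t0 is_geodesicD(2)[OF g1] by (simp add: g_def)
    have g1': "g 1 = y"
    proof (cases "t0 = 1")
      case True
      then have "m = y" using my M by auto
      then show ?thesis using True is_geodesicD(3)[OF g1] by (simp add: g_def)
    next
      case False
      then show ?thesis using t0 is_geodesicD(3)[OF g2] by (simp add: g_def)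
    qed
    have gt0: "g t0 = m"
    proof (cases "t0 = 0")
      case True
      then have "x = m" using xm M by auto
      then show ?thesis using True is_geodesicD(2)[OF g1] by (simp add: g_def)
    next
      case False
      then show ?thesis using is_geodesicD(3)[OF g1] by (simp add: g_def)
    qed
    have A: "d (g s) (g t) = (t - s) * L" if "0 \<le> s" "s \<le> t" "t \<le> t0" for s t
    proof -
      have "d (g s) (g t) = \<bar>s / t0 - t / t0\<bar> * (t0 * L)"
        using is_geodesicD(4)[OF g1 r1[of s] r1[of t]] that xm by (simp add: g_def)
      also have "\<bar>s / t0 - t / t0\<bar> = (t - s) / t0"
        using that t0 by (simp flip: diff_divide_distrib)
      finally show ?thesis using that by (cases "t0 = 0") auto
    qed
    have B: "d (g s) (g t) = (t - s) * L" if "t0 < s" "s \<le> t" "t \<le> 1" for s t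
    proof -
      have "d (g s) (g t) = \<bar>(s - t0) / (1 - t0) - (t - t0) / (1 - t0)\<bar> * ((1 - t0) * L)"
        using is_geodesicD(4)[OF g2 r2[of s] r2[of t]] that my by (simp add: g_def)
      also have "\<bar>(s - t0) / (1 - t0) - (t - t0) / (1 - t0)\<bar> = (t - s) / (1 - t0)"
        using that t0 by (simp flip: diff_divide_distrib)
      finally show ?thesis using that by auto
    qed
    have B': "d m (g t) = (t - t0) * L" if "t0 < t" "t \<le> 1" for t
      using is_geodesicD(5)[OF g2 r2[of t]] that my by (simp add: g_def)
    \<comment> \<open>The route through \<open>m\<close> bounds the distance above. A shorter
      connection would give a path from \<open>x\<close> to \<open>y\<close> shorter than
      \<open>L\<close>, so the bound is attained.\<close>
    have C: "d (g s) (g t) = (t - s) * L" if "0 \<le> s" "s \<le> t0" "t0 < t" "t \<le> 1" for s t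
    proof -
      have in_M: "g s \<in> M" "g t \<in> M" using gM that t0 by auto
      have "d (g s) (g t) \<le> (t0 - s) * L + (t - t0) * L"
        using triangle[of "g s" m "g t"] A[of s t0] B'[of t] gt0 in_M M that by simp
      moreover have "d x (g s) = s * L" using A[of 0 s] g0 that by simp
      moreover have "d (g t) y = (1 - t) * L" using B[of t 1] g1' that by simp
      moreover have "L \<le> d x (g s) + d (g s) (g t) + d (g t) y"
        using triangle[of x "g s" y] triangle[of "g s" "g t" y] in_M M by (simp add: L_def)
      ultimately show ?thesis by (simp add: algebra_simps)
    qed
    have "is_geodesic M d g x y"
    proof (rule is_geodesicI)
      show "d (g s) (g t) = (t - s) * d x y" if "0 \<le> s" "s \<le> t" "t \<le> 1" for s t
        using A[of s t] B[of s t] C[of s t] that unfolding L_def by linarith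
    qed (use gM g0 g1' in auto)
    then show ?thesis using that[of g t0] t0 gt0 by auto
  qed
qed

text \<open>The four-point inequality divided by \<open>d x y\<close>, with the two partial lengths
  \<open>t\<close> and \<open>1 - t\<close> times \<open>d x y\<close>. For \<open>t = 1/2\<close>
  this is the CN inequality of Bruhat and Tits.\<close>

lemma (in Metric_space) stewart_ineq_geodesic:
  assumes "stewart_ineq M d" "is_geodesic M d g x y" "z \<in> M" "t \<in> {0..1}"
  shows "(d z (g t))\<^sup>2 \<le> (1 - t) * (d z x)\<^sup>2 + t * (d z y)\<^sup>2 - t * (1 - t) * (d x y)\<^sup>2"
proof -
  note g = is_geodesicD[OF assms(2)]
  let ?L = "d x y"
  have "d x y = d x (g t) + d (g t) y"
    using g(5,6)[OF assms(4)] by (simp add: algebra_simps)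
  then have "?L * ((d z (g t))\<^sup>2 + d x (g t) * d (g t) y) \<le> d (g t) y * (d z x)\<^sup>2 + d x (g t) * (d z y)\<^sup>2"
    using assms(1,3) g(1)[OF assms(4)] g(7,8) unfolding stewart_ineq_def by blast
  then have *: "?L * ((d z (g t))\<^sup>2 + t * (1 - t) * ?L\<^sup>2) \<le> ?L * ((1 - t) * (d z x)\<^sup>2 + t * (d z y)\<^sup>2)"
    using g(5,6)[OF assms(4)] by (simp add: algebra_simps power2_eq_square)
  show ?thesis
  proof (cases "?L = 0")
    case True
    then have "x = g t" "x = y" using g(1,5,7,8) assms(4) by auto
    then show ?thesis using True by (simp add: algebra_simps)
  next
    case False
    then have "?L > 0" using nonneg[of x y] by linarith
    then show ?thesis using * by (simp add: mult_le_cancel_left_pos)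
  qed
qed

text \<open>Stewart's theorem proper: in an inner product space the inequality is an
  equality.\<close>

lemma dist_segment_sq:
  fixes z x y :: "'v::real_inner"
  shows "(dist z (x + t *\<^sub>R (y - x)))\<^sup>2
    = (1 - t) * (dist z x)\<^sup>2 + t * (dist z y)\<^sup>2 - t * (1 - t) * (dist x y)\<^sup>2"
  unfolding dist_norm power2_norm_eq_inner
  by (simp add: inner_diff_left inner_diff_right inner_add_left inner_add_right inner_commute
      algebra_simps)

text \<open>Two applications of the inequality: from the vertex \<open>r\<close> to the point
  \<open>g1 s\<close>, then from \<open>g1 s\<close> to the point \<open>g2 t\<close> on the
  opposite side \<open>q r\<close> of the triangle \<open>g1 s\<close>, \<open>q\<close>,
  \<open>r\<close>. The distance from \<open>q\<close> to \<open>g1 s\<close> is measured along a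
  side and agrees with the comparison exactly.\<close>

lemma (in Metric_space) stewart_ineq_consecutive_sides:
  fixes P Q R :: "real^2"
  assumes st: "stewart_ineq M d" and g1: "is_geodesic M d g1 p q" and g2: "is_geodesic M d g2 q r"
    and "r \<in> M" "dist P Q = d p q" "dist Q R = d q r" "dist R P = d r p"
    and s: "s \<in> {0..1}" and t: "t \<in> {0..1}"
  shows "d (g1 s) (g2 t) \<le> dist (P + s *\<^sub>R (Q - P)) (Q + t *\<^sub>R (R - Q))"
proof -
  note h1 = is_geodesicD[OF g1] and h2 = is_geodesicD[OF g2]
  define A where "A = P + s *\<^sub>R (Q - P)"
  have "(d r (g1 s))\<^sup>2 \<le> (1 - s) * (d r p)\<^sup>2 + s * (d r q)\<^sup>2 - s * (1 - s) * (d p q)\<^sup>2"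
    using stewart_ineq_geodesic[OF st g1 \<open>r \<in> M\<close> s] .
  also have "\<dots> = (dist R A)\<^sup>2"
    unfolding A_def dist_segment_sq using assms(5-7) by (simp add: dist_commute commute)
  finally have r: "(d r (g1 s))\<^sup>2 \<le> (dist R A)\<^sup>2" .
  have q: "(d q (g1 s))\<^sup>2 = (dist Q A)\<^sup>2"
  proof -
    have "(dist Q A)\<^sup>2 = (1 - s)\<^sup>2 * (dist P Q)\<^sup>2"
      unfolding A_def dist_segment_sq by (simp add: dist_commute algebra_simps power2_eq_square)
    then show ?thesis
      using h1(6)[OF s] assms(5) by (simp add: commute power_mult_distrib)
  qed
  have "(d (g1 s) (g2 t))\<^sup>2
      \<le> (1 - t) * (d (g1 s) q)\<^sup>2 + t * (d (g1 s) r)\<^sup>2 - t * (1 - t) * (d q r)\<^sup>2"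
    using stewart_ineq_geodesic[OF st g2 h1(1)[OF s] t] .
  also have "\<dots> \<le> (1 - t) * (dist A Q)\<^sup>2 + t * (dist A R)\<^sup>2 - t * (1 - t) * (dist Q R)\<^sup>2"
    using q r t assms(6) by (simp add: dist_commute commute mult_left_mono)
  also have "\<dots> = (dist A (Q + t *\<^sub>R (R - Q)))\<^sup>2" by (simp add: dist_segment_sq)
  finally show ?thesis unfolding A_def by (rule power2_le_imp_le) simp
qed

text \<open>Nine ordered pairs of sides: a side with itself is isometric to its comparison segment,
  three pairs are consecutive in the cyclic order, and the other three are these reversed.\<close>

lemma (in Metric_space) stewart_ineq_imp_CAT0:
  assumes geo: "geodesic_space M d" and st: "stewart_ineq M d"
  shows "CAT0 M d"
  unfolding CAT0_def
proof (intro conjI geo allI impI)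
  fix p q r g1 g2 g3 and P Q R :: "real^2"
  assume *: "p \<in> M \<and> q \<in> M \<and> r \<in> M \<and>
       is_geodesic M d g1 p q \<and> is_geodesic M d g2 q r \<and> is_geodesic M d g3 r p \<and>
       dist P Q = d p q \<and> dist Q R = d q r \<and> dist R P = d r p"
  then have g: "is_geodesic M d g1 p q" "is_geodesic M d g2 q r" "is_geodesic M d g3 r p"
    and D: "dist P Q = d p q" "dist Q R = d q r" "dist R P = d r p"
    and M: "p \<in> M" "q \<in> M" "r \<in> M" by auto
  have self: "d (g s) (g t) \<le> dist (A + s *\<^sub>R (B - A)) (A + t *\<^sub>R (B - A))"
    if "is_geodesic M d g a b" "dist A B = d a b" "s \<in> {0..1}" "t \<in> {0..1}"
    for g a b s t and A B :: "real^2"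
  proof -
    have "A + s *\<^sub>R (B - A) - (A + t *\<^sub>R (B - A)) = (s - t) *\<^sub>R (B - A)"
      by (simp add: algebra_simps)
    then have "dist (A + s *\<^sub>R (B - A)) (A + t *\<^sub>R (B - A)) = \<bar>s - t\<bar> * dist B A"
      unfolding dist_norm by (simp only: norm_scaleR real_norm_def)
    moreover have "dist B A = d a b" using that(2) by (metis dist_commute)
    ultimately show ?thesis using is_geodesicD(4)[OF that(1,3,4)] by (simp only: order_refl)
  qed
  have c12: "d (g1 s) (g2 t) \<le> dist (P + s *\<^sub>R (Q - P)) (Q + t *\<^sub>R (R - Q))"
    and c23: "d (g2 s) (g3 t) \<le> dist (Q + s *\<^sub>R (R - Q)) (R + t *\<^sub>R (P - R))"
    and c31: "d (g3 s) (g1 t) \<le> dist (R + s *\<^sub>R (P - R)) (P + t *\<^sub>R (Q - P))"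
    if "s \<in> {0..1}" "t \<in> {0..1}" for s t
    using stewart_ineq_consecutive_sides[OF st g(1,2) M(3) D that]
      stewart_ineq_consecutive_sides[OF st g(2,3) M(1) D(2,3,1) that]
      stewart_ineq_consecutive_sides[OF st g(3,1) M(2) D(3,1,2) that] by auto
  have c21: "d (g2 s) (g1 t) \<le> dist (Q + s *\<^sub>R (R - Q)) (P + t *\<^sub>R (Q - P))"
    and c32: "d (g3 s) (g2 t) \<le> dist (R + s *\<^sub>R (P - R)) (Q + t *\<^sub>R (R - Q))"
    and c13: "d (g1 s) (g3 t) \<le> dist (P + s *\<^sub>R (Q - P)) (R + t *\<^sub>R (P - R))"
    if "s \<in> {0..1}" "t \<in> {0..1}" for s t
    using c12[OF that(2,1)] c23[OF that(2,1)] c31[OF that(2,1)]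
    by (simp_all only: commute[of "g2 s"] commute[of "g3 s" "g2 t"] commute[of "g1 s"] dist_commute)
  show "\<forall>(g, A, B) \<in> {(g1, P, Q), (g2, Q, R), (g3, R, P)}.
        \<forall>(g', A', B') \<in> {(g1, P, Q), (g2, Q, R), (g3, R, P)}.
        \<forall>s\<in>{0..1}. \<forall>t\<in>{0..1}.
          d (g s) (g' t) \<le> dist (A + s *\<^sub>R (B - A)) (A' + t *\<^sub>R (B' - A'))"
    by (simp only: ball_simps prod.case)
      (intro conjI ballI TrueI; intro self[OF g(1) D(1)] self[OF g(2) D(2)] self[OF g(3) D(3)]
        c12 c23 c31 c21 c32 c13; assumption)
qed

lemma comparison_triangle_exists:
  fixes a b c :: real
  assumes "a \<ge> 0" "b \<ge> 0" "c \<ge> 0" "a \<le> b + c" "b \<le> a + c" "c \<le> a + b"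
  obtains P Q R :: "real^2" where "dist P Q = a" "dist Q R = b" "dist R P = c"
proof (cases "a = 0")
  case True
  then have "b = c" using assms by linarith
  define R :: "real^2" where "R = vector [b, 0]"
  have "norm R = b" using assms by (simp add: R_def norm_vec_def L2_set_def sum_2)
  then show ?thesis using that[of 0 0 R] True \<open>b = c\<close> by (simp add: dist_norm)
next
  case False
  then have a: "a > 0" using assms by simp
  \<comment> \<open>The law of cosines, with \<open>P\<close> at the origin and \<open>Q\<close> on
    the first axis, determines the first coordinate of \<open>R\<close>. The triangle inequalities
    bound it by \<open>c\<close>, so the square root below has a nonnegative argument.\<close>
  define x where "x = (a\<^sup>2 + c\<^sup>2 - b\<^sup>2) / (2 * a)"
  define y where "y = sqrt (c\<^sup>2 - x\<^sup>2)"
  have ax: "2 * a * x = a\<^sup>2 + c\<^sup>2 - b\<^sup>2" using a by (simp add: x_def)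
  have "\<bar>x\<bar> \<le> c"
  proof -
    have "2 * a * x \<le> 2 * a * c"
    proof -
      have "(a - c)\<^sup>2 \<le> b\<^sup>2" using assms by (simp add: abs_le_square_iff[symmetric])
      then show ?thesis unfolding ax by (simp add: power2_diff algebra_simps)
    qed
    moreover have "- (2 * a * c) \<le> 2 * a * x"
    proof -
      have "b\<^sup>2 \<le> (a + c)\<^sup>2" using assms by (simp add: power_mono)
      then show ?thesis unfolding ax by (simp add: power2_sum algebra_simps)
    qed
    ultimately have "2 * a * x \<le> 2 * a * c" "2 * a * (- c) \<le> 2 * a * x" by simp_all
    from this[THEN mult_left_le_imp_le] have "x \<le> c" "- c \<le> x" using a by simp_all
    then show ?thesis by linarith
  qed
  then have "x\<^sup>2 \<le> c\<^sup>2" using assms by (simp add: abs_le_square_iff[symmetric])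
  then have y2: "y\<^sup>2 = c\<^sup>2 - x\<^sup>2" by (simp add: y_def)
  define Q R :: "real^2" where "Q = vector [a, 0]" and "R = vector [x, y]"
  have "norm Q = a" using a by (simp add: Q_def norm_vec_def L2_set_def sum_2)
  moreover have "norm R = c" using y2 assms by (simp add: R_def norm_vec_def L2_set_def sum_2)
  moreover have "norm (Q - R) = b"
  proof -
    have "(a - x)\<^sup>2 + y\<^sup>2 = b\<^sup>2" using y2 ax by (simp add: power2_diff)
    then show ?thesis using assms by (simp add: Q_def R_def norm_vec_def L2_set_def sum_2)
  qed
  ultimately show ?thesis using that[of 0 Q R] by (simp add: dist_norm)
qed

text \<open>The equation \<open>d q r = d q m + d m r\<close> puts \<open>m\<close> on some geodesic
  from \<open>q\<close> to \<open>r\<close> by concatenation. CAT(0) speaks of all geodesic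
  triangles, so that geodesic may serve as the side opposite \<open>p\<close>.\<close>

lemma (in Metric_space) CAT0_imp_stewart_ineq:
  assumes cat: "CAT0 M d"
  shows "stewart_ineq M d"
  unfolding stewart_ineq_def
proof (intro ballI impI)
  fix p q r m assume M: "p \<in> M" "q \<in> M" "r \<in> M" "m \<in> M" and sum: "d q r = d q m + d m r"
  have geo: "\<exists>g. is_geodesic M d g x y" if "x \<in> M" "y \<in> M" for x y
    using cat that by (auto simp: CAT0_def geodesic_space_def)
  obtain h1 h2 where "is_geodesic M d h1 q m" "is_geodesic M d h2 m r" using geo M by metis
  then obtain g t where g: "is_geodesic M d g q r" and t: "t \<in> {0..1}" "g t = m"
    using geodesic_concat sum by metis
  obtain g1 g3 where g1: "is_geodesic M d g1 p q" and g3: "is_geodesic M d g3 r p"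
    using geo M by metis
  obtain P Q R :: "real^2" where D: "dist P Q = d p q" "dist Q R = d q r" "dist R P = d r p"
    using comparison_triangle_exists[of "d p q" "d q r" "d r p"]
      triangle[of p r q] triangle[of q p r] triangle[of r q p] M commute nonneg
    by (smt (verit, best))
  \<comment> \<open>The vertex \<open>p\<close> enters as the point at parameter 0 of the side
    \<open>g1\<close>, its comparison point being \<open>P\<close>.\<close>
  have "d (g1 0) (g t) \<le> dist (P + 0 *\<^sub>R (Q - P)) (Q + t *\<^sub>R (R - Q))"
  proof -
    have "\<forall>(h, A, B) \<in> {(g1, P, Q), (g, Q, R), (g3, R, P)}.
        \<forall>(g', A', B') \<in> {(g1, P, Q), (g, Q, R), (g3, R, P)}.
        \<forall>s\<in>{0..1}. \<forall>t\<in>{0..1}.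
          d (h s) (g' t) \<le> dist (A + s *\<^sub>R (B - A)) (A' + t *\<^sub>R (B' - A'))"
      by (rule cat[unfolded CAT0_def, THEN conjunct2, THEN spec[of _ p], THEN spec[of _ q],
            THEN spec[of _ r], THEN spec, THEN spec, THEN spec, THEN spec, THEN spec, THEN spec,
            THEN mp])
        (intro conjI M g1 g g3 D)
    then have "\<forall>s\<in>{0..1}. \<forall>t\<in>{0..1}.
        d (g1 s) (g t) \<le> dist (P + s *\<^sub>R (Q - P)) (Q + t *\<^sub>R (R - Q))" by simp
    from this[THEN bspec[of _ _ 0], THEN bspec[of _ _ t]] show ?thesis using t(1) by simp
  qed
  then have "d p m \<le> dist P (Q + t *\<^sub>R (R - Q))"
    using is_geodesicD(2)[OF g1] t(2) by simp
  then have "(d p m)\<^sup>2 \<le> (dist P (Q + t *\<^sub>R (R - Q)))\<^sup>2" by (simp add: power_mono)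
  also have "\<dots> = (1 - t) * (d p q)\<^sup>2 + t * (d p r)\<^sup>2 - t * (1 - t) * (d q r)\<^sup>2"
    unfolding dist_segment_sq using D by (simp add: dist_commute commute)
  finally have le: "(d p m)\<^sup>2 + t * (1 - t) * (d q r)\<^sup>2 \<le> (1 - t) * (d p q)\<^sup>2 + t * (d p r)\<^sup>2"
    by simp
  have eqs: "d q m = t * d q r" "d m r = (1 - t) * d q r"
    using is_geodesicD(5,6)[OF g t(1)] t(2) by auto
  show "d q r * ((d p m)\<^sup>2 + d q m * d m r) \<le> d m r * (d p q)\<^sup>2 + d q m * (d p r)\<^sup>2"
    unfolding eqs using mult_left_mono[OF le nonneg[of q r]]
    by (simp add: algebra_simps power2_eq_square)
qed

subsection \<open>Wedges of metric spaces\<close>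

text \<open>That pieces meet in \<open>b\<close> only is a consequence of \<open>cross\<close>: a
  common point \<open>x\<close> of two pieces satisfies \<open>0 = D x x = D x b + D b x\<close>.
  Nonnegativity and symmetry are required on the whole type because \<open>Metric_space\<close>
  demands them there.\<close>

locale wedge =
  fixes I :: "'i set" and Q :: "'i \<Rightarrow> 'p set" and D :: "'p \<Rightarrow> 'p \<Rightarrow> real" and b :: 'p
  assumes index_nonempty: "I \<noteq> {}"
    and base_in: "\<And>k. k \<in> I \<Longrightarrow> b \<in> Q k"
    and D_nonneg: "\<And>x y. 0 \<le> D x y"
    and D_commute: "\<And>x y. D x y = D y x"
    and piece: "\<And>k. k \<in> I \<Longrightarrow> Metric_space (Q k) D"
    and cross: "\<And>k l x y. \<lbrakk>k \<in> I; l \<in> I; k \<noteq> l; x \<in> Q k; y \<in> Q l\<rbrakk> \<Longrightarrow> D x y = D x b + D b y"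
begin

definition W :: "'p set" where "W = (\<Union>k\<in>I. Q k)"

lemma piece_subset: "k \<in> I \<Longrightarrow> Q k \<subseteq> W"
  by (auto simp: W_def)

lemma base_in_W: "b \<in> W"
  using index_nonempty base_in by (auto simp: W_def)

lemma D_triangle_piece: "k \<in> I \<Longrightarrow> x \<in> Q k \<Longrightarrow> y \<in> Q k \<Longrightarrow> z \<in> Q k \<Longrightarrow> D x z \<le> D x y + D y z"
  using Metric_space.triangle[OF piece] .

lemma D_zero_piece: "k \<in> I \<Longrightarrow> x \<in> Q k \<Longrightarrow> y \<in> Q k \<Longrightarrow> D x y = 0 \<longleftrightarrow> x = y"
  using Metric_space.zero[OF piece] .

lemma D_le_via_base: "x \<in> W \<Longrightarrow> y \<in> W \<Longrightarrow> D x y \<le> D x b + D b y"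
proof -
  assume "x \<in> W" "y \<in> W"
  then obtain k l where k: "k \<in> I" "x \<in> Q k" and l: "l \<in> I" "y \<in> Q l"
    unfolding W_def by blast
  show ?thesis
    using D_triangle_piece[OF k base_in[OF k(1)], of y] cross[OF k(1) l(1) _ k(2) l(2)] l
    by (cases "k = l") auto
qed

lemma D_base_le: "x \<in> W \<Longrightarrow> y \<in> W \<Longrightarrow> D x b \<le> D x y + D y b"
proof -
  assume "x \<in> W" "y \<in> W"
  then obtain k l where k: "k \<in> I" "x \<in> Q k" and l: "l \<in> I" "y \<in> Q l"
    unfolding W_def by blast
  show ?thesis
    using D_triangle_piece[OF k _ base_in[OF k(1)], of y] cross[OF k(1) l(1) _ k(2) l(2)] l
      D_nonneg[of b y] D_nonneg[of y b]
    by (cases "k = l") auto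
qed

lemma Metric_space_W: "Metric_space W D"
proof
  show "0 \<le> D x y" "D x y = D y x" for x y by (fact D_nonneg D_commute)+
  show "D x y = 0 \<longleftrightarrow> x = y" if xy: "x \<in> W" "y \<in> W" for x y
  proof -
    obtain k l where k: "k \<in> I" "x \<in> Q k" and l: "l \<in> I" "y \<in> Q l"
      using xy unfolding W_def by blast
    show ?thesis
    proof (cases "k = l")
      case True
      then show ?thesis using k l D_zero_piece by blast
    next
      case False
      have "x = b \<and> y = b" if "D x y = 0"
        using cross[OF k(1) l(1) False k(2) l(2)] that D_nonneg[of x b] D_nonneg[of b y]
          D_zero_piece[OF k base_in] D_zero_piece[OF l(1) base_in l(2)] k l by auto
      then show ?thesis using D_zero_piece k by auto
    qed
  qed
  show "D x z \<le> D x y + D y z" if xyz: "x \<in> W" "y \<in> W" "z \<in> W" for x y z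
  proof -
    obtain k l m where k: "k \<in> I" "x \<in> Q k" and l: "l \<in> I" "y \<in> Q l" and m: "m \<in> I" "z \<in> Q m"
      using xyz unfolding W_def by blast
    consider "k = m" "l = k" | "l \<noteq> k" | "k \<noteq> m" "l = k" by blast
    then show ?thesis
    proof cases
      case 1
      then show ?thesis using D_triangle_piece k l m by blast
    next
      case 2
      have "D x y = D x b + D b y" using cross 2 k l by blast
      moreover have "D b z \<le> D b y + D y z"
        using D_base_le[of z y] that D_commute by (simp add: add.commute)
      ultimately show ?thesis using D_le_via_base[of x z] that by linarith
    next
      case 3
      then have "D y z = D y b + D b z" using cross l m by blast
      then show ?thesis using D_base_le[of x y] D_le_via_base[of x z] that by linarith
    qed
  qed
qed

sublocale Metric_space W D by (fact Metric_space_W)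

lemma mtopology_piece:
  assumes "k \<in> I" shows "Metric_space.mtopology (Q k) D = subtopology mtopology (Q k)"
proof -
  interpret Submetric W D "Q k" using piece_subset[OF assms] by unfold_locales
  show ?thesis by (fact mtopology_submetric)
qed

text \<open>The member of a cover that contains \<open>b\<close> contains a ball about
  \<open>b\<close>, which swallows all but finitely many pieces; those left form a finite union of
  compact sets.\<close>

lemma compact_space_W:
  assumes comp: "\<And>k. k \<in> I \<Longrightarrow> compact_space (Metric_space.mtopology (Q k) D)"
    and small: "\<And>\<epsilon>. \<epsilon> > 0 \<Longrightarrow> finite {k\<in>I. \<exists>x\<in>Q k. \<epsilon> \<le> D x b}"
  shows "compact_space mtopology"
proof -
  have cpt: "compactin mtopology (Q k)" if "k \<in> I" for k
    using comp[OF that] piece_subset[OF that] by (simp add: mtopology_piece[OF that] compactin_subspace)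
  have "\<exists>\<F>. finite \<F> \<and> \<F> \<subseteq> \<U> \<and> W \<subseteq> \<Union>\<F>" if U: "\<forall>A\<in>\<U>. openin mtopology A" "W \<subseteq> \<Union>\<U>" for \<U>
  proof -
    obtain U0 where U0: "U0 \<in> \<U>" "b \<in> U0" using U base_in_W by blast
    then obtain \<epsilon> where e: "\<epsilon> > 0" "mball b \<epsilon> \<subseteq> U0" using U openin_mtopology by blast
    let ?K = "{k\<in>I. \<exists>x\<in>Q k. \<epsilon> \<le> D x b}"
    have "compactin mtopology (\<Union>(Q ` ?K))"
      using small[OF e(1)] cpt by (intro compactin_Union) auto
    moreover have "\<Union>(Q ` ?K) \<subseteq> \<Union>\<U>" using U(2) piece_subset by blast
    ultimately obtain \<F> where F: "finite \<F>" "\<F> \<subseteq> \<U>" "\<Union>(Q ` ?K) \<subseteq> \<Union>\<F>"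
      using U(1) unfolding compactin_def by meson
    have cover: "x \<in> \<Union>(insert U0 \<F>)" if "x \<in> W" for x
    proof (cases "D x b < \<epsilon>")
      case True
      then show ?thesis using e(2) that base_in_W D_commute by auto
    next
      case False
      then have "x \<in> \<Union>(Q ` ?K)" using that by (force simp: W_def)
      then show ?thesis using F by blast
    qed
    show ?thesis
      by (rule exI[of _ "insert U0 \<F>"], intro conjI subsetI cover) (use F U0 in auto)
  qed
  then show ?thesis by (auto simp: compact_space_def compactin_def)
qed

lemma connected_space_W:
  assumes "\<And>k. k \<in> I \<Longrightarrow> connected_space (Metric_space.mtopology (Q k) D)"
  shows "connected_space mtopology"
proof -
  have "connectedin mtopology (Q k)" if "k \<in> I" for k
    using assms[OF that] piece_subset[OF that] by (simp add: mtopology_piece[OF that] connectedin_def)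
  then have "connectedin mtopology (\<Union>(Q ` I))"
    using base_in by (intro connectedin_Union) (auto simp flip: ex_in_conv)
  then show ?thesis by (metis W_def connectedin_topspace topspace_mtopology)
qed

lemma path_connected_space_W:
  assumes "\<And>k. k \<in> I \<Longrightarrow> path_connected_space (Metric_space.mtopology (Q k) D)"
  shows "path_connected_space mtopology"
proof -
  have "path_connectedin mtopology (Q k)" if "k \<in> I" for k
    using assms[OF that] piece_subset[OF that] by (simp add: mtopology_piece[OF that] path_connectedin_def)
  then have "path_connectedin mtopology (\<Union>(Q ` I))"
    using base_in by (intro path_connectedin_Union) (auto simp flip: ex_in_conv)
  then show ?thesis by (metis W_def path_connectedin_topspace topspace_mtopology)
qed

lemma geodesic_space_W:
  assumes geo: "\<And>k. k \<in> I \<Longrightarrow> geodesic_space (Q k) D"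
  shows "geodesic_space W D"
  unfolding geodesic_space_def
proof (intro ballI)
  fix x y assume "x \<in> W" "y \<in> W"
  then obtain k l where k: "k \<in> I" "x \<in> Q k" and l: "l \<in> I" "y \<in> Q l" unfolding W_def by blast
  have lift: "\<exists>g. is_geodesic W D g u v" if j: "j \<in> I" "u \<in> Q j" "v \<in> Q j" for j u v
  proof -
    obtain g where "is_geodesic (Q j) D g u v"
      using geo[OF j(1)] j(2,3) unfolding geodesic_space_def by blast
    then have "is_geodesic W D g u v"
      using piece_subset[OF that(1)] unfolding is_geodesic_def by blast
    then show ?thesis by blast
  qed
  show "\<exists>g. is_geodesic W D g x y"
  proof (cases "k = l")
    case True
    then show ?thesis using lift k l by blast
  next
    case False
    then have "D x y = D x b + D b y" using cross k l by blast
    moreover obtain g1 g2 where "is_geodesic W D g1 x b" "is_geodesic W D g2 b y"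
      using lift[OF k base_in[OF k(1)]] lift[OF l(1) base_in[OF l(1)] l(2)] by blast
    ultimately show ?thesis using geodesic_concat by metis
  qed
qed

end

text \<open>The case of \<open>m\<close> lying between \<open>p\<close> and \<open>r\<close>, with
  \<open>a\<close> and \<open>c\<close> the distances from \<open>m\<close> to \<open>q\<close> and
  \<open>r\<close>. The two sides differ by \<open>c * (pq\<^sup>2 - (pm - a)\<^sup>2)\<close>, so
  the inequality is just a triangle inequality.\<close>

lemma stewart_aligned:
  fixes a c pm pq :: real
  assumes "c \<ge> 0" "\<bar>pm - a\<bar> \<le> pq"
  shows "(a + c) * (pm\<^sup>2 + a * c) \<le> c * pq\<^sup>2 + a * (pm + c)\<^sup>2"
proof -
  have "(pm - a)\<^sup>2 \<le> pq\<^sup>2" using assms by (simp add: abs_le_square_iff[symmetric])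
  then have "c * (pm - a)\<^sup>2 \<le> c * pq\<^sup>2" using assms(1) by (rule mult_left_mono)
  then show ?thesis by (simp add: power2_eq_square algebra_simps)
qed

text \<open>The segment from \<open>q\<close> through \<open>m\<close> to \<open>b\<close>, of parts
  \<open>a\<close> and \<open>e\<close>, is prolonged beyond \<open>b\<close> by \<open>f\<close>,
  and the distance from \<open>p\<close> to its end grows by the same \<open>f\<close>. After
  multiplication by \<open>a + e\<close> the new inequality is a multiple of the old one plus
  \<open>a * f * (pq\<^sup>2 - (pb - (a + e))\<^sup>2)\<close>, which is nonnegative. The hypothesis
  \<open>degenerate\<close> covers a vanishing multiplier.\<close>

lemma stewart_extend:
  fixes a e f pm pq pb :: real
  assumes nn: "a \<ge> 0" "e \<ge> 0" "f \<ge> 0"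
    and st: "(a + e) * (pm\<^sup>2 + a * e) \<le> e * pq\<^sup>2 + a * pb\<^sup>2"
    and tri: "\<bar>pb - (a + e)\<bar> \<le> pq" and degenerate: "a + e = 0 \<Longrightarrow> pm = pq"
  shows "(a + e + f) * (pm\<^sup>2 + a * (e + f)) \<le> (e + f) * pq\<^sup>2 + a * (pb + f)\<^sup>2"
proof (cases "a + e = 0")
  case True
  then have "a = 0" "e = 0" using nn by linarith+
  then show ?thesis using degenerate by simp
next
  case False
  then have pos: "a + e > 0" using nn by linarith
  have "(pb - (a + e))\<^sup>2 \<le> pq\<^sup>2" using tri by (simp add: abs_le_square_iff[symmetric])
  then have 1: "a * f * (pb - (a + e))\<^sup>2 \<le> a * f * pq\<^sup>2" using nn by (simp add: mult_left_mono)
  have 2: "(a + e + f) * ((a + e) * (pm\<^sup>2 + a * e)) \<le> (a + e + f) * (e * pq\<^sup>2 + a * pb\<^sup>2)"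
    using st nn by (simp add: mult_left_mono)
  have "(a + e) * ((a + e + f) * (pm\<^sup>2 + a * (e + f)))
      = (a + e + f) * ((a + e) * (pm\<^sup>2 + a * e)) + (a + e) * (a + e + f) * a * f"
    by (simp add: algebra_simps)
  also have "\<dots> \<le> (a + e + f) * (e * pq\<^sup>2 + a * pb\<^sup>2) + (a + e) * (a + e + f) * a * f
      + (a * f * pq\<^sup>2 - a * f * (pb - (a + e))\<^sup>2)"
    using 1 2 by simp
  also have "\<dots> = (a + e) * ((e + f) * pq\<^sup>2 + a * (pb + f)\<^sup>2)"
    by (simp add: power2_eq_square algebra_simps)
  finally show ?thesis using pos by (simp add: mult_le_cancel_left_pos)
qed

text \<open>The vertex moves away from \<open>b\<close>, and its distances to all three points grow
  by \<open>s\<close>. The terms in \<open>s\<^sup>2\<close> cancel; those linear in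
  \<open>s\<close> require convexity, \<open>(a + c) * bm \<le> c * bq + a * br\<close>, which
  follows on squaring from \<open>st\<close> and \<open>tri\<close>.\<close>

lemma stewart_shift:
  fixes a c bm bq br s :: real
  assumes nn: "a \<ge> 0" "c \<ge> 0" "s \<ge> 0" "bq \<ge> 0" "br \<ge> 0"
    and st: "(a + c) * (bm\<^sup>2 + a * c) \<le> c * bq\<^sup>2 + a * br\<^sup>2" and tri: "\<bar>bq - br\<bar> \<le> a + c"
  shows "(a + c) * ((s + bm)\<^sup>2 + a * c) \<le> c * (s + bq)\<^sup>2 + a * (s + br)\<^sup>2"
proof -
  have "(bq - br)\<^sup>2 \<le> (a + c)\<^sup>2" using tri nn by (simp add: abs_le_square_iff[symmetric])
  then have 1: "a * c * (bq - br)\<^sup>2 \<le> a * c * (a + c)\<^sup>2" using nn by (simp add: mult_left_mono)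
  have 2: "(a + c) * ((a + c) * (bm\<^sup>2 + a * c)) \<le> (a + c) * (c * bq\<^sup>2 + a * br\<^sup>2)"
    using st nn by (simp add: mult_left_mono)
  have "((a + c) * bm)\<^sup>2 \<le> (c * bq + a * br)\<^sup>2"
    using 1 2 by (simp add: power2_eq_square algebra_simps)
  then have "(a + c) * bm \<le> c * bq + a * br"
    using nn by (rule_tac power2_le_imp_le) auto
  then have "2 * s * ((a + c) * bm) \<le> 2 * s * (c * bq + a * br)" using nn by (simp add: mult_left_mono)
  then show ?thesis using st by (simp add: power2_eq_square algebra_simps)
qed

context wedge begin

text \<open>A case analysis on pieces. If \<open>q\<close>, \<open>m\<close>, \<open>r\<close> share
  a piece, a \<open>p\<close> outside it acts like the base point moved further away
  (\<open>stewart_shift\<close>). If \<open>r\<close> alone lies elsewhere, then \<open>b\<close>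
  lies between \<open>m\<close> and \<open>r\<close>: with \<open>p\<close> in the piece of
  \<open>q\<close> and \<open>m\<close> the segment is prolonged (\<open>stewart_extend\<close>),
  otherwise \<open>p\<close>, \<open>m\<close>, \<open>q\<close> are aligned.\<close>

lemma stewart_ineq_W:
  assumes st: "\<And>k. k \<in> I \<Longrightarrow> stewart_ineq (Q k) D"
  shows "stewart_ineq W D"
proof -
  let ?goal = "\<lambda>p q r m. D q r * ((D p m)\<^sup>2 + D q m * D m r) \<le> D m r * (D p q)\<^sup>2 + D q m * (D p r)\<^sup>2"
  have stD: "?goal p q r m"
    if "k \<in> I" "p \<in> Q k" "q \<in> Q k" "r \<in> Q k" "m \<in> Q k" "D q r = D q m + D m r" for k p q r m
    using st[OF that(1)] that(2-) unfolding stewart_ineq_def by blast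
  have aligned: "?goal p q r m"
    if "p \<in> W" "q \<in> W" "m \<in> W" "D q r = D q m + D m r" "D p r = D p m + D m r" for p q r m
  proof -
    have "\<bar>D p m - D q m\<bar> \<le> D p q"
      using triangle[of p q m] triangle[of q p m] commute[of p q] that by linarith
    then show ?thesis using stewart_aligned[OF D_nonneg[of m r]] that(4,5) by simp
  qed
  have near: "?goal p q r m"
    if k: "k \<in> I" "q \<in> Q k" "m \<in> Q k" and l: "l \<in> I" "r \<in> Q l" "k \<noteq> l" and p: "p \<in> W"
      and sum: "D q r = D q m + D m r" for k l p q r m
  proof -
    have W: "q \<in> W" "m \<in> W" "r \<in> W" using k l piece_subset by auto
    have qr: "D q r = D q b + D b r" and mr: "D m r = D m b + D b r" using cross k l by blast+
    then have qb: "D q b = D q m + D m b" using sum by linarith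
    obtain j where j: "j \<in> I" "p \<in> Q j" using p by (auto simp: W_def)
    show ?thesis
    proof (cases "j = k")
      case True
      then have pr: "D p r = D p b + D b r" using cross k l j by blast
      have "?goal p q b m" using stD[of k p q b m] True j k base_in qb by simp
      moreover have "\<bar>D p b - D q b\<bar> \<le> D p q"
        using triangle[of p q b] triangle[of q p b] commute[of p q] W p base_in_W by linarith
      moreover have "D p m = D p q" if "D q m + D m b = 0"
      proof -
        have "D q m = 0" using that D_nonneg[of q m] D_nonneg[of m b] by linarith
        then show ?thesis using W by simp
      qed
      ultimately show ?thesis
        using stewart_extend[of "D q m" "D m b" "D b r" "D p m" "D p q" "D p b"]
          D_nonneg qb sum mr pr by (simp add: add.assoc)
    next
      case False
      have "D p q = D p b + D b q" "D p m = D p b + D b m" using cross False k j by blast+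
      then have "D p q = D p m + D m q" using qb by (simp add: commute)
      \<comment> \<open>From \<open>p\<close> one reaches \<open>q\<close> through \<open>b\<close>
        and then \<open>m\<close>, so the aligned case applies with \<open>q\<close> and
        \<open>r\<close> exchanged; the inequality is symmetric in them.\<close>
      then have "?goal p r q m"
        using aligned[of p r m q] W p sum by (simp add: commute)
      then show ?thesis using commute[of r q] commute[of m q] commute[of r m]
        by (simp add: ac_simps)
    qed
  qed
  show ?thesis
    unfolding stewart_ineq_def
  proof (intro ballI impI)
    fix p q r m assume W: "p \<in> W" "q \<in> W" "r \<in> W" "m \<in> W" and sum: "D q r = D q m + D m r"
    obtain k l i j where k: "k \<in> I" "q \<in> Q k" and l: "l \<in> I" "r \<in> Q l"
      and i: "i \<in> I" "m \<in> Q i" and j: "j \<in> I" "p \<in> Q j"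
      using W unfolding W_def by blast
    \<comment> \<open>Outside both pieces \<open>m\<close> would cost a detour of
      \<open>2 * D m b\<close> beyond the route from \<open>q\<close> to \<open>r\<close> through
      \<open>b\<close>.\<close>
    have m_base: "m = b" if "i \<noteq> k" "i \<noteq> l"
    proof -
      have "D q m = D q b + D b m" "D m r = D m b + D b r" using cross k l i that by blast+
      then have "2 * D m b \<le> 0"
        using D_le_via_base[OF W(2,3)] sum commute[of b m] by linarith
      then show ?thesis using D_nonneg[of m b] W base_in_W by (simp add: order_antisym)
    qed
    have "m \<in> Q k \<or> m \<in> Q l" using m_base i base_in[OF k(1)] by metis
    then consider "k = l" "m \<in> Q k" | "k \<noteq> l" "m \<in> Q k" | "k \<noteq> l" "m \<in> Q l" by blast
    then show "?goal p q r m"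
    proof cases
      case 1
      show ?thesis
      proof (cases "j = k")
        case True
        then show ?thesis using stD[of k p q r m] 1 j k l sum by simp
      next
        case False
        have "D p x = D p b + D b x" if "x \<in> Q k" for x using cross False j k that by blast
        then have "D p m = D p b + D b m" "D p q = D p b + D b q" "D p r = D p b + D b r"
          using 1 k l by auto
        moreover have "?goal b q r m" using stD[of k b q r m] 1 k l base_in sum by simp
        moreover have "\<bar>D b q - D b r\<bar> \<le> D q r"
          using triangle[of b q r] triangle[of b r q] commute[of r q] W base_in_W by linarith
        ultimately show ?thesis
          using stewart_shift[of "D q m" "D m r" "D p b" "D b q" "D b r" "D b m"] D_nonneg sum by simp
      qed
    next
      case 2
      then show ?thesis using near k l W sum by blast
    next
      case 3
      have "D r q = D r m + D m q" using sum by (simp add: commute)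
      then have "?goal p r q m" using near[of l r m k q p] 3 k l W by simp
      then show ?thesis using commute[of r q] commute[of m q] commute[of r m]
        by (simp add: ac_simps)
    qed
  qed
qed

end

subsection \<open>Similarities and the four classes\<close>

definition similarity :: "real \<Rightarrow> 'a set \<Rightarrow> ('a \<Rightarrow> 'a \<Rightarrow> real) \<Rightarrow> 'b set \<Rightarrow> ('b \<Rightarrow> 'b \<Rightarrow> real) \<Rightarrow> ('a \<Rightarrow> 'b) \<Rightarrow> bool" where
  "similarity c X d Y e f \<longleftrightarrow> 0 < c \<and> f ` X = Y \<and> (\<forall>x\<in>X. \<forall>y\<in>X. e (f x) (f y) = c * d x y)"

lemma similarity_continuous_map:
  assumes "Metric_space X d" "Metric_space Y e" "similarity c X d Y e f"
  shows "continuous_map (Metric_space.mtopology X d) (Metric_space.mtopology Y e) f"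
proof -
  have "\<exists>\<delta>>0. \<forall>x. x \<in> X \<and> d a x < \<delta> \<longrightarrow> e (f a) (f x) < \<epsilon>" if "a \<in> X" "\<epsilon> > 0" for a \<epsilon>
  proof (intro exI[of _ "\<epsilon> / c"] conjI allI impI)
    show "\<epsilon> / c > 0" using assms(3) that by (simp add: similarity_def)
    show "e (f a) (f x) < \<epsilon>" if "x \<in> X \<and> d a x < \<epsilon> / c" for x
      using that assms(3) \<open>a \<in> X\<close> by (simp add: similarity_def pos_less_divide_eq mult.commute)
  qed
  then show ?thesis
    unfolding Metric_space.metric_continuous_map[OF assms(1,2)]
    using assms(3) by (auto simp: similarity_def)
qed

lemma similarity_in_GH_space:
  assumes "in_GH_space X d" "Metric_space Y e" "similarity c X d Y e f"
  shows "in_GH_space Y e"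
proof -
  have X: "Metric_space X d" using assms(1) by (simp add: in_GH_space_def)
  have "compactin (Metric_space.mtopology Y e) (f ` X)"
    using assms(1) Metric_space.topspace_mtopology[OF X]
    by (intro image_compactin[OF _ similarity_continuous_map[OF X assms(2,3)]])
      (simp add: in_GH_space_def compact_space_def)
  then show ?thesis
    using assms Metric_space.topspace_mtopology[OF assms(2)]
    by (auto simp: in_GH_space_def compact_space_def similarity_def)
qed

lemma similarity_geodesic_space:
  assumes "geodesic_space X d" "similarity c X d Y e f"
  shows "geodesic_space Y e"
  unfolding geodesic_space_def
proof (intro ballI)
  have f: "f ` X = Y" "\<And>x y. x \<in> X \<Longrightarrow> y \<in> X \<Longrightarrow> e (f x) (f y) = c * d x y"
    using assms(2) by (auto simp: similarity_def)
  fix x y assume "x \<in> Y" "y \<in> Y"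
  then obtain u v where uv: "u \<in> X" "v \<in> X" "x = f u" "y = f v" using f(1) by blast
  then obtain g where g: "is_geodesic X d g u v" using assms(1) unfolding geodesic_space_def by blast
  have "is_geodesic Y e (f \<circ> g) x y"
    unfolding is_geodesic_def
  proof (intro conjI ballI)
    show "(f \<circ> g) ` {0..1} \<subseteq> Y" using g f(1) unfolding is_geodesic_def by fastforce
    show "(f \<circ> g) 0 = x" "(f \<circ> g) 1 = y" using is_geodesicD[OF g] uv by auto
    fix s t :: real assume st: "s \<in> {0..1}" "t \<in> {0..1}"
    show "e ((f \<circ> g) s) ((f \<circ> g) t) = \<bar>s - t\<bar> * e x y"
      using is_geodesicD(1)[OF g] is_geodesicD(4)[OF g st] st uv f(2) by simp
  qed
  then show "\<exists>g. is_geodesic Y e g x y" by blast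
qed

lemma similarity_stewart_ineq:
  assumes "stewart_ineq X d" "similarity c X d Y e f"
  shows "stewart_ineq Y e"
  unfolding stewart_ineq_def
proof (intro ballI impI)
  have f: "c > 0" "f ` X = Y" "\<And>x y. x \<in> X \<Longrightarrow> y \<in> X \<Longrightarrow> e (f x) (f y) = c * d x y"
    using assms(2) by (auto simp: similarity_def)
  fix p q r m assume "p \<in> Y" "q \<in> Y" "r \<in> Y" "m \<in> Y" and sum: "e q r = e q m + e m r"
  then obtain p' q' r' m' where X: "p' \<in> X" "q' \<in> X" "r' \<in> X" "m' \<in> X"
    and eq: "p = f p'" "q = f q'" "r = f r'" "m = f m'"
    using f(2) by blast
  have "c * d q' r' = c * (d q' m' + d m' r')"
    using sum f(3) X by (simp add: eq distrib_left)
  then have "d q' r' = d q' m' + d m' r'" using f(1) by simp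
  then have "d q' r' * ((d p' m')\<^sup>2 + d q' m' * d m' r') \<le> d m' r' * (d p' q')\<^sup>2 + d q' m' * (d p' r')\<^sup>2"
    using assms(1) X unfolding stewart_ineq_def by blast
  \<comment> \<open>Both sides are homogeneous of degree 3 in the distances.\<close>
  then have "c^3 * (d q' r' * ((d p' m')\<^sup>2 + d q' m' * d m' r'))
      \<le> c^3 * (d m' r' * (d p' q')\<^sup>2 + d q' m' * (d p' r')\<^sup>2)"
    using f(1) by (simp add: mult_left_mono)
  then show "e q r * ((e p m)\<^sup>2 + e q m * e m r) \<le> e m r * (e p q)\<^sup>2 + e q m * (e p r)\<^sup>2"
    unfolding eq using f(3) X by (simp add: power2_eq_square power3_eq_cube algebra_simps)
qed

text \<open>Passing through the Stewart inequality avoids any rescaling of comparison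
  triangles.\<close>

lemma GH_CAT0_similarity:
  assumes "GH_CAT0 X d" "Metric_space Y e" and sim: "similarity c X d Y e f"
  shows "GH_CAT0 Y e"
proof -
  have GH: "in_GH_space X d" and cat: "CAT0 X d" using assms(1) by (auto simp: GH_CAT0_def)
  interpret X: Metric_space X d using GH by (simp add: in_GH_space_def)
  interpret Y: Metric_space Y e by (fact assms(2))
  have "geodesic_space X d" "stewart_ineq X d"
    using cat X.CAT0_imp_stewart_ineq by (auto simp: CAT0_def)
  then have "CAT0 Y e"
    using similarity_geodesic_space[OF _ sim] similarity_stewart_ineq[OF _ sim]
    by (intro Y.stewart_ineq_imp_CAT0)
  then show ?thesis
    using similarity_in_GH_space[OF GH assms(2) sim] by (simp add: GH_CAT0_def)
qed

lemma GH_class_similarity: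
  assumes S: "S \<in> {GH_connected, GH_path_connected, GH_geodesic, GH_CAT0}"
    and "S X d" "Metric_space Y e" and sim: "similarity c X d Y e f"
  shows "S Y e"
proof -
  have GH: "in_GH_space X d"
    using assms(1,2)
    by (auto simp: GH_connected_def GH_path_connected_def GH_geodesic_def GH_CAT0_def)
  then have X: "Metric_space X d" by (simp add: in_GH_space_def)
  interpret X: Metric_space X d by (fact X)
  interpret Y: Metric_space Y e by (fact assms(3))
  have GH': "in_GH_space Y e" by (rule similarity_in_GH_space[OF GH assms(3) sim])
  note cont = similarity_continuous_map[OF X assms(3) sim]
  have im: "f ` topspace X.mtopology = topspace Y.mtopology" using sim by (simp add: similarity_def)
  show ?thesis
    using S
  proof (elim insertE emptyE)
    assume "S = GH_connected"
    then show ?thesis using assms(2) GH' im connectedin_continuous_map_image[OF cont, of X]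
      by (auto simp: GH_connected_def simp flip: connectedin_topspace)
  next
    assume "S = GH_path_connected"
    then show ?thesis using assms(2) GH' im path_connectedin_continuous_map_image[OF cont, of X]
      by (auto simp: GH_path_connected_def simp flip: path_connectedin_topspace)
  next
    assume "S = GH_geodesic"
    then show ?thesis using assms(2) GH' similarity_geodesic_space[OF _ sim]
      by (simp add: GH_geodesic_def)
  next
    assume "S = GH_CAT0"
    then show ?thesis using assms(2) GH_CAT0_similarity[OF _ assms(3) sim] by simp
  qed
qed

lemma GH_class_imp_in_GH_space:
  assumes "S \<in> {GH_connected, GH_path_connected, GH_geodesic, GH_CAT0}" "S X d"
  shows "in_GH_space X d"
  using assms by (auto simp: GH_connected_def GH_path_connected_def GH_geodesic_def GH_CAT0_def)

lemma GH_class_wedge: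
  assumes S: "S \<in> {GH_connected, GH_path_connected, GH_geodesic, GH_CAT0}"
    and "wedge I Q D b" and pieces: "\<And>k. k \<in> I \<Longrightarrow> S (Q k) D"
    and small: "\<And>\<epsilon>. \<epsilon> > 0 \<Longrightarrow> finite {k\<in>I. \<exists>x\<in>Q k. \<epsilon> \<le> D x b}"
  shows "S (\<Union>k\<in>I. Q k) D"
proof -
  interpret wedge I Q D b by fact
  have W: "(\<Union>k\<in>I. Q k) = W" by (simp add: W_def)
  have "in_GH_space (Q k) D" if "k \<in> I" for k
    using GH_class_imp_in_GH_space[OF S] pieces that by blast
  then have "compact_space mtopology"
    by (intro compact_space_W small) (auto simp: in_GH_space_def)
  then have GH: "in_GH_space W D"
    using base_in_W Metric_space_W by (auto simp: in_GH_space_def)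
  have "S W D"
    using S
  proof (elim insertE emptyE)
    assume "S = GH_connected"
    then show "S W D" using GH pieces connected_space_W by (simp add: GH_connected_def)
  next
    assume "S = GH_path_connected"
    then show "S W D" using GH pieces path_connected_space_W by (simp add: GH_path_connected_def)
  next
    assume "S = GH_geodesic"
    then show "S W D" using GH pieces geodesic_space_W by (simp add: GH_geodesic_def)
  next
    assume eq: "S = GH_CAT0"
    have "geodesic_space (Q k) D" "stewart_ineq (Q k) D" if "k \<in> I" for k
      using pieces[OF that] Metric_space.CAT0_imp_stewart_ineq[OF piece[OF that]]
      by (auto simp: eq GH_CAT0_def CAT0_def)
    then show "S W D"
      using GH eq stewart_ineq_imp_CAT0 geodesic_space_W stewart_ineq_W by (simp add: GH_CAT0_def)
  qed
  then show ?thesis by (simp add: W)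
qed

section \<open>Inclusions between the four classes, and the unit interval\<close>

lemma is_geodesic_continuous_map:
  assumes "Metric_space X d" and g: "is_geodesic X d g x y"
  shows "continuous_map (top_of_set {0..1}) (Metric_space.mtopology X d) g"
proof -
  interpret Metric_space X d by fact
  interpret I: Metric_space "{0..1::real}" dist by (rule Met_TC.subspace) simp
  interpret S: Submetric UNIV dist "{0..1::real}" by unfold_locales simp
  have top: "I.mtopology = top_of_set {0..1}"
    using S.mtopology_submetric by simp
  have "\<exists>\<delta>>0. \<forall>t. t \<in> {0..1} \<and> dist s t < \<delta> \<longrightarrow> d (g s) (g t) < \<epsilon>" if "s \<in> {0..1}" "\<epsilon> > 0" for s \<epsilon>
  \<comment> \<open>A geodesic is Lipschitz with constant \<open>d x y\<close>; the added 1 keeps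
    the divisor positive for a constant geodesic.\<close>
  proof (intro exI[of _ "\<epsilon> / (d x y + 1)"] conjI allI impI)
    have pos: "d x y + 1 > 0" using nonneg[of x y] by linarith
    then show "\<epsilon> / (d x y + 1) > 0" using that by simp
    fix t assume t: "t \<in> {0..1} \<and> dist s t < \<epsilon> / (d x y + 1)"
    have "d (g s) (g t) = \<bar>s - t\<bar> * d x y" using is_geodesicD(4)[OF g] that t by blast
    also have "\<dots> \<le> \<bar>s - t\<bar> * (d x y + 1)" by (simp add: distrib_left)
    also have "\<dots> < \<epsilon>" using t pos by (simp add: dist_real_def pos_less_divide_eq)
    finally show "d (g s) (g t) < \<epsilon>" .
  qed
  then show ?thesis
    unfolding top[symmetric] I.metric_continuous_map[OF \<open>Metric_space X d\<close>]
    using is_geodesicD(1)[OF g] by auto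
qed

lemma geodesic_space_imp_path_connected_space:
  assumes "Metric_space X d" "geodesic_space X d"
  shows "path_connected_space (Metric_space.mtopology X d)"
proof -
  interpret Metric_space X d by fact
  show ?thesis
    unfolding path_connected_space_def
  proof (intro ballI)
    fix x y assume "x \<in> topspace mtopology" "y \<in> topspace mtopology"
    then obtain g where g: "is_geodesic X d g x y"
      using assms(2) by (auto simp: geodesic_space_def)
    show "\<exists>g. pathin mtopology g \<and> g 0 = x \<and> g 1 = y"
      using is_geodesic_continuous_map[OF assms(1) g] is_geodesicD(2,3)[OF g]
      by (auto simp: pathin_def)
  qed
qed

lemma GH_class_imp_connected_space:
  assumes "S \<in> {GH_connected, GH_path_connected, GH_geodesic, GH_CAT0}" "S X d"
  shows "connected_space (Metric_space.mtopology X d)"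
proof -
  have "Metric_space X d" using GH_class_imp_in_GH_space[OF assms] by (simp add: in_GH_space_def)
  then have path: "path_connected_space (Metric_space.mtopology X d)" if "geodesic_space X d"
    using geodesic_space_imp_path_connected_space that by blast
  note conn = path_connected_imp_connected_space[OF path]
  have CAT0: "geodesic_space X d" if "CAT0 X d" using that by (simp add: CAT0_def)
  show ?thesis
    using assms path conn CAT0 path_connected_imp_connected_space[of "Metric_space.mtopology X d"]
    by (elim insertE emptyE)
      (simp_all add: GH_connected_def GH_path_connected_def GH_geodesic_def GH_CAT0_def)
qed

text \<open>CAT(0) is the smallest of the four classes, so segments need checking there
  only.\<close>

lemma GH_CAT0_imp_GH_class:
  assumes "S \<in> {GH_connected, GH_path_connected, GH_geodesic, GH_CAT0}" "GH_CAT0 X d"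
  shows "S X d"
proof -
  have "Metric_space X d" using assms(2) by (simp add: in_GH_space_def GH_CAT0_def)
  then have path: "path_connected_space (Metric_space.mtopology X d)" if "geodesic_space X d"
    using geodesic_space_imp_path_connected_space that by blast
  note conn = path_connected_imp_connected_space[OF path]
  have CAT0: "geodesic_space X d" if "CAT0 X d" using that by (simp add: CAT0_def)
  show ?thesis
    using assms path conn CAT0 path_connected_imp_connected_space[of "Metric_space.mtopology X d"]
    by (elim insertE emptyE)
      (simp_all add: GH_connected_def GH_path_connected_def GH_geodesic_def GH_CAT0_def)
qed

lemma GH_CAT0_unit_interval: "GH_CAT0 {0..1::real} dist"
proof -
  interpret I: Metric_space "{0..1::real}" dist by (rule Met_TC.subspace) simp
  interpret S: Submetric UNIV dist "{0..1::real}" by unfold_locales simp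
  have "I.mtopology = top_of_set {0..1}"
    using S.mtopology_submetric by simp
  then have GH: "in_GH_space {0..1::real} dist"
    using I.Metric_space_axioms by (simp add: in_GH_space_def compact_space_subtopology)
  have "is_geodesic {0..1} dist (\<lambda>t. x + t * (y - x)) x y" if "x \<in> {0..1}" "y \<in> {0..1}" for x y :: real
  proof (rule I.is_geodesicI)
    show "x + t * (y - x) \<in> {0..1}" if "t \<in> {0..1}" for t
      using convexD_alt[of "{0..1::real}" x y t] \<open>x \<in> {0..1}\<close> \<open>y \<in> {0..1}\<close> that
      by (simp add: algebra_simps)
    show "dist (x + s * (y - x)) (x + t * (y - x)) = (t - s) * dist x y" if "0 \<le> s" "s \<le> t" "t \<le> 1" for s t
    proof -
      have "x + s * (y - x) - (x + t * (y - x)) = (t - s) * (x - y)" by (simp add: algebra_simps)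
      then show ?thesis using that by (simp add: dist_real_def abs_mult)
    qed
  qed auto
  then have geo: "geodesic_space {0..1::real} dist" unfolding geodesic_space_def by blast
  have "stewart_ineq {0..1::real} dist"
    unfolding stewart_ineq_def
  proof (intro ballI impI)
    fix p q r m :: real assume sum: "dist q r = dist q m + dist m r"
    \<comment> \<open>On a line Stewart's theorem is a polynomial identity; the two orders of
      \<open>q\<close>, \<open>m\<close>, \<open>r\<close> differ in signs.\<close>
    have id: "(r - q) * ((p - m)\<^sup>2 + (m - q) * (r - m)) = (r - m) * (p - q)\<^sup>2 + (m - q) * (p - r)\<^sup>2"
      by (simp add: power2_eq_square algebra_simps)
    have sq: "(dist a c)\<^sup>2 = (a - c)\<^sup>2" for a c :: real by (simp add: dist_real_def)
    have "q \<le> m \<and> m \<le> r \<or> r \<le> m \<and> m \<le> q" using sum by (auto simp: dist_real_def)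
    then show "dist q r * ((dist p m)\<^sup>2 + dist q m * dist m r)
        \<le> dist m r * (dist p q)\<^sup>2 + dist q m * (dist p r)\<^sup>2"
    proof
      assume "q \<le> m \<and> m \<le> r"
      then have "dist q r = r - q" "dist q m = m - q" "dist m r = r - m" by (auto simp: dist_real_def)
      then show ?thesis using id by (simp add: sq)
    next
      assume "r \<le> m \<and> m \<le> q"
      then have "dist q r = q - r" "dist q m = q - m" "dist m r = m - r" by (auto simp: dist_real_def)
      moreover have "(q - r) * ((p - m)\<^sup>2 + (q - m) * (m - r)) = (m - r) * (p - q)\<^sup>2 + (q - m) * (p - r)\<^sup>2"
        by (simp add: power2_eq_square algebra_simps)
      ultimately show ?thesis by (simp add: sq)
    qed
  qed
  then show ?thesis using GH geo I.stewart_ineq_imp_CAT0 by (simp add: GH_CAT0_def)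
qed

subsection \<open>Wedges of rescaled spaces\<close>

text \<open>\<open>G\<close> codes a pair of an index and a point as an element of
  \<open>'a\<close>, so that every wedge is a subset of the type of the given spaces. The index
  \<open>k0\<close> only selects which of the coded points \<open>p k\<close> represents the common
  base point.\<close>

locale wedge_family =
  fixes Y :: "'i \<Rightarrow> 'a set" and m :: "'i \<Rightarrow> 'a \<Rightarrow> 'a \<Rightarrow> real" and p :: "'i \<Rightarrow> 'a"
    and G :: "'i \<times> 'a \<Rightarrow> 'a" and k0 :: 'i
  assumes inj_G: "inj G"
    and metric: "\<And>k. Metric_space (Y k) (m k)"
    and p_in: "\<And>k. p k \<in> Y k"
begin

definition base :: 'a where "base = G (k0, p k0)"

definition E :: "'i \<Rightarrow> 'a \<Rightarrow> 'a" where "E k y = (if y = p k then base else G (k, y))"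

definition ix :: "'a \<Rightarrow> 'i" where "ix u = fst (inv G u)"

definition pt :: "'a \<Rightarrow> 'a" where "pt u = snd (inv G u)"

text \<open>The base point is read as a point of the piece \<open>k0\<close>. This agrees with every
  other reading, because its contribution there is \<open>m k0 (p k0) (p k0) = 0\<close>. Outside
  the range of \<open>G\<close> the values are arbitrary but nonnegative for nonnegative scales, and
  symmetric.\<close>

definition wdist :: "('i \<Rightarrow> real) \<Rightarrow> 'a \<Rightarrow> 'a \<Rightarrow> real" where
  "wdist s u v = (if ix u = ix v then s (ix u) * m (ix u) (pt u) (pt v)
     else s (ix u) * m (ix u) (pt u) (p (ix u)) + s (ix v) * m (ix v) (p (ix v)) (pt v))"

text \<open>Pieces of scale 0 are left out: \<open>wdist s\<close> would only be a pseudometric on them.\<close>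
definition wcar :: "('i \<Rightarrow> real) \<Rightarrow> 'a set" where
  "wcar s = (\<Union>k\<in>{k. 0 < s k}. E k ` Y k)"

lemma m_self [simp]: "m k (p k) (p k) = 0"
  using Metric_space.zero[OF metric p_in p_in] by simp

lemma m_nonneg [simp]: "0 \<le> m k x y"
  using Metric_space.nonneg[OF metric] .

lemma m_commute: "m k x y = m k y x"
  using Metric_space.commute[OF metric] .

lemma ix_G [simp]: "ix (G (k, y)) = k" and pt_G [simp]: "pt (G (k, y)) = y"
  by (simp_all add: ix_def pt_def inv_f_f[OF inj_G])

lemma ix_base [simp]: "ix base = k0" and pt_base [simp]: "pt base = p k0"
  by (simp_all add: base_def)

lemma E_p [simp]: "E k (p k) = base"
  by (simp add: E_def)

lemma wdist_E:
  "wdist s (E k y) (E l z) = (if k = l then s k * m k y z else s k * m k y (p k) + s l * m l (p l) z)"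
  by (cases "y = p k"; cases "z = p l") (simp_all add: E_def wdist_def base_def)

lemma wdist_E_base: "wdist s (E k y) base = s k * m k y (p k)"
  using wdist_E[of s k y k "p k"] by simp

lemma wdist_E_base': "wdist s base (E k y) = s k * m k (p k) y"
  using wdist_E[of s k "p k" k y] by simp

lemma wdist_nonneg: "(\<And>k. 0 \<le> s k) \<Longrightarrow> 0 \<le> wdist s u v"
  by (simp add: wdist_def)

lemma wdist_commute: "wdist s u v = wdist s v u"
  using m_commute[of "ix u" "pt u" "pt v"] m_commute[of "ix u" "pt u" "p (ix u)"]
    m_commute[of "ix v" "p (ix v)" "pt v"]
  by (cases "ix u = ix v") (simp_all add: wdist_def)

lemma E_eq_iff: "E k y = E k z \<longleftrightarrow> y = z"
  by (cases "y = p k"; cases "z = p k") (auto simp: E_def base_def inj_eq[OF inj_G])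

lemma Metric_space_piece:
  assumes s: "\<And>k. 0 \<le> s k" and k: "0 < s k"
  shows "Metric_space (E k ` Y k) (wdist s)"
proof -
  interpret Metric_space "Y k" "m k" by (fact metric)
  show ?thesis
  proof
    show "0 \<le> wdist s u v" "wdist s u v = wdist s v u" for u v
      using wdist_nonneg[OF s] wdist_commute by auto
    show "wdist s u v = 0 \<longleftrightarrow> u = v" if "u \<in> E k ` Y k" "v \<in> E k ` Y k" for u v
      using that k by (auto simp: wdist_E E_eq_iff)
    show "wdist s u w \<le> wdist s u v + wdist s v w"
      if "u \<in> E k ` Y k" "v \<in> E k ` Y k" "w \<in> E k ` Y k" for u v w
      using that k triangle by (auto simp: wdist_E mult_left_mono simp flip: distrib_left)
  qed
qed

lemma wedge_wcar:
  assumes s: "\<And>k. 0 \<le> s k" and ne: "\<exists>k. 0 < s k"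
  shows "wedge {k. 0 < s k} (\<lambda>k. E k ` Y k) (wdist s) base"
proof (rule wedge.intro)
  show "{k. 0 < s k} \<noteq> {}" using ne by auto
  show "base \<in> E k ` Y k" if "k \<in> {k. 0 < s k}" for k
    using p_in[of k] by (metis E_p image_eqI)
  show "0 \<le> wdist s u v" "wdist s u v = wdist s v u" for u v
    using wdist_nonneg[OF s] wdist_commute by auto
  show "Metric_space (E k ` Y k) (wdist s)" if "k \<in> {k. 0 < s k}" for k
    using Metric_space_piece[OF s] that by simp
  show "wdist s x y = wdist s x base + wdist s base y"
    if "k \<in> {k. 0 < s k}" "l \<in> {k. 0 < s k}" "k \<noteq> l" "x \<in> E k ` Y k" "y \<in> E l ` Y l" for k l x y
    using that by (auto simp: wdist_E wdist_E_base wdist_E_base')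
qed

lemma Metric_space_wcar:
  assumes s: "\<And>k. 0 \<le> s k" and ne: "\<exists>k. 0 < s k"
  shows "Metric_space (wcar s) (wdist s)"
proof -
  interpret wedge "{k. 0 < s k}" "\<lambda>k. E k ` Y k" "wdist s" base by (rule wedge_wcar[OF assms])
  show ?thesis using Metric_space_W unfolding W_def wcar_def .
qed

lemma base_in_wcar: "\<exists>k. 0 < s k \<Longrightarrow> base \<in> wcar s"
proof -
  assume "\<exists>k. 0 < s k"
  then obtain k where "0 < s k" by blast
  moreover have "base \<in> E k ` Y k" using p_in[of k] by (metis E_p image_eqI)
  ultimately show ?thesis unfolding wcar_def by blast
qed

lemma similarity_E: "0 < s k \<Longrightarrow> similarity (s k) (Y k) (m k) (E k ` Y k) (wdist s) (E k)"
  by (simp add: similarity_def wdist_E)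

lemma GH_class_wcar:
  assumes S: "S \<in> {GH_connected, GH_path_connected, GH_geodesic, GH_CAT0}"
    and pieces: "\<And>k. S (Y k) (m k)"
    and s: "\<And>k. 0 \<le> s k" and ne: "\<exists>k. 0 < s k"
    and bound: "\<And>k y z. y \<in> Y k \<Longrightarrow> z \<in> Y k \<Longrightarrow> m k y z \<le> \<Delta>" and "\<Delta> > 0"
    and fin: "\<And>\<epsilon>. \<epsilon> > 0 \<Longrightarrow> finite {k. \<epsilon> \<le> s k}"
  shows "S (wcar s) (wdist s)"
  unfolding wcar_def
proof (rule GH_class_wedge[OF S wedge_wcar[OF s ne]])
  show "S (E k ` Y k) (wdist s)" if "k \<in> {k. 0 < s k}" for k
    using GH_class_similarity[OF S pieces Metric_space_piece[OF s] similarity_E] that by simp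
  fix \<epsilon> :: real assume "\<epsilon> > 0"
  have "\<epsilon> / \<Delta> \<le> s k" if "y \<in> Y k" "\<epsilon> \<le> wdist s (E k y) base" for k y
  proof -
    have "\<epsilon> \<le> s k * m k y (p k)" using that by (simp add: wdist_E_base)
    also have "\<dots> \<le> s k * \<Delta>" using bound[OF that(1) p_in] s by (simp add: mult_left_mono)
    finally show ?thesis using \<open>\<Delta> > 0\<close> by (simp add: pos_divide_le_eq)
  qed
  then have "{k \<in> {k. 0 < s k}. \<exists>x\<in>E k ` Y k. \<epsilon> \<le> wdist s x base} \<subseteq> {k. \<epsilon> / \<Delta> \<le> s k}" by auto
  then show "finite {k \<in> {k. 0 < s k}. \<exists>x\<in>E k ` Y k. \<epsilon> \<le> wdist s x base}"
    by (rule finite_subset) (use fin[of "\<epsilon> / \<Delta>"] \<open>\<epsilon> > 0\<close> \<open>\<Delta> > 0\<close> in simp)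
qed

text \<open>Parametrises every \<open>wcar s\<close> by the same pairs \<open>(k, y)\<close>, also
  when the sets of pieces of positive scale differ; a missing piece is sent to the base
  point.\<close>

definition collapse :: "('i \<Rightarrow> real) \<Rightarrow> 'i \<Rightarrow> 'a \<Rightarrow> 'a" where
  "collapse s k y = (if 0 < s k then E k y else base)"

lemma collapse_in_wcar:
  assumes "\<exists>k. 0 < s k" "y \<in> Y k" shows "collapse s k y \<in> wcar s"
proof (cases "0 < s k")
  case True
  then have "E k y \<in> wcar s" using assms(2) unfolding wcar_def by blast
  then show ?thesis using True by (simp add: collapse_def)
next
  case False
  then show ?thesis using base_in_wcar[OF assms(1)] by (simp add: collapse_def)
qed

lemma wcar_collapse:
  assumes "u \<in> wcar s" obtains k y where "y \<in> Y k" "0 < s k" "u = E k y" "u = collapse s k y"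
proof -
  obtain k y where "0 < s k" "y \<in> Y k" "u = E k y" using assms unfolding wcar_def by blast
  then show ?thesis using that[of y k] by (simp add: collapse_def)
qed

lemma wdist_collapse:
  assumes s: "\<And>k. 0 \<le> s k"
  shows "wdist s (collapse s k y) (collapse s l z)
      = (if k = l then s k * m k y z else s k * m k y (p k) + s l * m l (p l) z)"
proof -
  define y' z' where "y' = (if 0 < s k then y else p k)" and "z' = (if 0 < s l then z else p l)"
  have "collapse s k y = E k y'" "collapse s l z = E l z'"
    by (auto simp: collapse_def y'_def z'_def)
  moreover have "s k = 0 \<or> 0 < s k" "s l = 0 \<or> 0 < s l" using s[of k] s[of l] by auto
  ultimately show ?thesis by (auto simp: wdist_E y'_def z'_def)
qed

text \<open>Points with the same parameters \<open>(k, y)\<close> correspond. A distance in a wedge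
  involves at most two pieces, and each contributes a change of at most
  \<open>\<eta> * \<Delta>\<close>. A piece whose scale drops to 0 causes no jump, since it shrinks
  to the base point.\<close>

lemma GH_close_wcar:
  assumes s: "\<And>k. 0 \<le> s k" "\<exists>k. 0 < s k" and s': "\<And>k. 0 \<le> s' k" "\<exists>k. 0 < s' k"
    and near: "\<And>k. \<bar>s k - s' k\<bar> \<le> \<eta>"
    and bound: "\<And>k y z. y \<in> Y k \<Longrightarrow> z \<in> Y k \<Longrightarrow> m k y z \<le> \<Delta>"
  shows "GH_close (2 * (\<eta> * \<Delta>)) (wcar s) (wdist s) (wcar s') (wdist s')"
proof -
  have bd: "\<bar>s k * m k y z - s' k * m k y z\<bar> \<le> \<eta> * \<Delta>" if "y \<in> Y k" "z \<in> Y k" for k y z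
  proof -
    have "\<bar>s k * m k y z - s' k * m k y z\<bar> = \<bar>s k - s' k\<bar> * m k y z"
      by (simp add: abs_mult flip: left_diff_distrib)
    also have "\<dots> \<le> \<eta> * \<Delta>"
      using near[of k] bound[OF that] by (intro mult_mono) auto
    finally show ?thesis .
  qed
  have "\<eta> * \<Delta> \<ge> 0"
    using bd[OF p_in p_in] by (meson abs_ge_zero order_trans)
  have dis: "\<bar>wdist s (collapse s k y) (collapse s l z) - wdist s' (collapse s' k y) (collapse s' l z)\<bar> \<le> 2 * (\<eta> * \<Delta>)"
    if "y \<in> Y k" "z \<in> Y l" for k l y z
    using bd[OF that(1) p_in] bd[OF p_in that(2)] bd[of y k z] that \<open>\<eta> * \<Delta> \<ge> 0\<close>
    unfolding wdist_collapse[OF s(1)] wdist_collapse[OF s'(1)] by (auto simp: abs_le_iff)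
  define R where "R u v \<longleftrightarrow> (\<exists>k y. y \<in> Y k \<and> u = collapse s k y \<and> v = collapse s' k y)" for u v
  have 1: "\<forall>u\<in>wcar s. \<exists>v\<in>wcar s'. R u v"
    using wcar_collapse[of _ s] collapse_in_wcar[OF s'(2)] unfolding R_def by metis
  have 2: "\<forall>v\<in>wcar s'. \<exists>u\<in>wcar s. R u v"
    using wcar_collapse[of _ s'] collapse_in_wcar[OF s(2)] unfolding R_def by metis
  have 3: "\<bar>wdist s u u' - wdist s' v v'\<bar> \<le> 2 * (\<eta> * \<Delta>)" if "R u v" "R u' v'" for u u' v v'
    using that dis unfolding R_def by blast
  show ?thesis
    unfolding GH_close_def by (rule exI[of _ R]) (use 1 2 3 in blast)
qed

end

subsection \<open>Counting separated points\<close>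

definition separated :: "real \<Rightarrow> ('a \<Rightarrow> 'a \<Rightarrow> real) \<Rightarrow> 'a set \<Rightarrow> bool" where
  "separated \<epsilon> d B \<longleftrightarrow> (\<forall>x\<in>B. \<forall>y\<in>B. x \<noteq> y \<longrightarrow> \<epsilon> \<le> d x y)"

lemma separated_subset: "separated \<epsilon> d B \<Longrightarrow> C \<subseteq> B \<Longrightarrow> separated \<epsilon> d C"
  unfolding separated_def by blast

text \<open>Two points in one ball of radius \<open>\<epsilon>\<close> are closer than
  \<open>2 * \<epsilon>\<close>, so each ball of a finite cover holds at most one point of
  \<open>B\<close>.\<close>

lemma in_GH_space_packing:
  assumes "in_GH_space X d" "\<epsilon> > 0"
  obtains N :: nat where "\<And>B. B \<subseteq> X \<Longrightarrow> separated (2 * \<epsilon>) d B \<Longrightarrow> finite B \<and> card B \<le> N"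
proof -
  interpret Metric_space X d using assms(1) by (simp add: in_GH_space_def)
  have "mtotally_bounded X"
    using assms(1) compactin_imp_mtotally_bounded[of X] by (simp add: in_GH_space_def compact_space_def)
  then have "\<exists>F. finite F \<and> F \<subseteq> X \<and> X \<subseteq> (\<Union>x\<in>F. mball x \<epsilon>)"
    using assms(2) by (simp add: mtotally_bounded_def)
  then obtain F where F: "finite F" "F \<subseteq> X" "X \<subseteq> (\<Union>x\<in>F. mball x \<epsilon>)" by blast
  have "finite B \<and> card B \<le> card F" if B: "B \<subseteq> X" "separated (2 * \<epsilon>) d B" for B
  proof -
    have "\<forall>y\<in>B. \<exists>x\<in>F. d x y < \<epsilon>" using B(1) F(3) by fastforce
    then obtain c where c: "\<And>y. y \<in> B \<Longrightarrow> c y \<in> F \<and> d (c y) y < \<epsilon>" by metis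
    have "inj_on c B"
    proof (rule inj_onI, rule ccontr)
      fix y z assume yz: "y \<in> B" "z \<in> B" "c y = c z" "y \<noteq> z"
      have "d y z \<le> d (c y) y + d (c z) z"
        using triangle''[of y "c y" z] yz B(1) c[of y] F(2) by auto
      also have "\<dots> < 2 * \<epsilon>" using c[of y] c[of z] yz by simp
      finally show False using B(2) yz unfolding separated_def by fastforce
    qed
    moreover have "c ` B \<subseteq> F" using c by blast
    ultimately show ?thesis using F(1) by (meson card_inj_on_le inj_on_finite)
  qed
  then show ?thesis using that by blast
qed

text \<open>\<open>Inl i\<close> indexes the given spaces and \<open>Inr (j, i)\<close> the
  \<open>i\<close>-th arm of level \<open>j\<close>; all arms are one unit segment, and only scales
  tell them apart. In \<open>many_arms\<close> the summand \<open>card K * N t\<close> beats the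
  given spaces in a count around the base point, \<open>N t\<close> beats a single piece in a count
  elsewhere, and 2 makes sure that the counted set has two points.\<close>

locale armed_wedge = wedge_family Y m p G k0
  for Y :: "nat + nat \<times> nat \<Rightarrow> 'a set" and m p and G :: "(nat + nat \<times> nat) \<times> 'a \<Rightarrow> 'a" and k0 +
  fixes arm :: "real \<Rightarrow> 'a" and K :: "nat set" and N M :: "nat \<Rightarrow> nat"
  assumes arm_image: "\<And>l. Y (Inr l) = arm ` {0..1}"
    and arm_dist: "\<And>l s t. s \<in> {0..1} \<Longrightarrow> t \<in> {0..1} \<Longrightarrow> m (Inr l) (arm s) (arm t) = \<bar>s - t\<bar>"
    and arm_base: "\<And>l. p (Inr l) = arm 0"
    and finite_K: "finite K"
    and packing: "\<And>k t B. B \<subseteq> Y k \<Longrightarrow> separated (2 * (1/16) ^ t) (m k) B \<Longrightarrow> finite B \<and> card B \<le> N t"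
    and many_arms: "\<And>t. card K * N t + N t + 2 \<le> M t"
begin

definition scales :: "(nat \<Rightarrow> real) \<Rightarrow> (nat \<Rightarrow> real) \<Rightarrow> nat + nat \<times> nat \<Rightarrow> real" where
  "scales \<alpha> \<sigma> k = (case k of Inl i \<Rightarrow> if i \<in> K then \<alpha> i else 0
     | Inr (j, i) \<Rightarrow> if i < M j then \<sigma> j else 0)"

lemma scales_Inl [simp]: "scales \<alpha> \<sigma> (Inl i) = (if i \<in> K then \<alpha> i else 0)"
  and scales_Inr [simp]: "scales \<alpha> \<sigma> (Inr (j, i)) = (if i < M j then \<sigma> j else 0)"
  by (simp_all add: scales_def)

text \<open>A scale of at most 1 shrinks distances, so a separated set in the rescaled piece is at
  least as separated in the original. The bound therefore holds for all scales at once.\<close>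

lemma piece_packing:
  assumes B: "B \<subseteq> E k ` Y k" "separated (2 * \<epsilon>) (wdist s) B" and "(1/16) ^ t \<le> \<epsilon>" "s k \<le> 1"
  shows "finite B \<and> card B \<le> N t"
proof -
  define C where "C = {y \<in> Y k. E k y \<in> B}"
  have BC: "B = E k ` C" using B(1) by (auto simp: C_def)
  have "2 * (1/16) ^ t \<le> m k y z" if "y \<in> C" "z \<in> C" "y \<noteq> z" for y z
  proof -
    have "2 * \<epsilon> \<le> wdist s (E k y) (E k z)"
      using B(2) that E_eq_iff[of k y z] by (auto simp: separated_def C_def)
    also have "\<dots> = s k * m k y z" by (simp add: wdist_E)
    also have "\<dots> \<le> 1 * m k y z" using assms(4) by (rule mult_right_mono) simp
    finally show ?thesis using assms(3) by simp
  qed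
  then have "separated (2 * (1/16) ^ t) (m k) C" by (simp add: separated_def)
  then have "finite C \<and> card C \<le> N t" using packing[of C k t] by (auto simp: C_def)
  then show ?thesis using card_image_le[of C "E k"] by (auto simp: BC)
qed

text \<open>A closed ball that does not reach the base point stays inside one piece.\<close>

lemma packing_off_base:
  assumes s: "\<And>k. 0 \<le> s k" "\<And>k. s k \<le> 1"
    and x: "x \<in> wcar s" and B: "B \<subseteq> wcar s" "separated (2 * \<epsilon>) (wdist s) B"
    and near: "\<And>u. u \<in> B \<Longrightarrow> wdist s x u \<le> \<epsilon>" and far: "\<epsilon> < wdist s x base"
    and t: "(1/16) ^ t \<le> \<epsilon>"
  shows "finite B \<and> card B \<le> N t"
proof -
  obtain k y where k: "y \<in> Y k" "0 < s k" "x = E k y" using wcar_collapse[OF x] by blast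
  interpret wedge "{k. 0 < s k}" "\<lambda>k. E k ` Y k" "wdist s" base
    by (rule wedge_wcar) (use s k in auto)
  have "u \<in> E k ` Y k" if "u \<in> B" for u
  proof (rule ccontr)
    assume u: "u \<notin> E k ` Y k"
    obtain l z where l: "z \<in> Y l" "0 < s l" "u = E l z"
      using wcar_collapse[of u s] B(1) \<open>u \<in> B\<close> by blast
    have "l \<noteq> k" using u l by auto
    then have "wdist s x u = wdist s x base + wdist s base u"
      using cross[of k l x u] k l by auto
    then show False using near[OF that] far D_nonneg[of base u] by linarith
  qed
  then show ?thesis using piece_packing[of B k \<epsilon> s t] B(2) t s(2) by blast
qed

text \<open>All points of \<open>B\<close> turn out to lie at distance exactly
  \<open>\<epsilon>\<close> from the base point. An arm has at most one such point, and none if it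
  is shorter than \<open>\<epsilon>\<close>, as all arms from level \<open>t\<close> on are. Each
  given space contributes at most \<open>N t\<close> points.\<close>

lemma packing_at_base:
  fixes \<alpha> \<sigma>
  defines "s \<equiv> scales \<alpha> \<sigma>"
  assumes s: "\<And>k. 0 \<le> s k" "\<And>k. s k \<le> 1" and dec: "decseq \<sigma>"
    and B: "B \<subseteq> wcar s" "separated (2 * \<epsilon>) (wdist s) B" "finite B" "2 \<le> card B"
    and near: "\<And>u. u \<in> B \<Longrightarrow> wdist s base u \<le> \<epsilon>" and "0 < \<epsilon>"
    and t: "(1/16) ^ t \<le> \<epsilon>" "\<sigma> t < \<epsilon>"
  shows "card B \<le> card K * N t + sum M {..<t}"
proof -
  let ?L = "SIGMA j:{..<t}. {..<M j}"
  have "B \<noteq> {}" using B(4) by auto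
  then have "\<exists>k. 0 < s k" using B(1) by (auto simp: wcar_def)
  then interpret Metric_space "wcar s" "wdist s" using Metric_space_wcar s by blast
  have base: "base \<in> wcar s" by (rule base_in_wcar) fact
  \<comment> \<open>Since \<open>2 \<le> card B\<close>, each point has a partner at distance at
    least \<open>2 * \<epsilon>\<close>, while both are within \<open>\<epsilon>\<close> of the base
    point; so neither can be closer.\<close>
  have eps: "wdist s base u = \<epsilon>" if u: "u \<in> B" for u
  proof -
    have "\<exists>v\<in>B. v \<noteq> u"
    proof (rule ccontr)
      assume "\<not> (\<exists>v\<in>B. v \<noteq> u)"
      then have "B \<subseteq> {u}" by blast
      then have "card B \<le> 1" using card_mono[of "{u}" B] by simp
      then show False using B(4) by simp
    qed
    then obtain v where v: "v \<in> B" "v \<noteq> u" by blast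
    have "2 * \<epsilon> \<le> wdist s u v" using B(2) u v by (auto simp: separated_def)
    also have "\<dots> \<le> wdist s base u + wdist s base v" using triangle''[of u base v] base u v B(1) by auto
    finally show ?thesis using near[OF u] near[OF v(1)] by linarith
  qed
  define BX where "BX = (\<Union>i\<in>K. B \<inter> E (Inl i) ` Y (Inl i))"
  have "card BX \<le> (\<Sum>i\<in>K. card (B \<inter> E (Inl i) ` Y (Inl i)))"
    unfolding BX_def by (rule card_UN_le[OF finite_K])
  also have "\<dots> \<le> (\<Sum>i\<in>K. N t)"
  proof (rule sum_mono)
    show "card (B \<inter> E (Inl i) ` Y (Inl i)) \<le> N t" for i
      using piece_packing[of "B \<inter> E (Inl i) ` Y (Inl i)" "Inl i" \<epsilon> s t] B(2) t s(2) separated_subset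
      by blast
  qed
  finally have cX: "card BX \<le> card K * N t" by simp
  have "\<exists>l \<tau>. l \<in> ?L \<and> \<tau> \<in> {0..1} \<and> u = E (Inr l) (arm \<tau>) \<and> s (Inr l) * \<tau> = \<epsilon>" if u: "u \<in> B - BX" for u
  proof -
    obtain k y where k: "y \<in> Y k" "0 < s k" "u = E k y" using wcar_collapse[of u s] B(1) u by blast
    have "k \<notin> range Inl"
    proof
      assume "k \<in> range Inl"
      then obtain i where "k = Inl i" by blast
      moreover have "i \<in> K" using k(2) \<open>k = Inl i\<close> by (auto simp: s_def split: if_splits)
      ultimately show False using u k by (auto simp: BX_def)
    qed
    then obtain j i where ji: "k = Inr (j, i)" by (cases k) auto
    then obtain \<tau> where \<tau>: "\<tau> \<in> {0..1}" "y = arm \<tau>" using k(1) arm_image by auto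
    have "i < M j" "s (Inr (j, i)) = \<sigma> j" using k(2) by (auto simp: ji s_def split: if_splits)
    have "wdist s base u = s k * \<tau>"
      using wdist_E_base'[of s k y] arm_dist[of 0 \<tau> "(j, i)"] arm_base k \<tau> ji by auto
    then have e: "s k * \<tau> = \<epsilon>" using eps u by simp
    then have "\<epsilon> \<le> \<sigma> j"
      using \<tau>(1) s(1)[of k] mult_left_le[of \<tau> "s k"] \<open>s (Inr (j, i)) = \<sigma> j\<close> ji by simp
    then have "j < t" using t(2) decseqD[OF dec, of t j] by (meson leI not_le order.trans)
    then have "(j, i) \<in> ?L" using \<open>i < M j\<close> by simp
    then show ?thesis using \<tau> k e ji by blast
  qed
  then obtain l \<tau> where l: "\<And>u. u \<in> B - BX \<Longrightarrow> l u \<in> ?L \<and> \<tau> u \<in> {0..1} \<and>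
      u = E (Inr (l u)) (arm (\<tau> u)) \<and> s (Inr (l u)) * \<tau> u = \<epsilon>" by metis
  have "inj_on l (B - BX)"
  proof (rule inj_onI)
    fix u v assume uv: "u \<in> B - BX" "v \<in> B - BX" "l u = l v"
    have "s (Inr (l u)) \<noteq> 0" using l[OF uv(1)] \<open>0 < \<epsilon>\<close> by auto
    then have "\<tau> u = \<tau> v" using l[OF uv(1)] l[OF uv(2)] uv(3) by (metis mult_left_cancel)
    then show "u = v" using l[OF uv(1)] l[OF uv(2)] uv(3) by metis
  qed
  moreover have "l ` (B - BX) \<subseteq> ?L" using l by blast
  ultimately have "card (B - BX) \<le> card ?L" by (intro card_inj_on_le) auto
  also have "\<dots> = sum M {..<t}" by simp
  finally have "card (B - BX) \<le> sum M {..<t}" .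
  moreover have "card B \<le> card BX + card (B - BX)"
  proof -
    have "B = BX \<union> (B - BX)" by (auto simp: BX_def)
    then show ?thesis using card_Un_le[of BX "B - BX"] by simp
  qed
  ultimately show ?thesis using cX by linarith
qed

text \<open>On every arm of level at most \<open>t\<close>, take the point at distance
  \<open>\<sigma> t\<close> from the base point; on level \<open>t\<close> it is the tip. Routes
  between different arms pass the base point and have length \<open>2 * \<sigma> t\<close>.\<close>

lemma arm_tips:
  fixes \<alpha> \<sigma>
  defines "s \<equiv> scales \<alpha> \<sigma>"
  assumes pos: "\<And>j. 0 < \<sigma> j" and dec: "decseq \<sigma>"
  obtains B where "B \<subseteq> wcar s" "separated (2 * \<sigma> t) (wdist s) B" "finite B" "card B = sum M {..t}"
    "\<And>u. u \<in> B \<Longrightarrow> wdist s base u \<le> \<sigma> t"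
proof -
  let ?L = "SIGMA j:{..t}. {..<M j}"
  define f where "f l = E (Inr l) (arm (\<sigma> t / \<sigma> (fst l)))" for l :: "nat \<times> nat"
  have r: "\<sigma> t / \<sigma> (fst l) \<in> {0..1}" and sl: "s (Inr l) = \<sigma> (fst l)" if "l \<in> ?L" for l
    using that pos[of t] pos[of "fst l"] decseqD[OF dec, of "fst l" t] by (auto simp: s_def)
  have dist_b: "s (Inr l) * m (Inr l) (arm 0) (arm (\<sigma> t / \<sigma> (fst l))) = \<sigma> t"
    and dist_b': "s (Inr l) * m (Inr l) (arm (\<sigma> t / \<sigma> (fst l))) (arm 0) = \<sigma> t" if "l \<in> ?L" for l
    using arm_dist[OF _ r[OF that], of 0 l] arm_dist[OF r[OF that], of 0 l] pos[of t]
      pos[of "fst l"] sl[OF that] by auto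
  have d: "wdist s (f l) (f l') = 2 * \<sigma> t" if "l \<in> ?L" "l' \<in> ?L" "l \<noteq> l'" for l l'
    unfolding f_def wdist_E using that dist_b[OF that(2)] dist_b'[OF that(1)] arm_base by simp
  have inj: "inj_on f ?L"
  proof (rule inj_onI, rule ccontr)
    fix l l' assume l: "l \<in> ?L" "l' \<in> ?L" "f l = f l'" "l \<noteq> l'"
    have "wdist s (f l) (f l) = s (Inr l) * 0"
      using Metric_space.mdist_zero[OF metric[of "Inr l"]] r[OF l(1)] arm_image
      unfolding f_def wdist_E by auto
    then show False using d[OF l(1,2,4)] l(3) pos[of t] by simp
  qed
  show ?thesis
  proof (rule that[of "f ` ?L"])
    show "f ` ?L \<subseteq> wcar s"
    proof
      fix u assume "u \<in> f ` ?L"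
      then obtain l where l: "l \<in> ?L" "u = f l" by blast
      have "arm (\<sigma> t / \<sigma> (fst l)) \<in> Y (Inr l)" using r[OF l(1)] arm_image by blast
      moreover have "0 < s (Inr l)" using sl[OF l(1)] pos by simp
      ultimately show "u \<in> wcar s" unfolding wcar_def l(2) f_def by blast
    qed
    show "separated (2 * \<sigma> t) (wdist s) (f ` ?L)"
      unfolding separated_def
    proof (intro ballI impI)
      fix u v assume "u \<in> f ` ?L" "v \<in> f ` ?L" "u \<noteq> v"
      then obtain l l' where "l \<in> ?L" "l' \<in> ?L" "u = f l" "v = f l'" "l \<noteq> l'" by blast
      then show "2 * \<sigma> t \<le> wdist s u v" using d by simp
    qed
    show "finite (f ` ?L)" by simp
    show "card (f ` ?L) = sum M {..t}" using card_image[OF inj] by simp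
    show "wdist s base u \<le> \<sigma> t" if "u \<in> f ` ?L" for u
    proof -
      obtain l where "l \<in> ?L" "u = f l" using \<open>u \<in> f ` ?L\<close> by blast
      then show ?thesis using dist_b[of l] arm_base by (simp only: f_def wdist_E_base' order_refl)
    qed
  qed
qed

text \<open>The isometry carries the tips to a separated set around the image \<open>x\<close> of
  the base point. Comparing its size with the packing bounds first excludes
  \<open>x \<noteq> base\<close> and then \<open>\<sigma>' t < \<sigma> t\<close>.\<close>

lemma isometric_scales_le:
  fixes \<alpha> \<sigma> \<alpha>' \<sigma>'
  defines "s \<equiv> scales \<alpha> \<sigma>" and "s' \<equiv> scales \<alpha>' \<sigma>'"
  assumes s: "\<And>k. 0 \<le> s k" "\<And>k. s k \<le> 1" and s': "\<And>k. 0 \<le> s' k" "\<And>k. s' k \<le> 1"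
    and pos: "\<And>j. 0 < \<sigma> j" and dec: "decseq \<sigma>" "decseq \<sigma>'" and lim: "\<sigma> \<longlonglongrightarrow> 0"
    and large: "eventually (\<lambda>t. (1/16) ^ t \<le> \<sigma> t) sequentially"
    and iso: "isometric (wcar s) (wdist s) (wcar s') (wdist s')"
  shows "eventually (\<lambda>t. \<sigma> t \<le> \<sigma>' t) sequentially"
proof -
  obtain f where f: "bij_betw f (wcar s) (wcar s')"
    "\<And>u v. u \<in> wcar s \<Longrightarrow> v \<in> wcar s \<Longrightarrow> wdist s' (f u) (f v) = wdist s u v"
    using iso unfolding isometric_def by blast
  have "M 0 > 0" using many_arms[of 0] by linarith
  then have "0 < s (Inr (0, 0))" using pos[of 0] by (simp add: s_def)
  then have base: "base \<in> wcar s" using base_in_wcar by blast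
  define x where "x = f base"
  have x: "x \<in> wcar s'" using base f(1) by (auto simp: x_def bij_betw_def)
  then have ne': "\<exists>k. 0 < s' k" by (auto simp: wcar_def)
  interpret W': Metric_space "wcar s'" "wdist s'" by (rule Metric_space_wcar[OF s'(1) ne'])
  have image: "\<exists>B. B \<subseteq> wcar s' \<and> separated (2 * \<sigma> t) (wdist s') B \<and> finite B \<and> card B = sum M {..t}
    \<and> (\<forall>u\<in>B. wdist s' x u \<le> \<sigma> t)" for t
  proof -
    obtain B where B: "B \<subseteq> wcar s" "separated (2 * \<sigma> t) (wdist s) B" "finite B" "card B = sum M {..t}"
      "\<And>u. u \<in> B \<Longrightarrow> wdist s base u \<le> \<sigma> t"
      using arm_tips[where \<alpha> = \<alpha> and t = t, OF pos dec(1)] unfolding s_def by metis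
    have "f ` B \<subseteq> wcar s'" using B(1) f(1) by (auto simp: bij_betw_def)
    moreover have "separated (2 * \<sigma> t) (wdist s') (f ` B)"
      using B(1,2) f(2) unfolding separated_def by (auto simp: subset_iff)
    moreover have "card (f ` B) = sum M {..t}"
      using card_image[of f B] inj_on_subset[of f "wcar s" B] f(1) B by (simp add: bij_betw_def)
    moreover have "wdist s' x u \<le> \<sigma> t" if "u \<in> f ` B" for u
      using that B(1,5) f(2) base by (auto simp: x_def subset_iff)
    ultimately show ?thesis using B(3) by blast
  qed
  have M_le: "M t \<le> sum M {..t}" for t by (rule member_le_sum) auto
  show ?thesis
  proof (cases "x = base")
    case True
    show ?thesis
      using large
    proof eventually_elim
      case (elim t)
      show ?case
      proof (rule ccontr)
        assume less: "\<not> \<sigma> t \<le> \<sigma>' t"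
        obtain B where B: "B \<subseteq> wcar s'" "separated (2 * \<sigma> t) (wdist s') B" "finite B"
          "card B = sum M {..t}" "\<forall>u\<in>B. wdist s' base u \<le> \<sigma> t"
          using image[of t] True by blast
        have "2 \<le> card B" using B(4) M_le[of t] many_arms[of t] by linarith
        \<comment> \<open>Arms of level \<open>t\<close> now being too short, the sum stops below
          \<open>t\<close>, and \<open>card K * N t\<close> cannot replace the missing
          \<open>M t\<close>.\<close>
        then have "card B \<le> card K * N t + sum M {..<t}"
          using packing_at_base[of \<alpha>' \<sigma>' B "\<sigma> t" t] s' dec(2) B pos[of t] elim less
          unfolding s'_def by auto
        moreover have "sum M {..t} = sum M {..<t} + M t"
          by (simp add: lessThan_Suc_atMost[symmetric])
        ultimately show False using B(4) many_arms[of t] by linarith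
      qed
    qed
  next
    case False
    have "0 < wdist s' x base" using False x base_in_wcar[OF ne'] by simp
    then have "eventually (\<lambda>t. \<sigma> t < wdist s' x base) sequentially"
      using order_tendstoD(2)[OF lim] by blast
    \<comment> \<open>For large \<open>t\<close> the ball about \<open>x\<close> misses the base
      point, so it admits \<open>N t\<close> points at most, fewer than \<open>M t\<close>. The case
      is contradictory.\<close>
    then have "eventually (\<lambda>t. False) sequentially"
      using large
    proof eventually_elim
      case (elim t)
      obtain B where B: "B \<subseteq> wcar s'" "separated (2 * \<sigma> t) (wdist s') B" "finite B"
        "card B = sum M {..t}" "\<forall>u\<in>B. wdist s' x u \<le> \<sigma> t"
        using image[of t] by blast
      have "card B \<le> N t"
        using packing_off_base[OF s' x B(1,2)] B(5) elim by blast
      then show ?case using B(4) M_le[of t] many_arms[of t] by linarith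
    qed
    then show ?thesis by simp
  qed
qed

end

section \<open>Arm lengths and the recovery of their parameters\<close>

definition arm_length :: "real \<Rightarrow> (nat \<Rightarrow> real) \<Rightarrow> nat \<Rightarrow> real" where
  "arm_length r w t = r * (1/4) ^ t * (1 + w t) / 2"

lemma arm_length_bounds:
  assumes "0 \<le> r" "r \<le> 1" "\<And>t. 0 \<le> w t" "\<And>t. w t \<le> 1"
  shows "r * (1/4) ^ t / 2 \<le> arm_length r w t" "arm_length r w t \<le> r * (1/4) ^ t"
    "arm_length r w t \<le> (1/4) ^ t" "0 \<le> arm_length r w t"
proof -
  have q: "0 \<le> r * (1/4) ^ t" using assms(1) by simp
  show "r * (1/4) ^ t / 2 \<le> arm_length r w t"
    using mult_left_mono[OF _ q, of 1 "1 + w t"] assms(3)[of t] by (simp add: arm_length_def)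
  moreover show *: "arm_length r w t \<le> r * (1/4) ^ t"
    using mult_left_mono[OF _ q, of "1 + w t" 2] assms(4)[of t] by (simp add: arm_length_def)
  moreover have "r * (1/4) ^ t \<le> 1 * (1/4) ^ t" using assms(2) by (rule mult_right_mono) simp
  ultimately show "arm_length r w t \<le> (1/4) ^ t" "0 \<le> arm_length r w t" using q by linarith+
qed

text \<open>The factor \<open>(1 + w t) / 2\<close> varies between 1/2 and 1 only, which cannot
  compensate the drop by 1/4 from one level to the next. So the lengths encode \<open>w\<close>
  without mixing levels.\<close>

lemma decseq_arm_length:
  assumes "0 \<le> r" "r \<le> 1" "\<And>t. 0 \<le> w t" "\<And>t. w t \<le> 1"
  shows "decseq (arm_length r w)"
proof (rule decseq_SucI)
  fix t
  have "arm_length r w (Suc t) \<le> r * (1/4) ^ Suc t" using arm_length_bounds(2)[OF assms] .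
  also have "\<dots> \<le> r * (1/4) ^ t / 2" using assms(1) by simp
  also have "\<dots> \<le> arm_length r w t" using arm_length_bounds(1)[OF assms] .
  finally show "arm_length r w (Suc t) \<le> arm_length r w t" .
qed

lemma arm_length_tendsto_0:
  assumes "0 \<le> r" "r \<le> 1" "\<And>t. 0 \<le> w t" "\<And>t. w t \<le> 1"
  shows "arm_length r w \<longlonglongrightarrow> 0"
proof (rule tendsto_sandwich[of "\<lambda>_. 0" _ _ "\<lambda>t. (1/4) ^ t"])
  show "(\<lambda>t. (1/4) ^ t :: real) \<longlonglongrightarrow> 0" by (rule LIMSEQ_realpow_zero) auto
qed (use arm_length_bounds[OF assms] in auto)

text \<open>Of the two factors \<open>(1/4) ^ t\<close> of \<open>(1/16) ^ t\<close>, one eventually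
  falls below \<open>r / 2\<close>.\<close>

lemma arm_length_eventually_ge:
  assumes "0 < r" "r \<le> 1" "\<And>t. 0 \<le> w t" "\<And>t. w t \<le> 1"
  shows "eventually (\<lambda>t. (1/16) ^ t \<le> arm_length r w t) sequentially"
proof -
  have "(\<lambda>t. (1/4) ^ t :: real) \<longlonglongrightarrow> 0" by (rule LIMSEQ_realpow_zero) auto
  then have "eventually (\<lambda>t. (1/4) ^ t < r / 2) sequentially"
    using assms(1) by (intro order_tendstoD) auto
  then show ?thesis
  proof eventually_elim
    case (elim t)
    have "(1/16 :: real) ^ t = (1/4) ^ t * (1/4) ^ t" by (simp flip: power_mult_distrib)
    also have "\<dots> \<le> r / 2 * (1/4) ^ t" using elim by (intro mult_right_mono) auto
    also have "\<dots> \<le> arm_length r w t" using arm_length_bounds(1)[of r w t] assms by simp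
    finally show ?case .
  qed
qed

text \<open>
  Only the tail of the sequence of arm lengths can be recovered; \<open>prod_decode\<close> repeats every
  value \<open>w j\<close> infinitely often.
\<close>
lemma arm_length_eventually_eq:
  assumes ev: "eventually (\<lambda>t. arm_length r (\<lambda>t. w (fst (prod_decode t))) t
      = arm_length r' (\<lambda>t. w' (fst (prod_decode t))) t) sequentially"
    and "r > 0" "w 0 = 0" "w' 0 = 0"
  shows "w = w'"
proof -
  obtain T where T: "\<And>t. t \<ge> T \<Longrightarrow> arm_length r (\<lambda>t. w (fst (prod_decode t))) t
      = arm_length r' (\<lambda>t. w' (fst (prod_decode t))) t"
    using ev by (auto simp: eventually_sequentially)
  have eq: "r * (1 + w j) = r' * (1 + w' j)" for j
    using T[of "prod_encode (j, T)"] le_prod_encode_2[of T j] by (simp add: arm_length_def)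
  \<comment> \<open>Index 0 carries the value 0 on both sides and so reveals \<open>r\<close>, which
    then cancels at all other indices.\<close>
  have "r = r'" using eq[of 0] assms by simp
  then show ?thesis using eq \<open>r > 0\<close> by (auto simp: fun_eq_iff)
qed

text \<open>There are infinitely many indices of pieces but only finitely many different unscaled
  spaces, so bounds per space become uniform.\<close>

lemma finite_range_uniform_bound:
  fixes P :: "'z \<Rightarrow> 'n::linorder \<Rightarrow> bool"
  assumes "finite (range f)" "\<And>k. \<exists>N. P (f k) N" "\<And>Z N N'. P Z N \<Longrightarrow> N \<le> N' \<Longrightarrow> P Z N'"
  shows "\<exists>N. \<forall>k. P (f k) N"
proof -
  have "\<forall>Z\<in>range f. \<exists>N. P Z N" using assms(2) by blast
  then obtain g where g: "\<forall>Z\<in>range f. P Z (g Z)" using bchoice by blast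
  have "P (f k) (Max (g ` range f))" for k
    by (rule assms(3)[of _ "g (f k)"]) (use g assms(1) in auto)
  then show ?thesis by blast
qed

subsection \<open>Parameter functions and cardinalities\<close>

text \<open>By connectedness the distance from \<open>x\<close> attains every value in
  \<open>{0..d x y}\<close>, and points at different distances are different. The result says that
  \<open>'a\<close> is large enough to contain the arms.\<close>

lemma connected_space_imp_real_inj:
  fixes X :: "'a set"
  assumes "Metric_space X d" "connected_space (Metric_space.mtopology X d)"
    and xy: "x \<in> X" "y \<in> X" "x \<noteq> y"
  obtains g :: "real \<Rightarrow> 'a" where "inj g"
proof -
  interpret Metric_space X d by fact
  define r where "r = d x y"
  have r: "r > 0" using xy by (simp add: r_def)
  have "continuous_map mtopology euclideanreal (\<lambda>z. d x z)"
    using xy by (intro continuous_map_dist) auto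
  moreover have "connectedin mtopology X"
    using assms(2) connectedin_topspace[of mtopology] by simp
  ultimately have "connected (d x ` X)"
    using connectedin_continuous_map_image[of mtopology euclideanreal "d x" X] by simp
  moreover have "0 \<in> d x ` X" "r \<in> d x ` X" using xy by (force simp: r_def)+
  ultimately have sub: "{0..r} \<subseteq> d x ` X" by (intro connected_contains_Icc) auto
  \<comment> \<open>The map \<open>r / (1 + exp t)\<close> sends the reals injectively into that
    interval.\<close>
  define g where "g t = inv_into X (d x) (r / (1 + exp t))" for t :: real
  have in_r: "r / (1 + exp t) \<in> {0..r}" for t
    using r by (simp add: pos_divide_le_eq add_pos_pos less_imp_le)
  have "inj g"
  proof (rule injI)
    fix s t assume "g s = g t"
    then have "r / (1 + exp s) = r / (1 + exp t)"
      unfolding g_def by (rule inj_onD[OF inj_on_inv_into[OF sub] _ in_r in_r])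
    moreover have "1 + exp s > 0" "1 + exp t > 0" by (simp_all add: add_pos_pos)
    ultimately have "1 + exp s = 1 + exp t" using r by (simp add: frac_eq_eq)
    then show "s = t" by simp
  qed
  then show ?thesis using that by blast
qed

text \<open>An infinite type is equipotent with its square, and a countable index embeds in
  \<open>'a\<close> through the reals.\<close>

lemma real_inj_imp_Times_inj:
  fixes g :: "real \<Rightarrow> 'a"
  assumes "inj g"
  obtains G :: "'i::countable \<times> 'a \<Rightarrow> 'a" where "inj G"
proof -
  have "infinite (range g)" using assms finite_imageD infinite_UNIV_char_0 by blast
  then have "infinite (UNIV :: 'a set)" by (meson finite_subset subset_UNIV)
  then obtain f :: "'a \<times> 'a \<Rightarrow> 'a" where "bij_betw f (UNIV \<times> UNIV) UNIV"
    using card_of_Times_same_infinite card_of_ordIso by blast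
  then have f: "inj f" by (simp add: bij_betw_def)
  have "inj (\<lambda>(k :: 'i, y). f (g (real (to_nat k)), y))"
    by (rule injI) (auto dest!: injD[OF f] injD[OF assms])
  then show ?thesis using that by blast
qed

text \<open>Truncated distances to the points of a countable dense set. The slot 0 is kept
  constantly 0; it later calibrates the common factor of the arm lengths.\<close>

lemma (in Metric_space) compact_space_separating_functions:
  assumes comp: "compact_space mtopology" and "M \<noteq> {}"
  obtains u :: "nat \<Rightarrow> 'a \<Rightarrow> real" where "\<And>j. continuous_map mtopology euclideanreal (u j)"
    "\<And>j x. 0 \<le> u j x" "\<And>j x. u j x \<le> 1" "\<And>x. u 0 x = 0"
    "\<And>x y. x \<in> M \<Longrightarrow> y \<in> M \<Longrightarrow> (\<And>j. u j x = u j y) \<Longrightarrow> x = y"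
proof -
  have tb: "mtotally_bounded M"
    using comp compactin_imp_mtotally_bounded[of M] by (simp add: compact_space_def)
  have "\<exists>F. finite F \<and> F \<subseteq> M \<and> M \<subseteq> (\<Union>x\<in>F. mball x (inverse (real (Suc k))))" for k
    using tb[unfolded mtotally_bounded_def, THEN spec[of _ "inverse (real (Suc k))"]] by simp
  then obtain F where F: "\<And>k. finite (F k)" "\<And>k. F k \<subseteq> M"
    "\<And>k. M \<subseteq> (\<Union>x\<in>F k. mball x (inverse (real (Suc k))))" by metis
  define C where "C = (\<Union>k. F k)"
  have "countable C" using F(1) by (simp add: C_def countable_finite)
  moreover have "C \<noteq> {}" using F(3)[of 0] \<open>M \<noteq> {}\<close> by (auto simp: C_def)
  ultimately have "range (from_nat_into C) = C" by (simp add: range_from_nat_into)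
  then obtain c :: "nat \<Rightarrow> 'a" where c: "range c = C" by blast
  have cM: "c j \<in> M" for j using c F(2) unfolding C_def by blast
  define u where "u j x = (case j of 0 \<Rightarrow> 0 | Suc i \<Rightarrow> min 1 (d x (c i)))" for j x
  show ?thesis
  proof (rule that[of u])
    show "continuous_map mtopology euclideanreal (u j)" for j
    proof (cases j)
      case (Suc i)
      have "continuous_map mtopology euclideanreal (\<lambda>x. min 1 (d x (c i)))"
        using cM by (intro continuous_map_real_min continuous_map_dist) auto
      moreover have "u j = (\<lambda>x. min 1 (d x (c i)))" by (simp add: fun_eq_iff u_def Suc)
      ultimately show ?thesis by simp
    next
      case 0
      then have "u j = (\<lambda>x. 0)" by (simp add: fun_eq_iff u_def)
      then show ?thesis by simp
    qed
    show "0 \<le> u j x" "u j x \<le> 1" for j x by (auto simp: u_def split: nat.split)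
    show "u 0 x = 0" for x by (simp add: u_def)
    fix x y assume xy: "x \<in> M" "y \<in> M" and eq: "\<And>j. u j x = u j y"
    show "x = y"
    proof (rule ccontr)
      assume "x \<noteq> y"
      then have "0 < d x y" using xy by simp
      then obtain k where k: "inverse (real (Suc k)) < d x y / 2"
        using reals_Archimedean[of "d x y / 2"] by auto
      let ?e = "inverse (real (Suc k))"
      obtain z where z: "z \<in> F k" "d z x < ?e" using F(3)[of k] xy(1) by auto
      then have "z \<in> range c" using c unfolding C_def by blast
      then obtain i where "c i = z" by blast
      then have dx: "d x (c i) < ?e" using z(2) by (simp add: commute)
      have "min 1 (d x (c i)) = min 1 (d y (c i))" using eq[of "Suc i"] by (simp add: u_def)
      \<comment> \<open>Values below \<open>?e\<close> lie below the truncation level, so equality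
        of the truncated distances is equality of the distances.\<close>
      moreover have "?e \<le> 1" by (simp add: inverse_le_1_iff)
      ultimately have "d y (c i) < ?e" using dx by (simp add: min_def split: if_splits)
      then have "d x y < 2 * ?e" using dx triangle'[of x "c i" y] xy cM by simp
      then show False using k by simp
    qed
  qed
qed

text \<open>The data that steer the wedge over \<open>x\<close>: \<open>\<alpha> i x\<close> scales
  the \<open>i\<close>-th space, \<open>\<rho> x\<close> all arms, and \<open>u j x\<close>
  modulates their lengths. At a vertex \<open>v i\<close> only the \<open>i\<close>-th space
  survives, at scale 1. The bounds are asked for on the whole type, so the scales obey them without
  side conditions.\<close>

locale interpolation_system =
  fixes H :: "'h topology" and v :: "nat \<Rightarrow> 'h" and K :: "nat set"
    and \<rho> :: "'h \<Rightarrow> real" and \<alpha> :: "nat \<Rightarrow> 'h \<Rightarrow> real" and u :: "nat \<Rightarrow> 'h \<Rightarrow> real"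
  assumes \<rho>_cont: "continuous_map H euclideanreal \<rho>"
    and \<alpha>_cont: "\<And>i. continuous_map H euclideanreal (\<alpha> i)"
    and u_cont: "\<And>j. continuous_map H euclideanreal (u j)"
    and \<rho>_nonneg: "\<And>x. 0 \<le> \<rho> x" and \<rho>_le_1: "\<And>x. \<rho> x \<le> 1"
    and \<alpha>_nonneg: "\<And>i x. 0 \<le> \<alpha> i x" and \<alpha>_le_1: "\<And>i x. \<alpha> i x \<le> 1"
    and u_nonneg: "\<And>j x. 0 \<le> u j x" and u_le_1: "\<And>j x. u j x \<le> 1"
    and \<rho>_eq_0: "\<And>x. x \<in> topspace H \<Longrightarrow> \<rho> x = 0 \<longleftrightarrow> x \<in> v ` K"
    and \<alpha>_v: "\<And>i j. i \<in> K \<Longrightarrow> j \<in> K \<Longrightarrow> \<alpha> i (v j) = (if i = j then 1 else 0)"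
    and u_0: "\<And>x. u 0 x = 0"
    and u_separates: "\<And>x y. x \<in> topspace H \<Longrightarrow> y \<in> topspace H \<Longrightarrow> (\<And>j. u j x = u j y) \<Longrightarrow> x = y"

lemma interpolation_system_exists:
  fixes H :: "'h topology" and v :: "nat \<Rightarrow> 'h" and K :: "nat set"
  assumes H: "compact_space H" "metrizable_space H" and K: "finite K" "K \<noteq> {}"
    and v: "\<And>i. i \<in> K \<Longrightarrow> v i \<in> topspace H" and dist: "inj_on v K"
  obtains \<rho> \<alpha> u where "interpolation_system H v K \<rho> \<alpha> u"
proof -
  obtain M \<mu> where "Metric_space M \<mu>" and Heq: "H = Metric_space.mtopology M \<mu>"
    using H(2) unfolding metrizable_space_def by blast
  interpret Metric_space M \<mu> by fact
  have top: "topspace H = M" using Heq by simp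
  have "M \<noteq> {}" using v K(2) top by blast
  then obtain u where u: "\<And>j. continuous_map mtopology euclideanreal (u j)"
    "\<And>j x. 0 \<le> u j x" "\<And>j x. u j x \<le> (1::real)" "\<And>x. u (0::nat) x = 0"
    "\<And>x y. x \<in> M \<Longrightarrow> y \<in> M \<Longrightarrow> (\<And>j. u j x = u j y) \<Longrightarrow> x = y"
    using compact_space_separating_functions H(1) Heq by metis
  have vM: "v i \<in> M" if "i \<in> K" for i using v that top by blast
  have \<mu>_v: "continuous_map mtopology euclideanreal (\<lambda>x. \<mu> x (v i))" if "i \<in> K" for i
    using vM[OF that] by (intro continuous_map_dist) auto
  define \<rho> where "\<rho> x = (\<Prod>i\<in>K. min 1 (\<mu> x (v i)))" for x
  \<comment> \<open>Modelled on Lagrange interpolation: the factor for \<open>j\<close> vanishes at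
    \<open>v j\<close> and is 1 at \<open>v i\<close>; capping at 1 keeps the product in the unit
    interval.\<close>
  define \<alpha> where "\<alpha> i x = (\<Prod>j\<in>K - {i}. min 1 (\<mu> x (v j) * inverse (\<mu> (v i) (v j))))" for i x
  have "interpolation_system H v K \<rho> \<alpha> u"
  proof (rule interpolation_system.intro)
    show "continuous_map H euclideanreal \<rho>" unfolding \<rho>_def Heq
      by (intro continuous_map_prod continuous_map_real_min K \<mu>_v) auto
    show "continuous_map H euclideanreal (\<alpha> i)" for i unfolding \<alpha>_def Heq
      using K by (intro continuous_map_prod continuous_map_real_min continuous_map_real_mult \<mu>_v) auto
    show "0 \<le> \<rho> x" "\<rho> x \<le> 1" for x unfolding \<rho>_def by (auto intro!: prod_nonneg prod_le_1)
    show "0 \<le> \<alpha> i x" "\<alpha> i x \<le> 1" for i x unfolding \<alpha>_def by (auto intro!: prod_nonneg prod_le_1)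
    show "\<rho> x = 0 \<longleftrightarrow> x \<in> v ` K" if "x \<in> topspace H" for x
    proof -
      have "\<rho> x = 0 \<longleftrightarrow> (\<exists>i\<in>K. min 1 (\<mu> x (v i)) = 0)" unfolding \<rho>_def using K(1) by (rule prod_zero_iff)
      also have "\<dots> \<longleftrightarrow> (\<exists>i\<in>K. \<mu> x (v i) = 0)"
        by (intro bex_cong refl) (auto simp: min_def)
      also have "\<dots> \<longleftrightarrow> (\<exists>i\<in>K. x = v i)" using that vM top by auto
      finally show ?thesis by blast
    qed
    show "\<alpha> i (v j) = (if i = j then 1 else 0)" if "i \<in> K" "j \<in> K" for i j
    proof (cases "i = j")
      case True
      have "\<mu> (v j) (v l) \<noteq> 0" if "l \<in> K - {j}" for l
      proof -
        have "v j \<noteq> v l" using dist that \<open>j \<in> K\<close> by (auto simp: inj_on_def)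
        then show ?thesis using vM that \<open>j \<in> K\<close> by auto
      qed
      then have "\<alpha> j (v j) = (\<Prod>l\<in>K - {j}. 1)" unfolding \<alpha>_def by (intro prod.cong) auto
      then show ?thesis using True by simp
    next
      case False
      have "\<alpha> i (v j) = 0" unfolding \<alpha>_def
        by (rule prod_zero) (use K(1) that False vM in \<open>auto intro!: bexI[of _ j]\<close>)
      then show ?thesis using False by simp
    qed
  qed (use u Heq top in auto)
  then show ?thesis by (rule that)
qed

lemma continuous_maps_common_neighbourhood:
  assumes "finite F" "\<And>\<phi>. \<phi> \<in> F \<Longrightarrow> continuous_map H euclideanreal \<phi>" "x \<in> topspace H" "\<eta> > 0"
  obtains U where "openin H U" "x \<in> U" "\<And>\<phi> y. \<phi> \<in> F \<Longrightarrow> y \<in> U \<Longrightarrow> \<bar>\<phi> x - \<phi> y\<bar> < \<eta>"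
proof -
  define V where "V \<phi> = {y \<in> topspace H. \<phi> y \<in> ball (\<phi> x) \<eta>}" for \<phi> :: "'a \<Rightarrow> real"
  have V: "openin H (V \<phi>)" if "\<phi> \<in> F" for \<phi>
    unfolding V_def by (rule openin_continuous_map_preimage[OF assms(2)[OF that]]) simp
  have "openin H (topspace H \<inter> \<Inter>(V ` F))"
    using V assms(1) by (cases "F = {}") (auto intro: openin_Inter)
  then show ?thesis
    by (rule that) (use assms(3,4) in \<open>auto simp: V_def dist_real_def\<close>)
qed

subsection \<open>The embedding\<close>

theorem theorem1p1:
  fixes n :: nat
    and H :: "'h topology"
    and v :: "nat \<Rightarrow> 'h"
    and S :: "'a set \<Rightarrow> ('a \<Rightarrow> 'a \<Rightarrow> real) \<Rightarrow> bool"
    and X :: "nat \<Rightarrow> 'a set"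
    and d :: "nat \<Rightarrow> 'a \<Rightarrow> 'a \<Rightarrow> real"
  assumes "n \<ge> 1"
    and "compact_space H" and "metrizable_space H"
    and "\<forall>i\<in>{1..n+1}. v i \<in> topspace H"
    and "\<forall>i\<in>{1..n+1}. \<forall>j\<in>{1..n+1}. i \<noteq> j \<longrightarrow> v i \<noteq> v j"
    and "S \<in> {GH_connected, GH_path_connected, GH_geodesic, GH_CAT0}"
    and "\<forall>i\<in>{1..n+1}. S (X i) (d i)"
    and "\<forall>i\<in>{1..n+1}. \<forall>j\<in>{1..n+1}. i \<noteq> j \<longrightarrow> GH_dist (X i) (d i) (X j) (d j) > 0"
  shows "\<exists>\<Phi> :: 'h \<Rightarrow> 'a set \<times> ('a \<Rightarrow> 'a \<Rightarrow> real).
           GH_topological_embedding H S \<Phi> \<and>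
           (\<forall>i\<in>{1..n+1}. isometric (fst (\<Phi> (v i))) (snd (\<Phi> (v i))) (X i) (d i))"
proof -
  define K where "K = {1..n+1}"
  have K: "finite K" "1 \<in> K" "2 \<in> K" using assms(1) by (auto simp: K_def)
  note S = assms(6)
  have SX: "S (X i) (d i)" if "i \<in> K" for i using assms(7) that by (simp add: K_def)
  have GH: "in_GH_space Z e" if "S Z e" for Z e using GH_class_imp_in_GH_space[OF S that] .
  have GHX: "in_GH_space (X i) (d i)" if "i \<in> K" for i using GH[OF SX[OF that]] .
  have noniso: "\<not> isometric (X i) (d i) (X j) (d j)" if "i \<in> K" "j \<in> K" "i \<noteq> j" for i j
    using isometric_imp_GH_dist_nonpos[OF GHX GHX, of i j] assms(8) that by (force simp: K_def)

  \<comment> \<open>One-point spaces are isometric, so at least one of the given spaces has two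
    points; its connectedness makes \<open>'a\<close> large.\<close>
  have "\<exists>i\<in>K. \<exists>x\<in>X i. \<exists>y\<in>X i. x \<noteq> y"
  proof (rule ccontr)
    assume "\<not> ?thesis"
    then have trivial: "\<And>i x y. i \<in> K \<Longrightarrow> x \<in> X i \<Longrightarrow> y \<in> X i \<Longrightarrow> x = y" by blast
    obtain a b where ab: "a \<in> X 1" "b \<in> X 2" using GHX K by (force simp: in_GH_space_def)
    have "X 1 = {a}" "X 2 = {b}" using trivial ab K by blast+
    moreover have "d 1 a a = 0" "d 2 b b = 0"
      using GHX[of 1] GHX[of 2] K ab by (auto simp: in_GH_space_def Metric_space.mdist_zero)
    ultimately have "isometric (X 1) (d 1) (X 2) (d 2)"
      unfolding isometric_def by (intro exI[of _ "\<lambda>_. b"]) (simp add: bij_betw_def)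
    then show False using noniso[of 1 2] K by simp
  qed
  then obtain i0 x0 y0 where i0: "i0 \<in> K" "x0 \<in> X i0" "y0 \<in> X i0" "x0 \<noteq> y0" by blast
  obtain arm :: "real \<Rightarrow> 'a" where arm: "inj arm"
    using connected_space_imp_real_inj[OF _ GH_class_imp_connected_space[OF S SX[OF i0(1)]] i0(2-4)]
      GHX[OF i0(1)] by (auto simp: in_GH_space_def)
  obtain G :: "(nat + nat \<times> nat) \<times> 'a \<Rightarrow> 'a" where G: "inj G"
    using real_inj_imp_Times_inj[OF arm] by blast

  define a where "a x y = \<bar>inv arm x - inv arm y\<bar>" for x y
  have a_arm: "a (arm s) (arm t) = \<bar>s - t\<bar>" for s t by (simp add: a_def inv_f_f[OF arm])
  have "Metric_space (arm ` {0..1}) a"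
    by unfold_locales (auto simp: a_def inv_f_f[OF arm])
  moreover have "similarity 1 {0..1} dist (arm ` {0..1}) a arm"
    by (simp add: similarity_def a_arm dist_real_def)
  ultimately have S_arm: "S (arm ` {0..1}) a"
    using GH_CAT0_imp_GH_class[OF S] GH_CAT0_similarity[OF GH_CAT0_unit_interval] by blast

  \<comment> \<open>The locale wants a metric space at every index, so indices outside
    \<open>K\<close> repeat the first space. Their scale is always 0.\<close>
  define r where "r i = (if i \<in> K then i else 1)" for i
  have rK: "r i \<in> K" for i using K by (simp add: r_def)
  define Y where "Y k = (case k of Inl i \<Rightarrow> X (r i) | Inr l \<Rightarrow> arm ` {0..1})" for k :: "nat + nat \<times> nat"
  define m where "m k = (case k of Inl i \<Rightarrow> d (r i) | Inr l \<Rightarrow> a)" for k :: "nat + nat \<times> nat"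
  define p where "p k = (case k of Inl i \<Rightarrow> SOME x. x \<in> X (r i) | Inr l \<Rightarrow> arm 0)" for k :: "nat + nat \<times> nat"
  have SY: "S (Y k) (m k)" for k
    using SX[OF rK] S_arm by (cases k) (auto simp: Y_def m_def)
  have pY: "p k \<in> Y k" for k
    using GHX[OF rK] by (cases k) (auto simp: Y_def p_def in_GH_space_def some_in_eq)
  have finite_range: "finite (range (\<lambda>k. (Y k, m k)))"
  proof (rule finite_subset)
    show "range (\<lambda>k. (Y k, m k)) \<subseteq> insert (arm ` {0..1}, a) ((\<lambda>i. (X i, d i)) ` K)"
    proof
      fix Z assume "Z \<in> range (\<lambda>k. (Y k, m k))"
      then obtain k where "Z = (Y k, m k)" by blast
      then show "Z \<in> insert (arm ` {0..1}, a) ((\<lambda>i. (X i, d i)) ` K)"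
        using rK by (cases k) (auto simp only: Y_def m_def sum.case intro: insertI2 image_eqI)
    qed
  qed (use K in auto)
  define pack where "pack t Z N \<longleftrightarrow> (\<forall>B. B \<subseteq> fst Z \<longrightarrow> separated (2 * (1/16) ^ t) (snd Z) B \<longrightarrow>
      finite B \<and> card B \<le> N)" for t N :: nat and Z :: "'a set \<times> ('a \<Rightarrow> 'a \<Rightarrow> real)"
  have "\<exists>N. \<forall>k. pack t (Y k, m k) N" for t
  proof (rule finite_range_uniform_bound[OF finite_range])
    show "\<exists>N. pack t (Y k, m k) N" for k
    proof -
      have "(0::real) < (1/16) ^ t" by simp
      from in_GH_space_packing[OF GH[OF SY[of k]] this] show ?thesis
        unfolding pack_def fst_conv snd_conv by (metis (no_types, lifting))
    qed
    show "pack t Z N'" if "pack t Z N" "N \<le> N'" for Z N N'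
      using that unfolding pack_def by (meson order_trans)
  qed
  then obtain N where N: "\<And>t k. pack t (Y k, m k) (N t)" by metis
  define M where "M t = card K * N t + N t + 2" for t
  define k0 :: "nat + nat \<times> nat" where "k0 = Inl 1"
  interpret armed_wedge Y m p G k0 arm K N M
  proof unfold_locales
    show "inj G" by fact
    show "0 \<le> m k x y" "m k x y = m k y x" for k x y
      using GH[OF SY[of k]] by (auto simp: in_GH_space_def Metric_space.nonneg intro: Metric_space.commute)
    show "m k x y = 0 \<longleftrightarrow> x = y" if "x \<in> Y k" "y \<in> Y k" for k x y
      using GH[OF SY[of k]] that by (auto simp: in_GH_space_def Metric_space.zero)
    show "m k x z \<le> m k x y + m k y z" if "x \<in> Y k" "y \<in> Y k" "z \<in> Y k" for k x y z
      using GH[OF SY[of k]] that by (auto simp: in_GH_space_def Metric_space.triangle)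
    show "p k \<in> Y k" for k by (rule pY)
    show "Y (Inr l) = arm ` {0..1}" for l by (simp add: Y_def)
    show "m (Inr l) (arm s) (arm t) = \<bar>s - t\<bar>" for l s t by (simp add: m_def a_arm)
    show "p (Inr l) = arm 0" for l by (simp add: p_def)
    show "finite K" by fact
    show "finite B \<and> card B \<le> N t" if "B \<subseteq> Y k" "separated (2 * (1/16) ^ t) (m k) B" for B k t
      using N[of t k] that by (simp add: pack_def)
    show "card K * N t + N t + 2 \<le> M t" for t by (simp add: M_def)
  qed

  define bdd where "bdd Z \<Delta> \<longleftrightarrow> 0 < \<Delta> \<and> (\<forall>y\<in>fst Z. \<forall>z\<in>fst Z. snd Z y z \<le> \<Delta>)"
    for Z :: "'a set \<times> ('a \<Rightarrow> 'a \<Rightarrow> real)" and \<Delta> :: real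
  have "\<exists>\<Delta>. \<forall>k. bdd (Y k, m k) \<Delta>"
  proof (rule finite_range_uniform_bound[OF finite_range])
    show "\<exists>\<Delta>. bdd (Y k, m k) \<Delta>" for k
      using in_GH_space_bounded[OF GH[OF SY[of k]]] unfolding bdd_def fst_conv snd_conv by metis
    show "bdd Z \<Delta>'" if "bdd Z \<Delta>" "\<Delta> \<le> \<Delta>'" for Z \<Delta> \<Delta>'
      using that unfolding bdd_def by force
  qed
  then obtain \<Delta> where \<Delta>: "\<And>k. bdd (Y k, m k) \<Delta>" by blast
  have bound: "m k y z \<le> \<Delta>" if "y \<in> Y k" "z \<in> Y k" for k y z
    using \<Delta>[of k] that by (simp add: bdd_def)
  have "\<Delta> > 0" using \<Delta>[of k0] by (simp add: bdd_def)

  have vH: "v i \<in> topspace H" if "i \<in> K" for i using assms(4) that by (simp add: K_def)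
  have inj_v: "inj_on v K" using assms(5) unfolding inj_on_def K_def by blast
  have "K \<noteq> {}" using K by blast
  obtain \<rho> \<alpha> u where "interpolation_system H v K \<rho> \<alpha> u"
    using interpolation_system_exists[OF assms(2,3) K(1) \<open>K \<noteq> {}\<close> _ inj_v] vH by blast
  then interpret interpolation_system H v K \<rho> \<alpha> u .
  define \<sigma> where "\<sigma> x = arm_length (\<rho> x) (\<lambda>t. u (fst (prod_decode t)) x)" for x
  define sc where "sc x = scales (\<lambda>i. \<alpha> i x) (\<sigma> x)" for x
  define \<Phi> where "\<Phi> x = (wcar (sc x), wdist (sc x))" for x

  have \<sigma>b: "0 \<le> \<sigma> x t" "\<sigma> x t \<le> (1/4) ^ t" and \<sigma>dec: "decseq (\<sigma> x)" and \<sigma>lim: "\<sigma> x \<longlonglongrightarrow> 0" for x t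
    unfolding \<sigma>_def
    using arm_length_bounds[of "\<rho> x"] decseq_arm_length[of "\<rho> x"] arm_length_tendsto_0[of "\<rho> x"] \<rho>_nonneg \<rho>_le_1 u_nonneg u_le_1
    by auto
  have \<sigma>pos: "0 < \<sigma> x t" if "0 < \<rho> x" for x t
    unfolding \<sigma>_def
    using arm_length_bounds(1)[of "\<rho> x" "\<lambda>t. u (fst (prod_decode t)) x" t] \<rho>_nonneg \<rho>_le_1 u_nonneg u_le_1 that
    by (smt (verit, best) divide_pos_pos mult_pos_pos zero_less_power)
  have sc_nonneg: "0 \<le> sc x k" and sc_le: "sc x k \<le> 1" for x k
  proof -
    have "\<sigma> x t \<le> 1" for t using \<sigma>b(2)[of x t] power_le_one[of "1/4::real" t] by simp
    then show "0 \<le> sc x k" "sc x k \<le> 1"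
      using \<alpha>_nonneg \<alpha>_le_1 \<sigma>b(1) by (cases k; auto simp: sc_def split: prod.split)+
  qed
  \<comment> \<open>The wedge is never empty: a vertex keeps its own space, and any other point has
    arms of positive length.\<close>
  have sc_pos: "\<exists>k. 0 < sc x k" if x: "x \<in> topspace H" for x
  proof (cases "\<rho> x = 0")
    case True
    then obtain i where "i \<in> K" "x = v i" using \<rho>_eq_0[OF x] by blast
    then have "0 < sc x (Inl i)" using \<alpha>_v by (simp add: sc_def)
    then show ?thesis by blast
  next
    case False
    then have "0 < \<rho> x" using \<rho>_nonneg[of x] by simp
    then have "0 < sc x (Inr (0, 0))" using \<sigma>pos by (simp add: sc_def M_def)
    then show ?thesis by blast
  qed
  have sc_finite: "finite {k. \<epsilon> \<le> sc x k}" if \<epsilon>: "\<epsilon> > 0" for x \<epsilon>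
  proof -
    obtain T where T: "(1/4) ^ T < \<epsilon>" using real_arch_pow_inv[OF \<epsilon>, of "1/4"] by auto
    have "k \<in> Inl ` K \<union> Inr ` (SIGMA j:{..<T}. {..<M j})" if k: "\<epsilon> \<le> sc x k" for k
    proof (cases k)
      case (Inl i)
      then show ?thesis using k \<open>\<epsilon> > 0\<close> by (auto simp: sc_def split: if_splits)
    next
      case (Inr l)
      obtain j i where l: "l = (j, i)" by force
      have i: "i < M j" "\<epsilon> \<le> \<sigma> x j" using k \<open>\<epsilon> > 0\<close> Inr l by (auto simp: sc_def split: if_splits)
      have "j < T"
      proof (rule ccontr)
        assume "\<not> j < T"
        then have "(1/4 :: real) ^ j \<le> (1/4) ^ T" by (intro power_decreasing) auto
        then show False using i(2) \<sigma>b(2)[of x j] T by linarith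
      qed
      then show ?thesis using i Inr l by auto
    qed
    then have "{k. \<epsilon> \<le> sc x k} \<subseteq> Inl ` K \<union> Inr ` (SIGMA j:{..<T}. {..<M j})" by blast
    then show ?thesis by (rule finite_subset) (use K in auto)
  qed
  have S\<Phi>: "S (fst (\<Phi> x)) (snd (\<Phi> x))" if "x \<in> topspace H" for x
    unfolding \<Phi>_def fst_conv snd_conv
    by (rule GH_class_wcar[OF S SY sc_nonneg sc_pos[OF that] bound \<open>\<Delta> > 0\<close> sc_finite])

  \<comment> \<open>At \<open>v i\<close> all scales are 0 except that of the \<open>i\<close>-th
    space, which is 1; what remains is a coded copy of \<open>X i\<close>.\<close>
  have iso_v: "isometric (wcar (sc (v i))) (wdist (sc (v i))) (X i) (d i)" if i: "i \<in> K" for i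
  proof -
    have "\<rho> (v i) = 0" using \<rho>_eq_0[OF vH[OF i]] i by blast
    then have sc: "sc (v i) k = (if k = Inl i then 1 else 0)" for k
      using \<alpha>_v i by (cases k) (auto simp: sc_def \<sigma>_def arm_length_def scales_def)
    then have "wcar (sc (v i)) = E (Inl i) ` X i"
      using i by (simp add: wcar_def Y_def r_def)
    moreover have "bij_betw (E (Inl i)) (X i) (E (Inl i) ` X i)"
      by (auto simp: bij_betw_def inj_on_def E_eq_iff)
    moreover have "wdist (sc (v i)) (E (Inl i) x) (E (Inl i) y) = d i x y" for x y
      using i by (simp add: wdist_E sc m_def r_def)
    ultimately have "isometric (X i) (d i) (wcar (sc (v i))) (wdist (sc (v i)))"
      unfolding isometric_def by auto
    then show ?thesis by (rule isometric_sym)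
  qed

  have le: "eventually (\<lambda>t. \<sigma> x t \<le> \<sigma> y t) sequentially"
    if "isometric (wcar (sc x)) (wdist (sc x)) (wcar (sc y)) (wdist (sc y))" "0 < \<rho> x" for x y
  proof (rule isometric_scales_le[where \<alpha> = "\<lambda>i. \<alpha> i x" and \<alpha>' = "\<lambda>i. \<alpha> i y"])
    show "0 \<le> scales (\<lambda>i. \<alpha> i x) (\<sigma> x) k" "scales (\<lambda>i. \<alpha> i x) (\<sigma> x) k \<le> 1"
      "0 \<le> scales (\<lambda>i. \<alpha> i y) (\<sigma> y) k" "scales (\<lambda>i. \<alpha> i y) (\<sigma> y) k \<le> 1" for k
      using sc_nonneg sc_le unfolding sc_def by blast+
    show "eventually (\<lambda>t. (1/16) ^ t \<le> \<sigma> x t) sequentially"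
      unfolding \<sigma>_def by (intro arm_length_eventually_ge that(2) \<rho>_le_1 u_nonneg u_le_1)
    show "isometric (wcar (scales (\<lambda>i. \<alpha> i x) (\<sigma> x))) (wdist (scales (\<lambda>i. \<alpha> i x) (\<sigma> x)))
        (wcar (scales (\<lambda>i. \<alpha> i y) (\<sigma> y))) (wdist (scales (\<lambda>i. \<alpha> i y) (\<sigma> y)))"
      using that(1) unfolding sc_def .
  qed (rule \<sigma>pos[OF that(2)] \<sigma>dec \<sigma>lim)+
  \<comment> \<open>A wedge with arms is not isometric to one without: at a zero of
    \<open>\<rho>\<close> all arm lengths are 0 and cannot dominate positive ones.\<close>
  have both_pos: "0 < \<rho> y"
    if iso: "isometric (wcar (sc x)) (wdist (sc x)) (wcar (sc y)) (wdist (sc y))" "0 < \<rho> x" for x y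
  proof (rule ccontr)
    assume "\<not> 0 < \<rho> y"
    then have "\<sigma> y t = 0" for t using \<rho>_nonneg[of y] by (simp add: \<sigma>_def arm_length_def)
    moreover obtain t where "\<sigma> x t \<le> \<sigma> y t"
      using le[OF iso] by (auto simp: eventually_sequentially)
    ultimately show False using \<sigma>pos[OF iso(2), of t] by simp
  qed
  have inj: "x = y" if x: "x \<in> topspace H" and y: "y \<in> topspace H"
    and iso: "isometric (wcar (sc x)) (wdist (sc x)) (wcar (sc y)) (wdist (sc y))" for x y
  proof (cases "\<rho> x = 0")
    case False
    then have px: "0 < \<rho> x" using \<rho>_nonneg[of x] by simp
    then have py: "0 < \<rho> y" using both_pos iso by blast
    \<comment> \<open>The isometry and its inverse each give one inequality.\<close>
    have "eventually (\<lambda>t. \<sigma> x t = \<sigma> y t) sequentially"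
      using le[OF iso px] le[OF isometric_sym[OF iso] py] by eventually_elim simp
    then have "(\<lambda>j. u j x) = (\<lambda>j. u j y)"
      unfolding \<sigma>_def using px u_0
      by (intro arm_length_eventually_eq[where w = "\<lambda>j. u j x" and w' = "\<lambda>j. u j y"]) auto
    then show ?thesis using u_separates[OF x y] by (simp add: fun_eq_iff)
  next
    case True
    then have "\<rho> y = 0" using both_pos[OF isometric_sym[OF iso]] \<rho>_nonneg[of y] by force
    then obtain i j where ij: "i \<in> K" "x = v i" "j \<in> K" "y = v j" using True \<rho>_eq_0 x y by blast
    \<comment> \<open>Both points are vertices, where the wedges are the given spaces; here the
      positive Gromov-Hausdorff distances separate them.\<close>
    have "isometric (X i) (d i) (X j) (d j)"
      using isometric_trans[OF isometric_trans[OF isometric_sym[OF iso_v[OF ij(1)]]] iso_v[OF ij(3)]]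
        iso ij by simp
    then have "i = j" using noniso ij by blast
    then show ?thesis using ij by simp
  qed

  have close: "\<exists>U. openin H U \<and> x \<in> U \<and>
      (\<forall>y\<in>U. GH_close \<epsilon> (fst (\<Phi> x)) (snd (\<Phi> x)) (fst (\<Phi> y)) (snd (\<Phi> y)))"
    if x: "x \<in> topspace H" and "\<epsilon> > 0" for x \<epsilon>
  proof -
    define \<eta> where "\<eta> = \<epsilon> / (2 * \<Delta>)"
    have \<eta>: "\<eta> > 0" "2 * (\<eta> * \<Delta>) = \<epsilon>" using \<open>\<epsilon> > 0\<close> \<open>\<Delta> > 0\<close> by (auto simp: \<eta>_def)
    obtain T where T: "(1/4) ^ T < \<eta>" using real_arch_pow_inv[OF \<eta>(1), of "1/4"] by auto
    have \<sigma>_cont: "continuous_map H euclideanreal (\<lambda>x. \<sigma> x t)" for t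
      unfolding \<sigma>_def arm_length_def divide_inverse
      by (intro continuous_map_real_mult continuous_map_add \<rho>_cont u_cont) auto
    \<comment> \<open>Finitely many functions suffice: from level \<open>T\<close> on both arm
      lengths lie between 0 and \<open>(1/4) ^ T\<close>, hence differ by less than
      \<open>\<eta>\<close> automatically.\<close>
    define F where "F = \<alpha> ` K \<union> (\<lambda>t x. \<sigma> x t) ` {..<T}"
    have "finite F" using K by (simp add: F_def)
    moreover have "continuous_map H euclideanreal \<phi>" if "\<phi> \<in> F" for \<phi>
      using that \<alpha>_cont \<sigma>_cont unfolding F_def by blast
    ultimately obtain U where U: "openin H U" "x \<in> U"
      "\<And>\<phi> y. \<phi> \<in> F \<Longrightarrow> y \<in> U \<Longrightarrow> \<bar>\<phi> x - \<phi> y\<bar> < \<eta>"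
      using continuous_maps_common_neighbourhood[OF _ _ x \<eta>(1)] by metis
    have "GH_close \<epsilon> (wcar (sc x)) (wdist (sc x)) (wcar (sc y)) (wdist (sc y))" if y: "y \<in> U" for y
      unfolding \<eta>(2)[symmetric]
    proof (rule GH_close_wcar[OF sc_nonneg sc_pos[OF x] sc_nonneg sc_pos _ bound])
      show "y \<in> topspace H" using U(1) y openin_subset by blast
      have \<sigma>_near: "\<bar>\<sigma> x t - \<sigma> y t\<bar> \<le> \<eta>" for t
      proof (cases "t < T")
        case True
        then have "(\<lambda>x. \<sigma> x t) \<in> F" by (simp add: F_def)
        then show ?thesis using U(3) y by fastforce
      next
        case False
        then have "(1/4 :: real) ^ t \<le> (1/4) ^ T" by (intro power_decreasing) auto
        then show ?thesis using \<sigma>b[of x t] \<sigma>b[of y t] T by linarith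
      qed
      have \<alpha>_near: "\<bar>\<alpha> i x - \<alpha> i y\<bar> \<le> \<eta>" if "i \<in> K" for i
        using U(3)[of "\<alpha> i" y] that y by (simp add: F_def less_imp_le)
      show "\<bar>sc x k - sc y k\<bar> \<le> \<eta>" for k
        using \<alpha>_near \<sigma>_near \<eta>(1) by (cases k) (auto simp: sc_def less_imp_le split: prod.split)
    qed
    then show ?thesis using U(1,2) by (auto simp: \<Phi>_def)
  qed

  have "GH_topological_embedding H S \<Phi>"
  proof (rule GH_topological_embedding_compact)
    show "\<not> isometric (fst (\<Phi> x)) (snd (\<Phi> x)) (fst (\<Phi> y)) (snd (\<Phi> y))"
      if "x \<in> topspace H" "y \<in> topspace H" "x \<noteq> y" for x y
      using inj that by (auto simp: \<Phi>_def)
  qed (fact assms(2) S\<Phi> GH close)+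
  moreover have "\<forall>i\<in>{1..n+1}. isometric (fst (\<Phi> (v i))) (snd (\<Phi> (v i))) (X i) (d i)"
    using iso_v by (simp add: \<Phi>_def K_def)
  ultimately show ?thesis by blast
qed

end
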